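(* Let $W$ be a Weyl group of type ADE, i.e. $(W,S)$ is a finite Coxeter system with $m_{st}\le 3$ for all $s,t\in S$. Then for any $x,y\in W$ with $x<y$ in the Bruhat order we have $d_{x,y}=g_{x,y}$, where $d_{x,y}$ is the negative of the coefficient of $q^{\ell(y)-\ell(x)-1}$ in the $R$-polynomial $R_{x,y}(q)$ and $g_{x,y}$ is the minimal cardinality of a diamond generating subset of the set $E_{x,y}$ of edges of the Bruhat graph restricted to $[x,y]$.
   Context: Let $(W,S)$ be a Coxeter system; $m_{st}$ is the order of $st$; $\ell$ is the length function, $\le$ the Bruhat order, $T=\bigcup_{w\in W}wSw^{-1}$ the set of reflections, and $[x,y]=\{z\in W: x\le z\le y\}$. $R$-polynomials: the unique family $\{R_{x,y}(q)\}_{x,y\in W}\subset\mathbb{Z}[q]$ with $R_{x,x}=1$, $R_{x,y}=0$ if $x\not\le y$, and for every $s\in S$ with $ys<y$: $R_{x,y}=R_{xs,ys}$ if $xs<x$, and $R_{x,y}=qR_{xs,ys}+(q-1)R_{x,ys}$ if $xs>x$. For $x\le y$, $R_{x,y}$ is monic of degree $\ell(y)-\ell(x)$, and $d_{x,y}\in\mathbb{Z}$ is defined by $R_{x,y}(q)=q^{\ell(y)-\ell(x)}-d_{x,y}q^{\ell(y)-\ell(x)-1}+(\text{lower terms in } q)$. Diamonds: let $\mathcal{G}|_{[x,y]}$ be the undirected graph with vertex set $[x,y]$ in which $z$ and $w$ are joined by an edge $(z - w)$ iff $w=zt$ for some $t\in T$ (no condition on the length difference). Let $E_{x,y}$ be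 its set of edges. A diamond is a $4$-cycle in $\mathcal{G}|_{[x,y]}$, consisting of four edges between four different vertices. A subset $F\subseteq E_{x,y}$ is diamond closed if, whenever two adjacent edges (i.e. two edges sharing a vertex) of a diamond lie in $F$, the other two edges of this diamond also lie in $F$. The diamond closure $F^\diamond$ is the smallest diamond closed subset of $E_{x,y}$ containing $F$. $F$ is diamond generating if $F^\diamond=E_{x,y}$. Finally $g_{x,y}:=\min\{|F| : F\subseteq E_{x,y}\text{ diamond generating}\}$. *)

theory Defs
  imports
    "HOL-Algebra.Multiplicative_Group"
    "HOL-Computational_Algebra.Polynomial"
begin

(* The congruence on words over S generated by the relations (s t)^m ~ 1, where m is the order of
   s t in G.  For s = t this is s s ~ 1, so that the quotient of the free monoid on S by this
   congruence is the group presented by generators S and these relations.  The value ord = 0 of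
   an element of infinite order contributes no relation. *)
inductive coxeter_eq :: "('a, 'b) monoid_scheme \<Rightarrow> 'a set \<Rightarrow> 'a list \<Rightarrow> 'a list \<Rightarrow> bool"
  for G :: "('a, 'b) monoid_scheme" and S :: "'a set"
where
  relation: "\<lbrakk>u \<in> lists S; v \<in> lists S; s \<in> S; t \<in> S\<rbrakk> \<Longrightarrow>
    coxeter_eq G S (u @ concat (replicate (group.ord G (s \<otimes>\<^bsub>G\<^esub> t)) [s, t]) @ v) (u @ v)"
| refl: "u \<in> lists S \<Longrightarrow> coxeter_eq G S u u"
| sym: "coxeter_eq G S u v \<Longrightarrow> coxeter_eq G S v u"
| trans: "\<lbrakk>coxeter_eq G S u v; coxeter_eq G S v w\<rbrakk> \<Longrightarrow> coxeter_eq G S u w"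

locale coxeter_system = group G for G (structure) +
  fixes S :: "'a set"
  assumes generators_closed: "S \<subseteq> carrier G"
    and generators_ord: "s \<in> S \<Longrightarrow> ord s = 2"
    and generators_generate: "generate G S = carrier G"
    and presentation:
      "\<lbrakk>u \<in> lists S; v \<in> lists S; foldr (\<otimes>) u \<one> = foldr (\<otimes>) v \<one>\<rbrakk> \<Longrightarrow> coxeter_eq G S u v"
begin

definition len :: "'a \<Rightarrow> nat" where
  "len w = (LEAST n. \<exists>u \<in> lists S. length u = n \<and> foldr (\<otimes>) u \<one> = w)"

definition reflections :: "'a set" where
  "reflections = {w \<otimes> s \<otimes> inv w | w s. w \<in> carrier G \<and> s \<in> S}"

definition bruhat_step :: "'a \<Rightarrow> 'a \<Rightarrow> bool" where
  "bruhat_step x y \<longleftrightarrow>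
     x \<in> carrier G \<and> y \<in> carrier G \<and> (\<exists>t \<in> reflections. y = x \<otimes> t) \<and> len x < len y"

definition bruhat_le :: "'a \<Rightarrow> 'a \<Rightarrow> bool" where
  "bruhat_le x y \<longleftrightarrow> x \<in> carrier G \<and> y \<in> carrier G \<and> bruhat_step\<^sup>*\<^sup>* x y"

definition bruhat_less :: "'a \<Rightarrow> 'a \<Rightarrow> bool" where
  "bruhat_less x y \<longleftrightarrow> bruhat_le x y \<and> x \<noteq> y"

definition bruhat_interval :: "'a \<Rightarrow> 'a \<Rightarrow> 'a set" where
  "bruhat_interval x y = {z. bruhat_le x z \<and> bruhat_le z y}"

(* In the second clause x and y range over the whole type: outside carrier G the relation
   bruhat_le is false, so R is normalized to 0 there and can be unique as a function.
   The polynomial [:0, 1:] is q and [:-1, 1:] is q - 1. *)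
definition is_R_family :: "('a \<Rightarrow> 'a \<Rightarrow> int poly) \<Rightarrow> bool" where
  "is_R_family R \<longleftrightarrow>
     (\<forall>x \<in> carrier G. R x x = 1) \<and>
     (\<forall>x y. \<not> bruhat_le x y \<longrightarrow> R x y = 0) \<and>
     (\<forall>x \<in> carrier G. \<forall>y \<in> carrier G. \<forall>s \<in> S. bruhat_less (y \<otimes> s) y \<longrightarrow>
        (bruhat_less (x \<otimes> s) x \<longrightarrow> R x y = R (x \<otimes> s) (y \<otimes> s)) \<and>
        (bruhat_less x (x \<otimes> s) \<longrightarrow>
           R x y = [:0, 1:] * R (x \<otimes> s) (y \<otimes> s) + [:-1, 1:] * R x (y \<otimes> s)))"

definition R_poly :: "'a \<Rightarrow> 'a \<Rightarrow> int poly" where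
  "R_poly = (THE R. is_R_family R)"

(* Meaningful for x < y in Bruhat order, where len y - len x is at least 1 and the natural
   number subtraction does not truncate. *)
definition d_coeff :: "'a \<Rightarrow> 'a \<Rightarrow> int" where
  "d_coeff x y = - Polynomial.coeff (R_poly x y) (len y - len x - 1)"

definition bruhat_edges :: "'a \<Rightarrow> 'a \<Rightarrow> 'a set set" where
  "bruhat_edges x y =
     {{z, w} | z w. z \<in> bruhat_interval x y \<and> w \<in> bruhat_interval x y \<and>
                    (\<exists>t \<in> reflections. w = z \<otimes> t)}"

definition is_diamond :: "'a \<Rightarrow> 'a \<Rightarrow> 'a \<Rightarrow> 'a \<Rightarrow> 'a \<Rightarrow> 'a \<Rightarrow> bool" where
  "is_diamond x y a b c d \<longleftrightarrow> distinct [a, b, c, d] \<and>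
     {{a, b}, {b, c}, {c, d}, {d, a}} \<subseteq> bruhat_edges x y"

(* Every pair of adjacent edges of a diamond has the form {a, b}, {b, c} after rotating the
   labelling of the 4-cycle. *)
definition diamond_closed :: "'a \<Rightarrow> 'a \<Rightarrow> 'a set set \<Rightarrow> bool" where
  "diamond_closed x y F \<longleftrightarrow> F \<subseteq> bruhat_edges x y \<and>
     (\<forall>a b c d. is_diamond x y a b c d \<and> {a, b} \<in> F \<and> {b, c} \<in> F \<longrightarrow>
        {c, d} \<in> F \<and> {d, a} \<in> F)"

definition diamond_closure :: "'a \<Rightarrow> 'a \<Rightarrow> 'a set set \<Rightarrow> 'a set set" where
  "diamond_closure x y F = \<Inter> {F'. diamond_closed x y F' \<and> F \<subseteq> F'}"

definition diamond_generating :: "'a \<Rightarrow> 'a \<Rightarrow> 'a set set \<Rightarrow> bool" where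
  "diamond_generating x y F \<longleftrightarrow>
     F \<subseteq> bruhat_edges x y \<and> diamond_closure x y F = bruhat_edges x y"

(* Bruhat intervals are finite, so card is the true cardinality here. *)
definition g_min :: "'a \<Rightarrow> 'a \<Rightarrow> nat" where
  "g_min x y = (LEAST n. \<exists>F. diamond_generating x y F \<and> card F = n)"

end

end

theory Submission
  imports Defs "HOL-Library.Function_Algebras"
begin

text \<open>
  Work with the roots of the geometric representation, so that an edge of the Bruhat graph at \<open>z\<close> is
  labelled by a root \<open>z b\<close> up to sign. Write \<open>d(x, y)\<close> for the coefficient. It satisfies
  \<open>d(x, y) = d(x s, y s)\<close> for a common descent \<open>s\<close>, and
  \<open>d(x, y) = d(x, y s) + 1 - [x s \<le> y s]\<close> if \<open>x < x s\<close> and \<open>y s < y\<close>.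

  Upper bound: let \<open>g\<close> be a minimal positive root with \<open>x g > 0 > y g\<close> and let \<open>u\<close> be \<open>x\<close> times
  the reflection in \<open>g\<close>. Stripping common descents makes \<open>g\<close> a simple root, so \<open>u\<close> covers \<open>x\<close> and
  \<open>d(x, y)\<close> is \<open>d(u, y)\<close> or \<open>d(u, y) + 1\<close>. The edge \<open>{x, u}\<close> and the edges above \<open>u\<close> generate all
  edges, and in the first case a ladder of diamonds generates \<open>{x, u}\<close> from the edges above \<open>u\<close>.

  Lower bound: consider the vector valued functions \<open>f\<close> on the interval such that \<open>f z - f w\<close> is
  a multiple of the label of \<open>{z, w}\<close> for each edge. The edges along which \<open>f\<close> is constant form a
  diamond closed set, because labels of two edges at a vertex are independent. Hence \<open>f\<close> is constant
  if it is so along a generating set. Each edge imposes one linear condition, so a generating set has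
  at least as many edges as the dimension of the space of these functions modulo constants, and by
  the recursion for \<open>d\<close> this dimension is at least \<open>d(x, y)\<close>.
\<close>

section \<open>Words and length\<close>

text \<open>Not every common descent may be stripped. A common descent \<open>s\<close> of
  \<open>x\<close> and \<open>y\<close> is good only if \<open>g\<close> stays minimal and
  \<open>s\<close> is also a descent of \<open>x \<otimes> rf g\<close> and
  \<open>y \<otimes> rf g\<close>; then right multiplication carries the edges by \<open>g\<close>
  over with additive lengths. A good \<open>s\<close> pairs to \<open>1\<close> or \<open>0\<close>
  with \<open>g\<close>, or to \<open>-1\<close> under an extra sign condition. It is found as the
  centre of a star of type A2, A3 or D4 inside \<open>g\<close>. Four arms would give pairing
  \<open>-2\<close>, which different positive roots of a finite simply laced system never have. The
  rungs of the ladder are known to stay inside the interval only where lengths are additive. The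
  chain of rungs therefore runs through a generalized quotient. In the lower bound the difficult
  case is again a common descent \<open>s\<close>, since \<open>[x s, y s]\<close> and
  \<open>[x, y]\<close> need not be isomorphic. Functions are extended from
  \<open>[x s, y s]\<close> to \<open>[x s, y]\<close> and restricted to \<open>[x, y]\<close>. That
  the restriction loses nothing is once more the ladder, so the generation argument of the upper
  bound also enters the lower bound.\<close>

locale simply_laced = coxeter_system G S for G (structure) and S +
  assumes fin: "finite (carrier G)"
    and ord_le_3: "\<lbrakk>s \<in> S; t \<in> S\<rbrakk> \<Longrightarrow> ord (s \<otimes> t) \<le> 3"
begin

definition wd :: "'a list \<Rightarrow> 'a" where "wd u = foldr (\<otimes>) u \<one>"

lemma wd_simps [simp]: "wd [] = \<one>" "wd (a # u) = a \<otimes> wd u"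
  by (auto simp: wd_def)

lemma len_wd: "len w = (LEAST n. \<exists>u \<in> lists S. length u = n \<and> wd u = w)"
  by (simp add: len_def wd_def)

lemma S_carr [simp]: "s \<in> S \<Longrightarrow> s \<in> carrier G"
  using generators_closed by auto

lemma finS: "finite S"
  using fin generators_closed finite_subset by blast

lemma S_sq:
  assumes s: "s \<in> S"
  shows "s \<otimes> s = \<one>"
proof -
  have "s [^] (2::nat) = \<one>" using pow_ord_eq_1[of s] generators_ord[OF s] s by simp
  then show ?thesis using s by (simp add: numeral_2_eq_2)
qed

lemma S_inv: "s \<in> S \<Longrightarrow> inv s = s"
  using S_sq inv_equality by simp

lemma S_ne_one: "s \<in> S \<Longrightarrow> s \<noteq> \<one>"
  using generators_ord ord_eq_1 by force

lemma mult_SS [simp]: "\<lbrakk>x \<in> carrier G; s \<in> S\<rbrakk> \<Longrightarrow> x \<otimes> s \<otimes> s = x"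
  by (simp add: m_assoc S_sq)

lemma mult_SS_left [simp]: "\<lbrakk>x \<in> carrier G; s \<in> S\<rbrakk> \<Longrightarrow> s \<otimes> (s \<otimes> x) = x"
  by (simp add: m_assoc[symmetric] S_sq)

lemma wd_carr [simp]: "u \<in> lists S \<Longrightarrow> wd u \<in> carrier G"
  by (induct u) auto

lemma wd_append: "\<lbrakk>u \<in> lists S; v \<in> lists S\<rbrakk> \<Longrightarrow> wd (u @ v) = wd u \<otimes> wd v"
  by (induct u) (auto simp: m_assoc)

lemma wd_rev: "u \<in> lists S \<Longrightarrow> wd (rev u) = inv (wd u)"
proof (induct u)
  case (Cons a u)
  then have *: "a \<in> S" "u \<in> lists S" by auto
  have "wd (rev (a # u)) = wd (rev u) \<otimes> wd [a]" using wd_append[of "rev u" "[a]"] * by (simp add: in_lists_conv_set)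
  then show ?case using Cons * by (simp add: inv_mult_group S_inv)
qed simp

lemma ex_word: "w \<in> carrier G \<Longrightarrow> \<exists>u \<in> lists S. wd u = w"
proof -
  assume "w \<in> carrier G"
  then have "w \<in> generate G S" using generators_generate by simp
  then show ?thesis
  proof (induct w rule: generate.induct)
    case one
    then show ?case by (intro bexI[of _ "[]"]) auto
  next
    case (incl h)
    then show ?case by (intro bexI[of _ "[h]"]) auto
  next
    case (inv h)
    then show ?case by (intro bexI[of _ "[h]"]) (auto simp: S_inv)
  next
    case (eng h1 h2)
    then obtain u v where "u \<in> lists S" "v \<in> lists S" "wd u = h1" "wd v = h2" by auto
    then show ?case by (intro bexI[of _ "u @ v"]) (auto simp: wd_append)
  qed
qed

lemma len_le: "u \<in> lists S \<Longrightarrow> len (wd u) \<le> length u"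
  unfolding len_wd by (rule Least_le) auto

lemma len_word: "w \<in> carrier G \<Longrightarrow> \<exists>u \<in> lists S. length u = len w \<and> wd u = w"
proof -
  assume "w \<in> carrier G"
  then obtain u where "u \<in> lists S" "wd u = w" using ex_word by blast
  then have "\<exists>n. \<exists>u\<in>lists S. length u = n \<and> wd u = w" by blast
  from LeastI_ex[OF this] show ?thesis unfolding len_wd by auto
qed

lemma len_one [simp]: "len \<one> = 0"
  using len_le[of "[]"] by simp

lemma len_mult:
  assumes a: "x \<in> carrier G" "y \<in> carrier G"
  shows "len (x \<otimes> y) \<le> len x + len y"
proof -
  obtain u v where uv: "u \<in> lists S" "v \<in> lists S" "length u = len x" "length v = len y" "wd u = x" "wd v = y"
    using len_word[OF a(1)] len_word[OF a(2)] by auto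
  have "len (wd (u @ v)) \<le> length (u @ v)" using uv by (intro len_le) auto
  then show ?thesis using uv by (simp add: wd_append)
qed

lemma len_inv [simp]: "x \<in> carrier G \<Longrightarrow> len (inv x) = len x"
proof -
  have *: "len (inv x) \<le> len x" if x: "x \<in> carrier G" for x
  proof -
    obtain u where u: "u \<in> lists S" "length u = len x" "wd u = x" using len_word[OF x] by auto
    have "len (wd (rev u)) \<le> length (rev u)" using u by (intro len_le) auto
    then show ?thesis using u wd_rev[of u] by simp
  qed
  assume "x \<in> carrier G"
  then show ?thesis using *[of x] *[of "inv x"] by simp
qed

lemma len_S: "s \<in> S \<Longrightarrow> len s \<le> 1"
  using len_le[of "[s]"] by simp

lemma len_eq_0: "x \<in> carrier G \<Longrightarrow> len x = 0 \<Longrightarrow> x = \<one>"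
  using len_word[of x] by auto

text \<open>Every defining relation has even length, so parity survives the presentation. Hence
  multiplication by a generator always changes the length.\<close>

lemma coxeter_eq_parity: "coxeter_eq G S u v \<Longrightarrow> even (length u) = even (length v)"
proof (induct rule: coxeter_eq.induct)
  case (relation u v s t)
  have "length (concat (replicate n [s, t])) = 2 * n" for n by (induct n) auto
  then show ?case by simp
qed auto

lemma parity:
  assumes u: "u \<in> lists S"
  shows "even (len (wd u)) = even (length u)"
proof -
  obtain v where v: "v \<in> lists S" "length v = len (wd u)" "wd v = wd u" using len_word[of "wd u"] u by auto
  show ?thesis using coxeter_eq_parity[OF presentation[OF v(1) u v(3)[unfolded wd_def]]] v by simp
qed

lemma len_parity:
  assumes a: "x \<in> carrier G" "y \<in> carrier G"
  shows "even (len (x \<otimes> y)) = (even (len x) = even (len y))"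
proof -
  obtain u v where uv: "u \<in> lists S" "v \<in> lists S" "wd u = x" "wd v = y"
    using ex_word[OF a(1)] ex_word[OF a(2)] by auto
  have "even (len (wd (u @ v))) = even (length (u @ v))" using uv by (intro parity) auto
  then show ?thesis using uv parity[of u] parity[of v] by (auto simp: wd_append)
qed

lemma len_S1: "s \<in> S \<Longrightarrow> len s = 1"
  using len_S[of s] len_eq_0[of s] S_ne_one[of s] by (cases "len s") auto

lemma len_step:
  assumes a: "x \<in> carrier G" "s \<in> S"
  shows "len (x \<otimes> s) = len x + 1 \<or> len x = len (x \<otimes> s) + 1"
proof -
  have 1: "len (x \<otimes> s) \<le> len x + 1" using len_mult[of x s] len_S1 a by simp
  have 2: "len x \<le> len (x \<otimes> s) + 1" using len_mult[of "x \<otimes> s" s] len_S1 a by simp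
  have 3: "len (x \<otimes> s) \<noteq> len x" using len_parity[of x s] len_S1[of s] a by auto
  show ?thesis using 1 2 3 by linarith
qed

lemma len_gt: "\<lbrakk>x \<in> carrier G; s \<in> S\<rbrakk> \<Longrightarrow> \<not> len (x \<otimes> s) < len x \<longleftrightarrow> len x < len (x \<otimes> s)"
  using len_step by force

lemma ex_descent:
  assumes x: "x \<in> carrier G" "x \<noteq> \<one>"
  shows "\<exists>s \<in> S. len (x \<otimes> s) < len x"
proof -
  obtain u where u: "u \<in> lists S" "length u = len x" "wd u = x" using len_word[OF x(1)] by auto
  then have "u \<noteq> []" using x by auto
  then obtain v s where v: "u = v @ [s]" by (metis rev_exhaust)
  then have s: "s \<in> S" "v \<in> lists S" using u by auto
  have xe: "x = wd v \<otimes> s" using u v s wd_append[of v "[s]"] by auto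
  have "x \<otimes> s = wd v" using xe s by simp
  then have "len (x \<otimes> s) < len x" using len_le[OF s(2)] u v by simp
  then show ?thesis using s by blast
qed

lemma len_induct [consumes 1, case_names one step]:
  assumes "x \<in> carrier G" "P \<one>"
    and "\<And>x s. \<lbrakk>x \<in> carrier G; s \<in> S; len x < len (x \<otimes> s); P x\<rbrakk> \<Longrightarrow> P (x \<otimes> s)"
  shows "P x"
  using assms(1)
proof (induct "len x" arbitrary: x rule: less_induct)
  case less
  show ?case
  proof (cases "x = \<one>")
    case False
    then obtain s where s: "s \<in> S" "len (x \<otimes> s) < len x" using ex_descent less by blast
    then have "P (x \<otimes> s)" using less by simp
    then have "P (x \<otimes> s \<otimes> s)" using s less(2) assms(3)[of "x \<otimes> s" s] by simp
    then show ?thesis using s less(2) by simp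
  qed (simp add: assms(2))
qed

section \<open>Products of two generators\<close>

lemma ord_pos: "x \<in> carrier G \<Longrightarrow> 1 \<le> ord x"
  using ord_ge_1[OF fin] by blast

lemma ord_SS:
  assumes a: "s \<in> S" "t \<in> S" "s \<noteq> t"
  shows "ord (s \<otimes> t) = 2 \<or> ord (s \<otimes> t) = 3"
proof -
  have "s \<otimes> t \<noteq> \<one>" using a S_inv[of t] inv_equality[of s t] by auto
  then have "ord (s \<otimes> t) \<noteq> 1" using ord_eq_1[of "s \<otimes> t"] a by auto
  then show ?thesis using ord_pos[of "s \<otimes> t"] ord_le_3[OF a(1,2)] a by force
qed

lemma ord_SS_sym: "\<lbrakk>s \<in> S; t \<in> S\<rbrakk> \<Longrightarrow> ord (s \<otimes> t) = ord (t \<otimes> s)"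
  using ord_inv[of "s \<otimes> t"] by (simp add: inv_mult_group S_inv)

lemma comm2:
  assumes a: "s \<in> S" "t \<in> S" "ord (s \<otimes> t) = 2"
  shows "s \<otimes> t = t \<otimes> s"
proof -
  have "(s \<otimes> t) [^] (2::nat) = \<one>" using pow_ord_eq_1[of "s \<otimes> t"] a by simp
  then have "(s \<otimes> t) \<otimes> (s \<otimes> t) = \<one>" using a by (simp add: numeral_2_eq_2)
  then have "inv (s \<otimes> t) = s \<otimes> t" using a by (simp add: inv_equality)
  then show ?thesis using a by (simp add: inv_mult_group S_inv)
qed

lemma braid3:
  assumes a: "s \<in> S" "t \<in> S" "ord (s \<otimes> t) = 3"
  shows "s \<otimes> t \<otimes> s = t \<otimes> s \<otimes> t"
proof -
  have "(s \<otimes> t) [^] (3::nat) = \<one>" using pow_ord_eq_1[of "s \<otimes> t"] a by simp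
  then have "(s \<otimes> t \<otimes> s) \<otimes> (t \<otimes> s \<otimes> t) = \<one>" using a by (simp add: numeral_3_eq_3 m_assoc)
  then have "inv (t \<otimes> s \<otimes> t) = s \<otimes> t \<otimes> s" using a by (simp add: inv_equality)
  then show ?thesis using a by (simp add: inv_mult_group S_inv m_assoc)
qed

section \<open>The geometric representation\<close>


text \<open>Vectors are coordinate functions with respect to the simple roots \<open>al s\<close>; \<open>co s\<close> is the coroot,
  \<open>sr s\<close> the simple reflection and \<open>bf\<close> the invariant form.\<close>

definition cart :: "'a \<Rightarrow> 'a \<Rightarrow> int" where
  "cart s t = (if s = t then 2 else if ord (s \<otimes> t) = 2 then 0 else -1)"

definition al :: "'a \<Rightarrow> 'a \<Rightarrow> int" where "al s = (\<lambda>t. if t = s then 1 else 0)"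

definition sc :: "int \<Rightarrow> ('a \<Rightarrow> int) \<Rightarrow> 'a \<Rightarrow> int" where "sc c v = (\<lambda>t. c * v t)"

definition co :: "'a \<Rightarrow> ('a \<Rightarrow> int) \<Rightarrow> int" where "co s v = (\<Sum>t\<in>S. cart s t * v t)"

definition sr :: "'a \<Rightarrow> ('a \<Rightarrow> int) \<Rightarrow> 'a \<Rightarrow> int" where "sr s v = v - sc (co s v) (al s)"

definition bf :: "('a \<Rightarrow> int) \<Rightarrow> ('a \<Rightarrow> int) \<Rightarrow> int" where "bf u v = (\<Sum>s\<in>S. u s * co s v)"

lemma cart_sym: "\<lbrakk>s \<in> S; t \<in> S\<rbrakk> \<Longrightarrow> cart s t = cart t s"
  using ord_SS_sym by (auto simp: cart_def)

lemma cart_self [simp]: "cart s s = 2" by (simp add: cart_def)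

lemma co_al [simp]: "t \<in> S \<Longrightarrow> co s (al t) = cart s t"
  using finS by (simp add: co_def al_def if_distrib [of "\<lambda>x. _ * x"] cong: if_cong)

lemma co_add [simp]: "co s (u + v) = co s u + co s v"
  by (simp add: co_def distrib_left sum.distrib)

lemma co_diff [simp]: "co s (u - v) = co s u - co s v"
  by (simp add: co_def right_diff_distrib sum_subtractf)

lemma co_sc [simp]: "co s (sc c v) = c * co s v"
  by (simp add: co_def sc_def sum_distrib_left mult.left_commute)

lemma co_uminus [simp]: "co s (- v) = - co s v"
  by (simp add: co_def sum_negf)

lemma sc_add2: "sc (c + d) v = sc c v + sc d v" by (auto simp: sc_def distrib_right)
lemma sc_diff: "sc c (u - v) = sc c u - sc c v" by (auto simp: sc_def right_diff_distrib)
lemma sc_diff2: "sc (c - d) v = sc c v - sc d v" by (auto simp: sc_def left_diff_distrib)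
lemma sc_sc [simp]: "sc c (sc d v) = sc (c * d) v" by (auto simp: sc_def mult.assoc)
lemma sc_simps [simp]: "sc 0 v = 0" "sc 1 v = v" "sc (-1) v = - v" "sc c 0 = 0" by (auto simp: sc_def)
lemma sc_minus: "sc (- c) v = - sc c v" "sc c (- v) = - sc c v" by (auto simp: sc_def)

lemma bf_al [simp]: "s \<in> S \<Longrightarrow> bf (al s) v = co s v"
  using finS by (simp add: bf_def al_def if_distrib [of "\<lambda>x. x * _"] cong: if_cong)

lemma bf_sym: "bf u v = bf v u"
proof -
  have "bf u v = (\<Sum>s\<in>S. \<Sum>t\<in>S. cart s t * u s * v t)"
    by (simp add: bf_def co_def sum_distrib_left mult_ac)
  also have "\<dots> = (\<Sum>t\<in>S. \<Sum>s\<in>S. cart s t * u s * v t)" by (rule sum.swap)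
  also have "\<dots> = (\<Sum>t\<in>S. \<Sum>s\<in>S. cart t s * u s * v t)"
    using cart_sym by (intro sum.cong) auto
  also have "\<dots> = bf v u" by (simp add: bf_def co_def sum_distrib_left mult_ac)
  finally show ?thesis .
qed

lemma bf_lin [simp]:
  "bf u (v + w) = bf u v + bf u w" "bf u (v - w) = bf u v - bf u w" "bf u (sc c v) = c * bf u v" "bf u (- v) = - bf u v"
  by (simp_all add: bf_def distrib_left right_diff_distrib sum.distrib sum_subtractf sum_distrib_left mult.left_commute sum_negf)

lemma bf_lin2 [simp]:
  "bf (v + w) u = bf v u + bf w u" "bf (v - w) u = bf v u - bf w u" "bf (sc c v) u = c * bf v u" "bf (- v) u = - bf v u"
  by (simp_all add: bf_sym[of _ u])

lemma sr_lin: "sr s (u + v) = sr s u + sr s v" "sr s (u - v) = sr s u - sr s v" "sr s (sc c v) = sc c (sr s v)"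
  "sr s (- v) = - sr s v"
  by (simp_all add: sr_def sc_add2 sc_diff2 sc_diff sc_minus)

lemma sr_sr [simp]: "s \<in> S \<Longrightarrow> sr s (sr s v) = v"
  by (simp add: sr_def sc_diff2[symmetric] flip: sc_add2) (simp add: sc_def fun_eq_iff)

lemma sr_al: "t \<in> S \<Longrightarrow> sr s (al t) = al t - sc (cart s t) (al s)"
  by (simp add: sr_def)

lemma sr_al_self [simp]: "s \<in> S \<Longrightarrow> sr s (al s) = - al s"
  by (auto simp: sr_al sc_def)

lemma bf_sr: "s \<in> S \<Longrightarrow> bf (sr s u) (sr s v) = bf u v"
  by (simp add: sr_def bf_sym[of u "al s"] algebra_simps)

lemma sr_comm: "\<lbrakk>s \<in> S; t \<in> S; cart s t = 0\<rbrakk> \<Longrightarrow> sr s (sr t v) = sr t (sr s v)"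
  using cart_sym[of s t] by (simp add: sr_def)

lemma sr_braid: "\<lbrakk>s \<in> S; t \<in> S; cart s t = -1\<rbrakk> \<Longrightarrow> sr s (sr t (sr s v)) = sr t (sr s (sr t v))"
  using cart_sym[of s t] by (simp add: sr_def) (simp add: sc_def fun_eq_iff algebra_simps)

lemma foldr_sr_relation:
  assumes "s \<in> S" "t \<in> S"
  shows "foldr sr (concat (replicate (ord (s \<otimes> t)) [s, t])) v = v"
proof (cases "s = t")
  case True
  then have "ord (s \<otimes> t) = 1" using assms S_sq ord_eq_1[of "s \<otimes> t"] by simp
  then show ?thesis using True assms by simp
next
  case False
  then consider "ord (s \<otimes> t) = 2" | "ord (s \<otimes> t) = 3" using ord_SS assms by blast
  then show ?thesis
  proof cases
    case 1
    then have "cart s t = 0" using False by (simp add: cart_def)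
    then show ?thesis using 1 assms sr_comm[of s t] by (simp add: numeral_2_eq_2)
  next
    case 2
    then have "cart s t = -1" using False by (simp add: cart_def)
    then show ?thesis using 2 assms sr_braid[of s t] by (simp add: numeral_3_eq_3)
  qed
qed

lemma coxeter_eq_sr: "coxeter_eq G S u v \<Longrightarrow> foldr sr u = foldr sr v"
  by (induct rule: coxeter_eq.induct) (auto simp: fun_eq_iff foldr_sr_relation)

text \<open>Any word for \<open>w\<close> gives the same map: two such words are equivalent by the
  presentation, and the simple reflections satisfy the relations.\<close>

definition act :: "'a \<Rightarrow> ('a \<Rightarrow> int) \<Rightarrow> 'a \<Rightarrow> int" where
  "act w = foldr sr (SOME u. u \<in> lists S \<and> wd u = w)"

lemma act_wd:
  assumes u: "u \<in> lists S"
  shows "act (wd u) = foldr sr u"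
proof -
  let ?v = "SOME v. v \<in> lists S \<and> wd v = wd u"
  have v: "?v \<in> lists S \<and> wd ?v = wd u" by (rule someI[of _ u]) (simp add: u del: in_lists_conv_set)
  then show ?thesis unfolding act_def using coxeter_eq_sr presentation u by (metis wd_def)
qed

lemma act_one [simp]: "act \<one> v = v"
  using act_wd[of "[]"] by (simp add: fun_eq_iff)

lemma act_S [simp]: "s \<in> S \<Longrightarrow> act s v = sr s v"
  using act_wd[of "[s]"] by (simp add: fun_eq_iff)

lemma act_mult [simp]:
  assumes a: "x \<in> carrier G" "y \<in> carrier G"
  shows "act (x \<otimes> y) v = act x (act y v)"
proof -
  obtain u w where uv: "u \<in> lists S" "w \<in> lists S" "wd u = x" "wd w = y"
    using ex_word[OF a(1)] ex_word[OF a(2)] by auto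
  have "act (wd (u @ w)) = foldr sr (u @ w)" using uv by (intro act_wd) auto
  then have "act (x \<otimes> y) = foldr sr u \<circ> foldr sr w" using uv wd_append[of u w] by (simp add: fun_eq_iff)
  then show ?thesis using uv act_wd[of u] act_wd[of w] by simp
qed

lemma act_inv [simp]: "x \<in> carrier G \<Longrightarrow> act (inv x) (act x v) = v" "x \<in> carrier G \<Longrightarrow> act x (act (inv x) v) = v"
  by (simp_all flip: act_mult)

lemma act_lin: assumes "x \<in> carrier G" shows "act x (u + v) = act x u + act x v" "act x (u - v) = act x u - act x v"
  "act x (sc c v) = sc c (act x v)" "act x (- v) = - act x v"
proof -
  obtain w where w: "w \<in> lists S" "wd w = x" using ex_word[OF assms] by auto
  have "foldr sr w (u + v) = foldr sr w u + foldr sr w v \<and> foldr sr w (u - v) = foldr sr w u - foldr sr w v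
    \<and> foldr sr w (sc c v) = sc c (foldr sr w v) \<and> foldr sr w (- v) = - foldr sr w v"
  proof (induct w)
    case (Cons a w)
    then show ?case by (simp only: foldr_Cons comp_apply sr_lin)
  qed simp
  then show "act x (u + v) = act x u + act x v" "act x (u - v) = act x u - act x v"
  "act x (sc c v) = sc c (act x v)" "act x (- v) = - act x v" using w act_wd[of w] by auto
qed

lemma bf_act: "x \<in> carrier G \<Longrightarrow> bf (act x u) (act x v) = bf u v"
proof (induct arbitrary: u v rule: len_induct)
  case (step x s)
  then show ?case by (simp add: bf_sr)
qed simp

section \<open>Roots and reflections\<close>


definition pos :: "('a \<Rightarrow> int) \<Rightarrow> bool" where "pos v \<longleftrightarrow> (\<forall>t. 0 \<le> v t) \<and> (\<exists>t. 0 < v t)"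

abbreviation neg :: "('a \<Rightarrow> int) \<Rightarrow> bool" where "neg v \<equiv> pos (- v)"

lemma pos_add: "pos u \<Longrightarrow> pos v \<Longrightarrow> pos (u + v)"
  unfolding pos_def by (auto intro: add_nonneg_pos add_pos_nonneg)

lemma neg_add: "neg u \<Longrightarrow> neg v \<Longrightarrow> neg (u + v)"
  using pos_add[of "-u" "-v"] by simp

lemma pos_not_neg: "pos v \<Longrightarrow> \<not> neg v"
  unfolding pos_def by (metis neg_0_less_iff_less not_less uminus_apply)

lemma pos_al: "pos (al s)"
  by (auto simp: pos_def al_def)

definition Rt :: "('a \<Rightarrow> int) set" where "Rt = {act w (al s) | w s. w \<in> carrier G \<and> s \<in> S}"

definition PR :: "('a \<Rightarrow> int) set" where "PR = {b \<in> Rt. pos b}"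

text \<open>Split off a descent \<open>t\<close>, so \<open>x = y t\<close>. Then
  \<open>x (al s)\<close> is \<open>y (al s)\<close>, plus \<open>y (al t)\<close> if
  \<open>s\<close> and \<open>t\<close> do not commute, and these are positive unless
  \<open>s\<close> is a descent of \<open>y\<close>. In that case \<open>x = z s t\<close>.
  Commuting generators would make \<open>x s\<close> too short, and in the braid case
  \<open>x (al s) = z (al t)\<close> where \<open>t\<close> is an ascent of
  \<open>z\<close>.\<close>

lemma act_al_pos: "\<lbrakk>x \<in> carrier G; s \<in> S; len x < len (x \<otimes> s)\<rbrakk> \<Longrightarrow> pos (act x (al s))"
proof (induct "len x" arbitrary: x s rule: less_induct)
  case less
  show ?case
  proof (cases "x = \<one>")
    case True
    then show ?thesis using less pos_al by simp
  next
    case False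
    then obtain t where t: "t \<in> S" "len (x \<otimes> t) < len x" using ex_descent less.prems by blast
    have st: "s \<noteq> t" using t less.prems by auto
    define y where "y = x \<otimes> t"
    have y: "y \<in> carrier G" "x = y \<otimes> t" "len x = len y + 1"
      using t less.prems len_step[of x t] by (auto simp: y_def)
    have c: "cart t s = 0 \<or> cart t s = -1" using st by (auto simp: cart_def)
    have xs: "act x (al s) = act y (al s) - sc (cart t s) (act y (al t))"
      using y t less.prems by (simp add: sr_al act_lin)
    have yt: "pos (act y (al t))" using less.hyps[of y t] y t less.prems by simp
    show ?thesis
    proof (cases "len y < len (y \<otimes> s)")
      case True
      then have "pos (act y (al s))" using less.hyps[of y s] y less.prems by simp
      then show ?thesis using c yt xs pos_add by auto
    next
      case False
      define z where "z = y \<otimes> s"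
      have z: "z \<in> carrier G" "y = z \<otimes> s" "len y = len z + 1"
        using False y less.prems len_step[of y s] by (auto simp: z_def)
      have xz: "x = z \<otimes> s \<otimes> t" using y z by simp
      have n2: "ord (s \<otimes> t) \<noteq> 2"
      proof
        assume "ord (s \<otimes> t) = 2"
        then have "s \<otimes> t = t \<otimes> s" using comm2 t(1) less.prems(2) by blast
        then have "x = z \<otimes> t \<otimes> s" using xz z t less.prems by (simp add: m_assoc)
        then have "x \<otimes> s = z \<otimes> t" using z t less.prems by simp
        then have "len (x \<otimes> s) \<le> len z + 1" using len_step[of z t] z t by auto
        then show False using y z less.prems by simp
      qed
      then have o3: "ord (s \<otimes> t) = 3" using ord_SS st t less.prems by blast
      have c3: "cart t s = -1" "cart s t = -1"
        using st o3 n2 cart_sym[of t s] t less.prems by (auto simp: cart_def)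
      have xa: "act x (al s) = act z (al t)"
        using xz z t less c3 by (simp add: sr_al sr_lin act_lin)
      have "len z < len (z \<otimes> t)"
      proof (rule ccontr)
        assume "\<not> len z < len (z \<otimes> t)"
        then have l: "len z = len (z \<otimes> t) + 1" using len_step[of z t] z t by auto
        have "x = z \<otimes> t \<otimes> (t \<otimes> s \<otimes> t)" using xz z t less.prems by (simp add: m_assoc)
        also have "\<dots> = z \<otimes> t \<otimes> (s \<otimes> t \<otimes> s)" by (simp only: braid3[OF less.prems(2) t(1) o3])
        finally have "x \<otimes> s = z \<otimes> t \<otimes> s \<otimes> t" using z t less.prems by (simp add: m_assoc S_sq)
        then have "len (x \<otimes> s) \<le> len (z \<otimes> t) + 1 + 1"
          using len_step[of "z \<otimes> t" s] len_step[of "z \<otimes> t \<otimes> s" t] z t less.prems by auto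
        then show False using l y z less.prems by simp
      qed
      then show ?thesis using xa less.hyps[of z t] z y t by simp
    qed
  qed
qed

lemma act_al_neg: "\<lbrakk>x \<in> carrier G; s \<in> S; len (x \<otimes> s) < len x\<rbrakk> \<Longrightarrow> neg (act x (al s))"
  using act_al_pos[of "x \<otimes> s" s] by (simp add: act_lin)

lemma act_al_iff: "\<lbrakk>x \<in> carrier G; s \<in> S\<rbrakk> \<Longrightarrow> pos (act x (al s)) \<longleftrightarrow> len x < len (x \<otimes> s)"
  "\<lbrakk>x \<in> carrier G; s \<in> S\<rbrakk> \<Longrightarrow> neg (act x (al s)) \<longleftrightarrow> len (x \<otimes> s) < len x"
  using act_al_pos[of x s] act_al_neg[of x s] len_step[of x s] pos_not_neg[of "act x (al s)"] by linarith+

lemma Rt_al [simp]: "s \<in> S \<Longrightarrow> al s \<in> Rt"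
  unfolding Rt_def by (intro CollectI exI[of _ \<one>] exI[of _ s]) simp

lemma Rt_act [simp]: "x \<in> carrier G \<Longrightarrow> b \<in> Rt \<Longrightarrow> act x b \<in> Rt"
proof -
  assume x: "x \<in> carrier G" and "b \<in> Rt"
  then obtain w s where "b = act w (al s)" "w \<in> carrier G" "s \<in> S" by (auto simp: Rt_def)
  then show ?thesis using x unfolding Rt_def by (intro CollectI exI[of _ "x \<otimes> w"] exI[of _ s]) simp
qed

lemma Rt_uminus [simp]: "- b \<in> Rt \<longleftrightarrow> b \<in> Rt"
proof -
  have "- b \<in> Rt" if b: "b \<in> Rt" for b
  proof -
    obtain w s where b: "b = act w (al s)" "w \<in> carrier G" "s \<in> S" using b by (auto simp: Rt_def)
    have "act (w \<otimes> s) (al s) = - b" using b by (simp add: act_lin)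
    then show ?thesis using b Rt_act[of "w \<otimes> s" "al s"] by simp
  qed
  from this[of b] this[of "-b"] show ?thesis by auto
qed

lemma Rt_cases: "b \<in> Rt \<Longrightarrow> pos b \<or> neg b"
  unfolding Rt_def using act_al_iff len_step by force

lemma bf_Rt: "b \<in> Rt \<Longrightarrow> bf b b = 2"
  unfolding Rt_def by (auto simp: bf_act)

lemma PR_al [simp]: "s \<in> S \<Longrightarrow> al s \<in> PR"
  by (simp add: PR_def pos_al)

lemma PR_Rt: "b \<in> PR \<Longrightarrow> b \<in> Rt" by (simp add: PR_def)
lemma PR_pos: "b \<in> PR \<Longrightarrow> pos b" by (simp add: PR_def)

lemma Rt_support: "b \<in> Rt \<Longrightarrow> t \<notin> S \<Longrightarrow> b t = 0"
proof -
  assume "b \<in> Rt" "t \<notin> S"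
  then obtain w s where b: "b = act w (al s)" "w \<in> carrier G" "s \<in> S" by (auto simp: Rt_def)
  have "act w v t = v t" for v using b(2) \<open>t \<notin> S\<close>
  proof (induct arbitrary: v rule: len_induct)
    case (step x s)
    then show ?case by (auto simp: sr_def sc_def al_def)
  qed simp
  then show ?thesis using b \<open>t \<notin> S\<close> by (auto simp: al_def)
qed

text \<open>A nontrivial element has a descent \<open>s\<close> and so makes \<open>al s\<close>
  negative.\<close>

lemma act_faithful:
  assumes a: "x \<in> carrier G" "y \<in> carrier G" "\<And>b. b \<in> Rt \<Longrightarrow> act x b = act y b"
  shows "x = y"
proof -
  have "inv x \<otimes> y = \<one>"
  proof (rule ccontr)
    assume "inv x \<otimes> y \<noteq> \<one>"
    then obtain s where s: "s \<in> S" "len (inv x \<otimes> y \<otimes> s) < len (inv x \<otimes> y)" using ex_descent a by blast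
    then have "neg (act (inv x \<otimes> y) (al s))" using a act_al_iff(2)[of "inv x \<otimes> y" s] by (simp del: act_mult)
    moreover have "act (inv x \<otimes> y) (al s) = al s" using a s by (simp flip: a(3))
    ultimately show False using pos_al pos_not_neg by metis
  qed
  then show ?thesis using a by (metis inv_closed inv_equality inv_inv)
qed

text \<open>The conjugate acts by \<open>v - bf b v * b\<close>, which depends only on
  \<open>b\<close>, and the representation is faithful. So the choice of \<open>w\<close> and
  \<open>s\<close> does not matter.\<close>

definition rf :: "('a \<Rightarrow> int) \<Rightarrow> 'a" where
  "rf b = (SOME t. \<exists>w s. w \<in> carrier G \<and> s \<in> S \<and> b = act w (al s) \<and> t = w \<otimes> s \<otimes> inv w)"

lemma act_conj:
  assumes a: "w \<in> carrier G" "s \<in> S"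
  shows "act (w \<otimes> s \<otimes> inv w) v = v - sc (bf (act w (al s)) v) (act w (al s))"
proof -
  have "bf (act w (al s)) v = bf (act w (al s)) (act w (act (inv w) v))" using a by simp
  also have "\<dots> = co s (act (inv w) v)" using a by (simp only: bf_act bf_al)
  finally show ?thesis using a by (simp add: sr_def act_lin)
qed

lemma rf_eq:
  assumes a: "w \<in> carrier G" "s \<in> S"
  shows "rf (act w (al s)) = w \<otimes> s \<otimes> inv w"
proof -
  let ?P = "\<lambda>t. \<exists>w' s'. w' \<in> carrier G \<and> s' \<in> S \<and> act w (al s) = act w' (al s') \<and> t = w' \<otimes> s' \<otimes> inv w'"
  have "?P (rf (act w (al s)))" unfolding rf_def by (rule someI_ex) (use a in blast)
  then obtain w' s' where w': "w' \<in> carrier G" "s' \<in> S" "act w (al s) = act w' (al s')"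
    "rf (act w (al s)) = w' \<otimes> s' \<otimes> inv w'" by blast
  have "w' \<otimes> s' \<otimes> inv w' = w \<otimes> s \<otimes> inv w"
    by (rule act_faithful) (use a w' in \<open>simp_all only: act_conj m_closed inv_closed S_carr\<close>)
  then show ?thesis using w' by simp
qed

lemma rf_al [simp]: "s \<in> S \<Longrightarrow> rf (al s) = s"
  using rf_eq[of \<one> s] by simp

lemma rf_carr [simp]: "b \<in> Rt \<Longrightarrow> rf b \<in> carrier G"
  unfolding Rt_def by (auto simp: rf_eq)

lemma act_rf: "b \<in> Rt \<Longrightarrow> act (rf b) v = v - sc (bf b v) b"
  unfolding Rt_def by (auto simp: rf_eq act_conj simp del: act_mult)

lemma rf_sq [simp]: "b \<in> Rt \<Longrightarrow> rf b \<otimes> rf b = \<one>"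
proof -
  assume "b \<in> Rt"
  then obtain w s where b: "b = act w (al s)" "w \<in> carrier G" "s \<in> S" by (auto simp: Rt_def)
  have "w \<otimes> s \<otimes> inv w \<otimes> (w \<otimes> s \<otimes> inv w) = w \<otimes> (s \<otimes> ((inv w \<otimes> w) \<otimes> s)) \<otimes> inv w"
    using b by (simp only: m_assoc m_closed inv_closed S_carr)
  also have "\<dots> = \<one>" using b by (simp add: S_sq)
  finally show ?thesis using b by (simp add: rf_eq)
qed

lemma mult_rf [simp]: "x \<in> carrier G \<Longrightarrow> b \<in> Rt \<Longrightarrow> x \<otimes> rf b \<otimes> rf b = x"
  by (simp add: m_assoc)

lemma rf_act: "x \<in> carrier G \<Longrightarrow> b \<in> Rt \<Longrightarrow> rf (act x b) = x \<otimes> rf b \<otimes> inv x"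
proof -
  assume x: "x \<in> carrier G" and "b \<in> Rt"
  then obtain w s where b: "b = act w (al s)" "w \<in> carrier G" "s \<in> S" by (auto simp: Rt_def)
  have "act x b = act (x \<otimes> w) (al s)" using x b by simp
  then have "rf (act x b) = (x \<otimes> w) \<otimes> s \<otimes> inv (x \<otimes> w)" using x b rf_eq[of "x \<otimes> w" s] by simp
  then show ?thesis using x b by (simp add: rf_eq m_assoc inv_mult_group)
qed

lemma mult_rf_comm: "x \<in> carrier G \<Longrightarrow> b \<in> Rt \<Longrightarrow> x \<otimes> rf b = rf (act x b) \<otimes> x"
  by (simp add: rf_act m_assoc)

lemma rf_uminus [simp]: "b \<in> Rt \<Longrightarrow> rf (- b) = rf b"
  by (rule act_faithful) (simp_all add: act_rf sc_minus)

lemma reflections_rf: "reflections = rf ` PR"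
proof
  show "reflections \<subseteq> rf ` PR"
  proof
    fix t assume "t \<in> reflections"
    then obtain w s where t: "t = w \<otimes> s \<otimes> inv w" "w \<in> carrier G" "s \<in> S" by (auto simp: reflections_def)
    then have r: "act w (al s) \<in> Rt" "t = rf (act w (al s))" by (auto simp: rf_eq)
    show "t \<in> rf ` PR"
    proof (cases "pos (act w (al s))")
      case True
      then show ?thesis using r by (simp add: PR_def)
    next
      case False
      then have "- act w (al s) \<in> PR" using r Rt_cases[OF r(1)] by (simp add: PR_def)
      moreover have "t = rf (- act w (al s))" using r by simp
      ultimately show ?thesis by blast
    qed
  qed
  show "rf ` PR \<subseteq> reflections"
  proof
    fix t assume "t \<in> rf ` PR"
    then obtain w s where "t = w \<otimes> s \<otimes> inv w" "w \<in> carrier G" "s \<in> S" by (auto simp: PR_def Rt_def rf_eq)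
    then show "t \<in> reflections" unfolding reflections_def by blast
  qed
qed

text \<open>A simple reflection changes only the coefficient of \<open>al s\<close>. Roots have norm
  2, so a positive root other than \<open>al s\<close> is no multiple of it and keeps a positive
  coefficient elsewhere.\<close>

lemma sr_PR:
  assumes a: "b \<in> PR" "s \<in> S" "b \<noteq> al s"
  shows "sr s b \<in> PR"
proof -
  have r: "b \<in> Rt" "pos b" using a by (auto simp: PR_def)
  have "\<exists>t. t \<noteq> s \<and> b t \<noteq> 0"
  proof (rule ccontr)
    assume "\<not> ?thesis"
    then have e: "b = sc (b s) (al s)" by (auto simp: fun_eq_iff sc_def al_def)
    have "bf (sc (b s) (al s)) (sc (b s) (al s)) = 2" using e bf_Rt[OF r(1)] by simp
    then have "b s * b s = 1" using a by simp
    then have "b s = 1" using r(2) unfolding pos_def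
      by (metis abs_mult_self_eq abs_of_nonneg abs_one less_le_not_le mult_cancel_left2 zle_add1_eq_le
          zmult_eq_1_iff order_less_le zero_less_one neg_0_less_iff_less)
    then show False using e a by simp
  qed
  then obtain t where t: "t \<noteq> s" "b t > 0" using r(2) unfolding pos_def by (metis order_le_less)
  then have "sr s b t > 0" by (simp add: sr_def sc_def al_def)
  then have "\<not> neg (sr s b)" unfolding pos_def by (metis neg_0_le_iff_le not_less uminus_apply)
  moreover have "sr s b \<in> Rt" using Rt_act[of s b] r a by simp
  ultimately show ?thesis using Rt_cases by (auto simp: PR_def)
qed

text \<open>Strong exchange in terms of roots: the last letter \<open>s\<close> is moved past the
  reflection, which turns \<open>b\<close> into \<open>sr s b\<close>, until \<open>b\<close> is the
  simple root of that letter.\<close>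

lemma len_rf_neg: "\<lbrakk>x \<in> carrier G; b \<in> PR; neg (act x b)\<rbrakk> \<Longrightarrow> len (x \<otimes> rf b) < len x"
proof (induct arbitrary: b rule: len_induct)
  case one
  then show ?case using pos_not_neg[of b] PR_pos[of b] by (simp add: fun_Compl_def)
next
  case (step x s)
  show ?case
  proof (cases "b = al s")
    case True
    then show ?thesis using step by simp
  next
    case False
    then have sb: "sr s b \<in> PR" using sr_PR step by simp
    have "len (x \<otimes> rf (sr s b)) < len x" using step sb by simp
    moreover have "x \<otimes> s \<otimes> rf b = x \<otimes> rf (sr s b) \<otimes> s"
      using step mult_rf_comm[of s b] PR_Rt[OF step(5)] PR_Rt[OF sb] by (simp add: m_assoc)
    ultimately show ?thesis using step len_step[of "x \<otimes> rf (sr s b)" s] PR_Rt[OF sb] len_step[of x s] by auto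
  qed
qed

lemma len_rf: "\<lbrakk>x \<in> carrier G; b \<in> PR\<rbrakk> \<Longrightarrow> len x < len (x \<otimes> rf b) \<longleftrightarrow> pos (act x b)"
  "\<lbrakk>x \<in> carrier G; b \<in> PR\<rbrakk> \<Longrightarrow> len (x \<otimes> rf b) < len x \<longleftrightarrow> neg (act x b)"
proof -
  assume a: "x \<in> carrier G" "b \<in> PR"
  have b: "b \<in> Rt" using a PR_Rt by simp
  have "act (x \<otimes> rf b) b = - act x b" using a b by (simp add: act_rf bf_Rt act_lin) (simp add: sc_def fun_eq_iff)
  then have *: "pos (act x b) \<Longrightarrow> len x < len (x \<otimes> rf b)"
    using len_rf_neg[of "x \<otimes> rf b" b] a b by simp
  show "len x < len (x \<otimes> rf b) \<longleftrightarrow> pos (act x b)" "len (x \<otimes> rf b) < len x \<longleftrightarrow> neg (act x b)"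
    using * len_rf_neg[OF a] Rt_cases[of "act x b"] a b pos_not_neg[of "act x b"] by auto
qed

text \<open>Definiteness comes from finiteness of the group: \<open>av\<close> averages the standard
  scalar product and is an invariant, definite form on vectors supported in \<open>S\<close>,
  proportional to \<open>bf\<close> on roots. Non-orthogonal roots have the same \<open>av\<close>
  norm, so \<open>2 - bf a b\<close> is the norm of \<open>a - b\<close> up to a positive
  factor.\<close>

lemma bf_bound:
  assumes a: "a \<in> Rt" "b \<in> Rt"
  shows "bf a b \<le> 2" "bf a b = 2 \<Longrightarrow> a = b"
proof -
  define av where "av u v = (\<Sum>w\<in>carrier G. \<Sum>t\<in>S. act w u t * act w v t)" for u v
  have lin: "av u (v - w) = av u v - av u w" "av (v - w) u = av v u - av w u"
    "av u (sc c v) = c * av u v" "av (sc c v) u = c * av v u" "av u v = av v u" for u v w c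
    by (simp_all add: av_def act_lin right_diff_distrib left_diff_distrib sum_subtractf sum_distrib_left)
      (simp_all add: sc_def mult_ac)
  have inva: "av (act x u) (act x v) = av u v" if "x \<in> carrier G" for x u v
  proof -
    have "av (act x u) (act x v) = (\<Sum>w\<in>carrier G. \<Sum>t\<in>S. act (w \<otimes> x) u t * act (w \<otimes> x) v t)"
      using that by (simp add: av_def)
    also have "\<dots> = av u v" unfolding av_def
      by (rule sum.reindex_bij_witness[of _ "\<lambda>w. w \<otimes> inv x" "\<lambda>w. w \<otimes> x"]) (use that in \<open>auto simp: m_assoc\<close>)
    finally show ?thesis .
  qed
  have nn: "0 \<le> av v v" for v unfolding av_def by (intro sum_nonneg) auto
  have z: "v t = 0" if "av v v = 0" "t \<in> S" for v t
  proof -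
    have "(\<Sum>t\<in>S. act \<one> v t * act \<one> v t) = 0"
      using that(1) unfolding av_def by (subst (asm) sum_nonneg_eq_0_iff) (blast intro: fin sum_nonneg zero_le_square one_closed)+
    then show ?thesis using that(2) by (subst (asm) sum_nonneg_eq_0_iff) (auto simp: finS)
  qed
  \<comment> \<open>The reflection in \<open>c\<close> preserves \<open>av\<close>, negates
    \<open>c\<close> and sends \<open>v\<close> to \<open>v - bf c v * c\<close>.\<close>
  have key: "2 * av v c = bf c v * av c c" if "c \<in> Rt" for c v
  proof -
    have "av v c = av (v - sc (bf c v) c) (c - sc (bf c c) c)"
      using inva[of "rf c" v c] that by (simp add: act_rf)
    also have "c - sc (bf c c) c = sc (-1) c" using that by (simp add: bf_Rt) (simp add: sc_def fun_eq_iff)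
    finally have "av v c = (-1) * (av v c - bf c v * av c c)" by (simp only: lin) (simp add: algebra_simps)
    then show ?thesis by (simp add: algebra_simps)
  qed
  have k1: "2 * av b a = bf a b * av a a" and k2: "2 * av a b = bf b a * av b b" using key a by auto
  have apos: "av a a > 0"
  proof -
    obtain t where t: "a t \<noteq> 0" using Rt_cases[OF a(1)] by (auto simp: pos_def) (metis less_irrefl)+
    then have "t \<in> S" using Rt_support a(1) by blast
    then show ?thesis using z[of a t] nn[of a] t by force
  qed
  have main: "bf a b \<noteq> 0 \<Longrightarrow> av b b = av a a" using k1 k2 lin(5)[of a b] bf_sym[of a b] by auto
  have "av (a - b) (a - b) = av a a + av b b - 2 * av a b" by (simp add: lin(1,2)) (simp add: lin(5)[of b a])
  then have d: "bf a b \<noteq> 0 \<Longrightarrow> av (a - b) (a - b) = (2 - bf a b) * av a a"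
    using main k1 lin(5)[of a b] by (simp add: algebra_simps)
  show "bf a b \<le> 2"
  proof (rule ccontr)
    assume "\<not> bf a b \<le> 2"
    then show False using d nn[of "a - b"] apos by (auto simp: zero_le_mult_iff)
  qed
  assume "bf a b = 2"
  then have "av (a - b) (a - b) = 0" using d by simp
  then have "t \<in> S \<Longrightarrow> a t = b t" for t using z[of "a - b" t] by simp
  then show "a = b" using Rt_support a by (metis ext)
qed

lemma bf_cases:
  assumes "a \<in> Rt" "b \<in> Rt" "a \<noteq> b" "a \<noteq> - b"
  shows "bf a b = -1 \<or> bf a b = 0 \<or> bf a b = 1"
proof -
  have "- b \<in> Rt" using assms by simp
  then have "bf a b \<le> 2" "bf a b \<noteq> 2" "- bf a b \<le> 2" "- bf a b \<noteq> 2"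
    using bf_bound[of a b] bf_bound[of a "- b"] assms by auto
  then show ?thesis by linarith
qed

section \<open>Bruhat order\<close>


abbreviation leB (infix "\<preceq>" 50) where "x \<preceq> y \<equiv> bruhat_le x y"
abbreviation up where "up x s \<equiv> len x < len (x \<otimes> s)"
abbreviation dn where "dn x s \<equiv> len (x \<otimes> s) < len x"

lemma step_iff: "bruhat_step x y \<longleftrightarrow> x \<in> carrier G \<and> (\<exists>b\<in>PR. y = x \<otimes> rf b \<and> pos (act x b))"
proof
  assume "bruhat_step x y"
  then obtain b where "b \<in> PR" "y = x \<otimes> rf b" "x \<in> carrier G" "len x < len y"
    by (auto simp: bruhat_step_def reflections_rf)
  then show "x \<in> carrier G \<and> (\<exists>b\<in>PR. y = x \<otimes> rf b \<and> pos (act x b))" using len_rf(1) by blast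
next
  assume "x \<in> carrier G \<and> (\<exists>b\<in>PR. y = x \<otimes> rf b \<and> pos (act x b))"
  then show "bruhat_step x y" using len_rf(1) PR_Rt by (auto simp: bruhat_step_def reflections_rf)
qed

lemma le_refl [simp]: "x \<in> carrier G \<Longrightarrow> x \<preceq> x" by (simp add: bruhat_le_def)

lemma le_trans: "x \<preceq> y \<Longrightarrow> y \<preceq> z \<Longrightarrow> x \<preceq> z" by (auto simp: bruhat_le_def)

lemma le_carr: "x \<preceq> y \<Longrightarrow> x \<in> carrier G" "x \<preceq> y \<Longrightarrow> y \<in> carrier G" by (auto simp: bruhat_le_def)

lemma step_le: "bruhat_step x y \<Longrightarrow> x \<preceq> y"
  unfolding bruhat_le_def by (simp add: bruhat_step_def r_into_rtranclp)

lemma step_carr: "bruhat_step x y \<Longrightarrow> x \<in> carrier G \<and> y \<in> carrier G" by (simp add: bruhat_step_def)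

lemma step_len: "bruhat_step x y \<Longrightarrow> len x < len y" by (simp add: bruhat_step_def)

lemma le_induct [consumes 1, case_names refl step]:
  assumes "x \<preceq> y" and "P x"
    and "\<And>y z. \<lbrakk>x \<preceq> y; bruhat_step y z; P y\<rbrakk> \<Longrightarrow> P z"
  shows "P y"
proof -
  have x: "x \<in> carrier G" and "bruhat_step\<^sup>*\<^sup>* x y" using assms(1) by (auto simp: bruhat_le_def)
  from this(2) have "P y \<and> x \<preceq> y"
  proof (induct rule: rtranclp_induct)
    case (step y z)
    then show ?case using assms(3) step_le le_trans by blast
  qed (use x assms(2) in simp)
  then show ?thesis by simp
qed

lemma le_conv_induct [consumes 1, case_names refl step]:
  assumes "x \<preceq> y" and "P y"
    and "\<And>w z. \<lbrakk>bruhat_step w z; z \<preceq> y; P z\<rbrakk> \<Longrightarrow> P w"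
  shows "P x"
proof -
  have y: "y \<in> carrier G" and "bruhat_step\<^sup>*\<^sup>* x y" using assms(1) by (auto simp: bruhat_le_def)
  from this(2) have "P x \<and> x \<preceq> y"
  proof (induct rule: converse_rtranclp_induct)
    case (step w z)
    then show ?case using assms(3) step_le le_trans by blast
  qed (use y assms(2) in simp)
  then show ?thesis by simp
qed

lemma le_len: "x \<preceq> y \<Longrightarrow> len x < len y \<or> x = y"
  by (induct rule: le_induct) (auto dest: step_len)

lemma le_antisym: "x \<preceq> y \<Longrightarrow> y \<preceq> x \<Longrightarrow> x = y"
  using le_len[of x y] le_len[of y x] by auto

lemma step_up: "x \<in> carrier G \<Longrightarrow> s \<in> S \<Longrightarrow> up x s \<Longrightarrow> bruhat_step x (x \<otimes> s)"
  using act_al_pos[of x s] PR_al[of s] rf_al[of s] step_iff by metis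

lemma step_dn: "x \<in> carrier G \<Longrightarrow> s \<in> S \<Longrightarrow> dn x s \<Longrightarrow> bruhat_step (x \<otimes> s) x"
  using step_up[of "x \<otimes> s" s] by simp

lemma le_up: "x \<in> carrier G \<Longrightarrow> s \<in> S \<Longrightarrow> up x s \<Longrightarrow> x \<preceq> x \<otimes> s"
  using step_up step_le by blast

lemma le_dn: "x \<in> carrier G \<Longrightarrow> s \<in> S \<Longrightarrow> dn x s \<Longrightarrow> x \<otimes> s \<preceq> x"
  using step_dn step_le by blast

lemma rf_sr: "x \<in> carrier G \<Longrightarrow> b \<in> Rt \<Longrightarrow> s \<in> S \<Longrightarrow> x \<otimes> s \<otimes> rf (sr s b) = x \<otimes> rf b \<otimes> s"
  using mult_rf_comm[of s "sr s b"] Rt_act[of s b] by (simp add: m_assoc)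

text \<open>\<open>sr s\<close> permutes the positive roots other than \<open>al s\<close>, so right
  multiplication by \<open>s\<close> keeps the direction of every edge not labelled by
  \<open>al s\<close>. All lifting properties rest on this.\<close>

lemma step_s: "bruhat_step x y \<Longrightarrow> s \<in> S \<Longrightarrow> y = x \<otimes> s \<or> bruhat_step (x \<otimes> s) (y \<otimes> s)"
proof -
  assume a: "bruhat_step x y" "s \<in> S"
  then obtain b where b: "x \<in> carrier G" "b \<in> PR" "y = x \<otimes> rf b" "pos (act x b)" by (auto simp: step_iff)
  show ?thesis
  proof (cases "b = al s")
    case False
    then have "sr s b \<in> PR" using sr_PR b a by simp
    moreover have "y \<otimes> s = x \<otimes> s \<otimes> rf (sr s b)" using rf_sr[of x b s] b a PR_Rt by simp
    ultimately have "bruhat_step (x \<otimes> s) (y \<otimes> s)" using b a unfolding step_iff by auto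
    then show ?thesis ..
  qed (use b a in simp)
qed

lemma lift0: "x \<preceq> y \<Longrightarrow> s \<in> S \<Longrightarrow> x \<otimes> s \<preceq> y \<or> x \<otimes> s \<preceq> y \<otimes> s"
proof -
  assume a: "x \<preceq> y" "s \<in> S"
  from a(1) show ?thesis
  proof (induct rule: le_conv_induct)
    case refl
    then show ?case using le_carr(2)[OF a(1)] a(2) by simp
  next
    case (step w z)
    from step_s[OF step(1) a(2)] show ?case
    proof
      assume "z = w \<otimes> s"
      then show ?thesis using step by simp
    next
      assume "bruhat_step (w \<otimes> s) (z \<otimes> s)"
      then have "w \<otimes> s \<preceq> z \<otimes> s" by (rule step_le)
      then show ?thesis using step le_trans by blast
    qed
  qed
qed

lemma lift_dn: "x \<preceq> y \<Longrightarrow> s \<in> S \<Longrightarrow> dn y s \<Longrightarrow> x \<otimes> s \<preceq> y"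
  using lift0 le_dn le_trans le_carr by metis

lemma lift_up: "x \<preceq> y \<Longrightarrow> s \<in> S \<Longrightarrow> up y s \<Longrightarrow> x \<otimes> s \<preceq> y \<otimes> s"
  using lift0 le_up le_trans le_carr by metis

lemma lift_up_dn: "x \<preceq> y \<Longrightarrow> s \<in> S \<Longrightarrow> up x s \<Longrightarrow> dn y s \<Longrightarrow> x \<preceq> y \<otimes> s"
proof (induct rule: le_induct)
  case refl
  then show ?case by simp
next
  case (step y z)
  have c: "y \<in> carrier G" "z \<in> carrier G" using step_carr[OF step(2)] by auto
  from step_s[OF step(2) step(4)] show ?case
  proof
    assume "z = y \<otimes> s"
    then show ?thesis using step c by simp
  next
    assume "bruhat_step (y \<otimes> s) (z \<otimes> s)"
    then have *: "y \<otimes> s \<preceq> z \<otimes> s" by (rule step_le)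
    show ?thesis
    proof (cases "dn y s")
      case True
      then show ?thesis using step * le_trans by blast
    next
      case False
      then have "y \<preceq> y \<otimes> s" using le_up c len_gt step by blast
      then show ?thesis using step(1) * le_trans by blast
    qed
  qed
qed

lemma lift_dn_dn:
  assumes a: "x \<preceq> y" "s \<in> S" "dn x s" "dn y s"
  shows "x \<otimes> s \<preceq> y \<otimes> s"
proof -
  have c: "x \<in> carrier G" "y \<in> carrier G" using le_carr a by auto
  have "x \<otimes> s \<preceq> y" using le_dn[of x s] a c le_trans by blast
  then show ?thesis using lift_up_dn[of "x \<otimes> s" y s] a c by simp
qed

section \<open>Inversion and the left-handed lifting properties\<close>

lemma step_inv: "bruhat_step x y \<Longrightarrow> bruhat_step (inv x) (inv y)"
proof -
  assume "bruhat_step x y"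
  then obtain b where b: "x \<in> carrier G" "b \<in> PR" "y = x \<otimes> rf b" "pos (act x b)" by (auto simp: step_iff)
  have r: "b \<in> Rt" using b PR_Rt by simp
  have i: "inv (rf b) = rf b" using r by (simp add: inv_equality)
  have "inv y = inv x \<otimes> rf (act x b)" using b r i mult_rf_comm[of "inv x" "act x b"] by (simp add: inv_mult_group)
  moreover have "act x b \<in> PR" using b r by (simp add: PR_def)
  ultimately show ?thesis using b PR_pos unfolding step_iff by auto
qed

lemma le_inv: assumes a: "x \<preceq> y" shows "inv x \<preceq> inv y"
  using a
proof (induct rule: le_induct)
  case refl
  then show ?case using le_carr(1)[OF a] by simp
next
  case (step y z)
  then show ?case using step_inv step_le le_trans by blast
qed

lemma le_inv_iff: "x \<in> carrier G \<Longrightarrow> y \<in> carrier G \<Longrightarrow> inv x \<preceq> inv y \<longleftrightarrow> x \<preceq> y"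
  using le_inv[of x y] le_inv[of "inv x" "inv y"] by auto

lemma len_left: "x \<in> carrier G \<Longrightarrow> s \<in> S \<Longrightarrow> len (s \<otimes> x) = len (inv x \<otimes> s)"
  using len_inv[of "s \<otimes> x"] by (simp add: inv_mult_group S_inv)

lemma len_left_step: "x \<in> carrier G \<Longrightarrow> s \<in> S \<Longrightarrow> len (s \<otimes> x) = len x + 1 \<or> len x = len (s \<otimes> x) + 1"
  using len_step[of "inv x" s] by (simp add: len_left)

lemma inv_left: "x \<in> carrier G \<Longrightarrow> s \<in> S \<Longrightarrow> inv (s \<otimes> x) = inv x \<otimes> s"
  by (simp add: inv_mult_group S_inv)

lemma llift_dn: "x \<preceq> y \<Longrightarrow> s \<in> S \<Longrightarrow> len (s \<otimes> y) < len y \<Longrightarrow> s \<otimes> x \<preceq> y"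
  using lift_dn[OF le_inv, of x y s] le_inv_iff[of "s \<otimes> x" y] le_carr[of x y] by (simp add: inv_left len_left)

lemma llift_up: "x \<preceq> y \<Longrightarrow> s \<in> S \<Longrightarrow> len y < len (s \<otimes> y) \<Longrightarrow> s \<otimes> x \<preceq> s \<otimes> y"
  using lift_up[OF le_inv, of x y s] le_inv_iff[of "s \<otimes> x" "s \<otimes> y"] le_carr[of x y] by (simp add: inv_left len_left)

lemma llift_up_dn: "x \<preceq> y \<Longrightarrow> s \<in> S \<Longrightarrow> len x < len (s \<otimes> x) \<Longrightarrow> len (s \<otimes> y) < len y \<Longrightarrow> x \<preceq> s \<otimes> y"
  using lift_up_dn[OF le_inv, of x y s] le_inv_iff[of x "s \<otimes> y"] le_carr[of x y] by (simp add: inv_left len_left)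

lemma llift_dn_dn: "x \<preceq> y \<Longrightarrow> s \<in> S \<Longrightarrow> len (s \<otimes> x) < len x \<Longrightarrow> len (s \<otimes> y) < len y \<Longrightarrow> s \<otimes> x \<preceq> s \<otimes> y"
  using lift_dn_dn[OF le_inv, of x y s] le_inv_iff[of "s \<otimes> x" "s \<otimes> y"] le_carr[of x y] by (simp add: inv_left len_left)

lemma one_le: "x \<in> carrier G \<Longrightarrow> \<one> \<preceq> x"
proof (induct rule: len_induct)
  case (step x s)
  then show ?case using le_up le_trans by blast
qed simp

text \<open>Generalized quotients in the sense of Bjoerner and Wachs.\<close>

definition gq :: "'a set \<Rightarrow> 'a set" where
  "gq A = {c \<in> carrier G. \<forall>a\<in>A. len (c \<otimes> a) = len c + len a}"

lemma len_wd_left: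
  assumes a: "c \<in> carrier G" "s \<in> S" "u \<in> lists S" "len (c \<otimes> (s \<otimes> wd u)) = len c + Suc (length u)"
  shows "len (c \<otimes> s) = len c + 1 \<and> len (c \<otimes> s \<otimes> wd u) = len (c \<otimes> s) + length u"
proof -
  have w: "wd u \<in> carrier G" using a by simp
  have e: "c \<otimes> (s \<otimes> wd u) = c \<otimes> s \<otimes> wd u" using a w by (simp add: m_assoc)
  have "len (c \<otimes> s \<otimes> wd u) \<le> len (c \<otimes> s) + length u"
    using len_mult[of "c \<otimes> s" "wd u"] len_le[OF a(3)] a w by simp
  then show ?thesis using a e len_step[of c s] by auto
qed

text \<open>The root \<open>z (al s)\<close> is positive and is made negative by \<open>q\<close>,
  so it equals \<open>al q\<close>.\<close>

lemma exchange_left: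
  assumes a: "z \<in> carrier G" "q \<in> S" "s \<in> S" "len z < len (q \<otimes> z)" "up z s" "dn (q \<otimes> z) s"
  shows "q \<otimes> z \<otimes> s = z"
proof -
  have p: "act z (al s) \<in> PR" using act_al_pos[of z s] a by (simp add: PR_def)
  have "neg (sr q (act z (al s)))" using act_al_neg[of "q \<otimes> z" s] a by simp
  then have "act z (al s) = al q" using sr_PR[OF p a(2)] PR_pos pos_not_neg by blast
  then have "z \<otimes> s = q \<otimes> z" using mult_rf_comm[of z "al s"] a by simp
  then show ?thesis using a by (metis mult_SS)
qed

text \<open>Let \<open>s\<close>, after a prefix \<open>p\<close> of \<open>u\<close>, be the first
  letter that is a descent of \<open>q z p\<close>. Exchange gives \<open>q z p s = z p\<close>, and
  lifting puts \<open>c p\<close> below it because \<open>s\<close> is an ascent of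
  \<open>c p\<close>. The letters of \<open>p\<close> are then stripped from both sides.\<close>

lemma gq_aux: "\<lbrakk>u \<in> lists S; z \<in> carrier G; c \<in> carrier G; q \<in> S; len (z \<otimes> wd u) = len z + length u;
    len (c \<otimes> wd u) = len c + length u; c \<preceq> q \<otimes> z; len z < len (q \<otimes> z);
    len (q \<otimes> z \<otimes> wd u) \<noteq> len (q \<otimes> z) + length u\<rbrakk> \<Longrightarrow> c \<preceq> z"
proof (induct u arbitrary: c z)
  case Nil
  then show ?case by simp
next
  case (Cons s u)
  have s: "s \<in> S" "u \<in> lists S" using Cons(2) by auto
  have z: "len (z \<otimes> s) = len z + 1" "len (z \<otimes> s \<otimes> wd u) = len (z \<otimes> s) + length u"
    using len_wd_left[of z s u] Cons s by auto
  have c: "len (c \<otimes> s) = len c + 1" "len (c \<otimes> s \<otimes> wd u) = len (c \<otimes> s) + length u"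
    using len_wd_left[of c s u] Cons s by auto
  have lq: "len (q \<otimes> z) = len z + 1" using len_left_step[of z q] Cons by auto
  show ?case
  proof (cases "dn (q \<otimes> z) s")
    case True
    have "c \<preceq> q \<otimes> z \<otimes> s" using lift_up_dn[of c "q \<otimes> z" s] Cons s c True by simp
    then show ?thesis using exchange_left[of z q s] Cons s z True by simp
  next
    case False
    then have upq: "up (q \<otimes> z) s" using len_gt[of "q \<otimes> z" s] Cons s by simp
    then have lqs: "len (q \<otimes> z \<otimes> s) = len z + 2" using len_step[of "q \<otimes> z" s] lq Cons s by auto
    have "c \<otimes> s \<preceq> z \<otimes> s"
    proof (rule Cons.hyps)
      show "c \<otimes> s \<preceq> q \<otimes> (z \<otimes> s)" using lift_up[of c "q \<otimes> z" s] upq Cons s by (simp add: m_assoc)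
      show "len (z \<otimes> s) < len (q \<otimes> (z \<otimes> s))" using lqs z Cons s by (simp add: m_assoc)
      show "len (q \<otimes> (z \<otimes> s) \<otimes> wd u) \<noteq> len (q \<otimes> (z \<otimes> s)) + length u"
        using Cons.prems(9) lqs lq Cons.prems s by (simp add: m_assoc)
    qed (use Cons s z c in auto)
    then show ?thesis using lift_dn_dn[of "c \<otimes> s" "z \<otimes> s" s] Cons s z c by simp
  qed
qed

lemma gq_left:
  assumes a: "z \<in> gq A" "A \<subseteq> carrier G" "q \<in> S" "len (q \<otimes> z) < len z"
  shows "q \<otimes> z \<in> gq A"
proof -
  have z: "z \<in> carrier G" using a by (simp add: gq_def)
  have l: "len z = len (q \<otimes> z) + 1" using len_left_step[of z q] a z by auto
  have "len (q \<otimes> z \<otimes> b) = len (q \<otimes> z) + len b" if b: "b \<in> A" for b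
  proof -
    have bc: "b \<in> carrier G" using a b by auto
    have "len (z \<otimes> b) = len z + len b" using a b by (simp add: gq_def)
    moreover have "len (z \<otimes> b) \<le> len (q \<otimes> (z \<otimes> b)) + 1" using len_left_step[of "z \<otimes> b" q] a z bc by auto
    moreover have "len (q \<otimes> z \<otimes> b) \<le> len (q \<otimes> z) + len b" using len_mult a z bc by simp
    ultimately show ?thesis using l a z bc by (simp add: m_assoc)
  qed
  then show ?thesis using a z by (simp add: gq_def)
qed

text \<open>Strip a left descent \<open>q\<close> of \<open>z\<close>. Either \<open>c\<close> is
  below \<open>q z\<close>, which stays in the quotient, or \<open>q\<close> is a left descent of
  \<open>c\<close> too and induction yields some \<open>z2\<close> below \<open>q z\<close>. Then
  \<open>q z2\<close> works: if it left the quotient, \<open>gq_aux\<close> would put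
  \<open>c\<close> below \<open>z2\<close> and hence below \<open>q z\<close>.\<close>

lemma gq_chain: "\<lbrakk>c \<in> gq A; z \<in> gq A; A \<subseteq> carrier G; c \<preceq> z; c \<noteq> z\<rbrakk> \<Longrightarrow> \<exists>z'\<in>gq A. bruhat_step z' z \<and> c \<preceq> z'"
proof (induct "len z" arbitrary: c z rule: less_induct)
  case less
  note pr = less.prems
  have cc: "c \<in> carrier G" "z \<in> carrier G" using le_carr pr by auto
  have "z \<noteq> \<one>" using le_len[OF pr(4)] pr(5) by auto
  then obtain q where q: "q \<in> S" "len (inv z \<otimes> q) < len (inv z)"
    using ex_descent[of "inv z"] cc inv_equality by (metis inv_closed inv_inv inv_one)
  then have ql: "len (q \<otimes> z) < len z" using cc by (simp add: len_left)
  define z1 where "z1 = q \<otimes> z"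
  have z1: "z1 \<in> carrier G" "z = q \<otimes> z1" "len z = len z1 + 1"
    using cc q ql len_left_step[of z q] by (auto simp: z1_def)
  have z1g: "z1 \<in> gq A" unfolding z1_def by (rule gq_left) (use pr q ql in auto)
  \<comment> \<open>Left multiplication by \<open>q\<close> is right multiplication by a conjugate
    of \<open>q\<close>, hence an edge.\<close>
  have "inv z1 \<otimes> q \<otimes> inv (inv z1) \<in> reflections" unfolding reflections_def using q z1 inv_closed by blast
  moreover have "z = z1 \<otimes> (inv z1 \<otimes> q \<otimes> inv (inv z1))" using z1 q by (simp add: m_assoc[symmetric])
  ultimately have st1: "bruhat_step z1 z" using z1 cc unfolding bruhat_step_def by auto
  show ?case
  proof (cases "c \<preceq> z1")
    case True
    then show ?thesis using st1 z1g by blast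
  next
    case F: False
    have qc: "len (q \<otimes> c) < len c"
      using llift_up_dn[OF pr(4) q(1)] F ql len_left_step[of c q] cc q by (fastforce simp: z1_def)
    define c1 where "c1 = q \<otimes> c"
    have c1: "c1 \<in> carrier G" "c = q \<otimes> c1" using cc q by (auto simp: c1_def)
    have c1g: "c1 \<in> gq A" unfolding c1_def by (rule gq_left) (use pr q qc in auto)
    have le1: "c1 \<preceq> z1" unfolding c1_def z1_def by (rule llift_dn_dn) (use pr q qc ql in auto)
    have "c1 \<noteq> z1" using pr(5) c1 z1 by auto
    then obtain z2 where z2: "z2 \<in> gq A" "bruhat_step z2 z1" "c1 \<preceq> z2"
      using less.hyps[of z1 c1] z1 z1g c1g le1 pr(3) by auto
    have z2c: "z2 \<in> carrier G" using z2 by (simp add: gq_def)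
    have nle: "\<not> c \<preceq> z2" using F le_trans step_le[OF z2(2)] by blast
    have up2: "len z2 < len (q \<otimes> z2)"
    proof (rule ccontr)
      assume "\<not> len z2 < len (q \<otimes> z2)"
      then have "len (q \<otimes> z2) < len z2" using len_left_step[of z2 q] z2c q by auto
      then show False using llift_dn[OF z2(3) q(1)] c1 nle by simp
    qed
    have cz: "c \<preceq> q \<otimes> z2" using llift_up[OF z2(3) q(1) up2] c1 by simp
    obtain t where t: "t \<in> reflections" "z1 = z2 \<otimes> t" using z2(2) by (auto simp: bruhat_step_def)
    have tc: "t \<in> carrier G" using t(1) by (auto simp: reflections_def)
    have "z = (q \<otimes> z2) \<otimes> t" using t z1 z2c tc q by (simp add: m_assoc)
    moreover have "len (q \<otimes> z2) < len z"
      using step_len[OF z2(2)] z1 len_left_step[of z2 q] z2c q by auto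
    ultimately have st: "bruhat_step (q \<otimes> z2) z" using t z2c q cc unfolding bruhat_step_def by auto
    have "q \<otimes> z2 \<in> gq A"
    proof (rule ccontr)
      assume "q \<otimes> z2 \<notin> gq A"
      then obtain a where a: "a \<in> A" "len (q \<otimes> z2 \<otimes> a) \<noteq> len (q \<otimes> z2) + len a"
        using z2c q by (auto simp: gq_def)
      obtain u where u: "u \<in> lists S" "length u = len a" "wd u = a" using len_word[of a] a pr(3) by auto
      have "c \<preceq> z2" by (rule gq_aux[OF u(1) z2c cc(1) q(1)]) (use u a z2 pr cz up2 in \<open>auto simp: gq_def\<close>)
      then show False using nle by simp
    qed
    then show ?thesis using st cz by blast
  qed
qed

section \<open>R-polynomials\<close>


text \<open>Maps the row \<open>R(-, y)\<close> to the row \<open>R(-, y s)\<close> if \<open>y < y s\<close>. These operators satisfy the braid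
  relations, so a row depends only on \<open>y\<close> and not on the reduced word used to compute it.\<close>

definition lam :: "'a \<Rightarrow> ('a \<Rightarrow> int poly) \<Rightarrow> 'a \<Rightarrow> int poly" where
  "lam s h x = (if x \<notin> carrier G then 0 else if dn x s then h (x \<otimes> s)
     else [:0, 1:] * h (x \<otimes> s) + [:-1, 1:] * h x)"

lemma dn_pos: "x \<in> carrier G \<Longrightarrow> s \<in> S \<Longrightarrow> dn x s \<longleftrightarrow> \<not> pos (act x (al s))"
  using act_al_iff(1)[of x s] len_gt[of x s] by linarith

lemma dn_swap: "x \<in> carrier G \<Longrightarrow> s \<in> S \<Longrightarrow> dn (x \<otimes> s) s \<longleftrightarrow> \<not> dn x s"
  using len_step[of x s] by auto

lemma cart2: "s \<in> S \<Longrightarrow> t \<in> S \<Longrightarrow> s \<noteq> t \<Longrightarrow> ord (s \<otimes> t) = 2 \<Longrightarrow> cart s t = 0 \<and> cart t s = 0"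
  using cart_sym[of s t] by (simp add: cart_def)

lemma cart3: "s \<in> S \<Longrightarrow> t \<in> S \<Longrightarrow> s \<noteq> t \<Longrightarrow> ord (s \<otimes> t) = 3 \<Longrightarrow> cart s t = -1 \<and> cart t s = -1"
  using cart_sym[of s t] by (simp add: cart_def)

lemma dn_comm: "\<lbrakk>x \<in> carrier G; s \<in> S; t \<in> S; s \<noteq> t; ord (s \<otimes> t) = 2\<rbrakk> \<Longrightarrow> dn (x \<otimes> s) t \<longleftrightarrow> dn x t"
  using cart2[of s t] by (simp add: dn_pos sr_al)

lemma dn_braid:
  assumes "x \<in> carrier G" "s \<in> S" "t \<in> S" "s \<noteq> t" "ord (s \<otimes> t) = 3"
  shows "dn (x \<otimes> s) t \<longleftrightarrow> dn (x \<otimes> t) s" "dn (x \<otimes> s \<otimes> t) s \<longleftrightarrow> dn x t"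
    "dn x s \<Longrightarrow> dn x t \<Longrightarrow> dn (x \<otimes> s) t" "\<not> dn x s \<Longrightarrow> \<not> dn x t \<Longrightarrow> \<not> dn (x \<otimes> s) t"
proof -
  note c = cart3[OF assms(2-5)]
  have e: "act (x \<otimes> s) (al t) = act x (al s) + act x (al t)" "act (x \<otimes> t) (al s) = act x (al s) + act x (al t)"
    "act (x \<otimes> s \<otimes> t) (al s) = act x (al t)"
    using assms c by (simp_all add: sr_al act_lin sr_lin algebra_simps)
  show "dn (x \<otimes> s) t \<longleftrightarrow> dn (x \<otimes> t) s" "dn (x \<otimes> s \<otimes> t) s \<longleftrightarrow> dn x t"
    using assms e by (simp_all only: dn_pos m_closed S_carr)
  show "dn x s \<Longrightarrow> dn x t \<Longrightarrow> dn (x \<otimes> s) t"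
    using assms e neg_add[of "act x (al s)" "act x (al t)"] pos_not_neg[of "act x (al s) + act x (al t)"]
    by (simp only: dn_pos m_closed S_carr) (metis Rt_act Rt_al Rt_cases)
  show "\<not> dn x s \<Longrightarrow> \<not> dn x t \<Longrightarrow> \<not> dn (x \<otimes> s) t"
    using assms e pos_add[of "act x (al s)" "act x (al t)"] by (simp only: dn_pos m_closed S_carr) simp
qed

lemma lam_comm: "\<lbrakk>s \<in> S; t \<in> S; s \<noteq> t; ord (s \<otimes> t) = 2\<rbrakk> \<Longrightarrow> lam s (lam t h) = lam t (lam s h)"
proof
  fix x
  assume a: "s \<in> S" "t \<in> S" "s \<noteq> t" "ord (s \<otimes> t) = 2"
  show "lam s (lam t h) x = lam t (lam s h) x"
  proof (cases "x \<in> carrier G")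
    case True
    have 1: "x \<otimes> s \<otimes> t = x \<otimes> t \<otimes> s" using a True comm2[OF a(1,2,4)] by (simp add: m_assoc)
    have 2: "dn (x \<otimes> s) t \<longleftrightarrow> dn x t" using dn_comm a True by simp
    have 3: "dn (x \<otimes> t) s \<longleftrightarrow> dn x s" using dn_comm[of x t s] ord_SS_sym[of s t] a True by simp
    have c: "x \<otimes> s \<in> carrier G" "x \<otimes> t \<in> carrier G" using a True by auto
    show ?thesis unfolding lam_def[of s "lam t h"] lam_def[of t "lam s h"] lam_def[of t h] lam_def[of s h]
      using True c 1 2 3 by (cases "dn x s"; cases "dn x t") (simp_all add: algebra_simps)
  qed (simp add: lam_def)
qed

text \<open>All descents in the coset of \<open>x\<close> under the two generators are determined by
  \<open>dn x s\<close>, \<open>dn x t\<close> and \<open>dn (x \<otimes> s) t\<close>, so both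
  sides become explicit combinations of the six values of \<open>h\<close> there. Two of the eight
  sign patterns cannot occur.\<close>

lemma lam_braid: "\<lbrakk>s \<in> S; t \<in> S; s \<noteq> t; ord (s \<otimes> t) = 3\<rbrakk> \<Longrightarrow> lam s (lam t (lam s h)) = lam t (lam s (lam t h))"
proof
  fix x
  assume a: "s \<in> S" "t \<in> S" "s \<noteq> t" "ord (s \<otimes> t) = 3"
  have o: "ord (t \<otimes> s) = 3" using a ord_SS_sym by metis
  show "lam s (lam t (lam s h)) x = lam t (lam s (lam t h)) x"
  proof (cases "x \<in> carrier G")
    case True
    have 1: "x \<otimes> s \<otimes> t \<otimes> s = x \<otimes> t \<otimes> s \<otimes> t" using a True braid3[OF a(1,2,4)] by (simp add: m_assoc)
    note b = dn_braid[OF True a(1,2,3,4)] dn_braid(2)[OF True a(2,1) not_sym[OF a(3)] o]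
    note sw = dn_swap[OF True a(1)] dn_swap[OF True a(2)]
    have c: "x \<otimes> s \<in> carrier G" "x \<otimes> t \<in> carrier G" "x \<otimes> s \<otimes> t \<in> carrier G" "x \<otimes> t \<otimes> s \<in> carrier G" using a True by auto
    have f: "len (x \<otimes> t \<otimes> s \<otimes> t) < len (x \<otimes> s \<otimes> t) \<longleftrightarrow> dn x t" "len (x \<otimes> t \<otimes> s \<otimes> t) < len (x \<otimes> t \<otimes> s) \<longleftrightarrow> dn x s"
      "up x s \<longleftrightarrow> \<not> dn x s" "up x t \<longleftrightarrow> \<not> dn x t"
      using b(2,5) 1 sw True a by simp_all
    define h1 h2 h3 h4 h5 h6 where "h1 = h x" "h2 = h (x \<otimes> s)" "h3 = h (x \<otimes> t)" "h4 = h (x \<otimes> s \<otimes> t)"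
      "h5 = h (x \<otimes> t \<otimes> s)" "h6 = h (x \<otimes> t \<otimes> s \<otimes> t)"
    note hd = this
    have l: "lam s (lam t (lam s h)) x = (if dn x s then lam t (lam s h) (x \<otimes> s)
        else [:0, 1:] * lam t (lam s h) (x \<otimes> s) + [:-1, 1:] * lam t (lam s h) x)"
      "lam t (lam s (lam t h)) x = (if dn x t then lam s (lam t h) (x \<otimes> t)
        else [:0, 1:] * lam s (lam t h) (x \<otimes> t) + [:-1, 1:] * lam s (lam t h) x)"
      "lam t (lam s h) (x \<otimes> s) = (if dn (x \<otimes> s) t then lam s h (x \<otimes> s \<otimes> t)
        else [:0, 1:] * lam s h (x \<otimes> s \<otimes> t) + [:-1, 1:] * lam s h (x \<otimes> s))"
      "lam s (lam t h) (x \<otimes> t) = (if dn (x \<otimes> s) t then lam t h (x \<otimes> t \<otimes> s)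
        else [:0, 1:] * lam t h (x \<otimes> t \<otimes> s) + [:-1, 1:] * lam t h (x \<otimes> t))"
      "lam t (lam s h) x = (if dn x t then lam s h (x \<otimes> t)
        else [:0, 1:] * lam s h (x \<otimes> t) + [:-1, 1:] * lam s h x)"
      "lam s (lam t h) x = (if dn x s then lam t h (x \<otimes> s)
        else [:0, 1:] * lam t h (x \<otimes> s) + [:-1, 1:] * lam t h x)"
      "lam s h (x \<otimes> s \<otimes> t) = (if dn x t then h6 else [:0, 1:] * h6 + [:-1, 1:] * h4)"
      "lam t h (x \<otimes> t \<otimes> s) = (if dn x s then h6 else [:0, 1:] * h6 + [:-1, 1:] * h5)"
      "lam s h (x \<otimes> s) = (if \<not> dn x s then h1 else [:0, 1:] * h1 + [:-1, 1:] * h2)"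
      "lam t h (x \<otimes> t) = (if \<not> dn x t then h1 else [:0, 1:] * h1 + [:-1, 1:] * h3)"
      "lam s h (x \<otimes> t) = (if dn (x \<otimes> s) t then h5 else [:0, 1:] * h5 + [:-1, 1:] * h3)"
      "lam t h (x \<otimes> s) = (if dn (x \<otimes> s) t then h4 else [:0, 1:] * h4 + [:-1, 1:] * h2)"
      "lam s h x = (if dn x s then h2 else [:0, 1:] * h2 + [:-1, 1:] * h1)"
      "lam t h x = (if dn x t then h3 else [:0, 1:] * h3 + [:-1, 1:] * h1)"
      using True c a by (simp_all only: lam_def b(1)[symmetric] f hd 1 mult_SS not_not simp_thms if_False if_True)
    \<comment> \<open>Writing \<open>q\<close> as \<open>p + 1\<close> leaves identities between
      polynomials in the single unknown \<open>p\<close>.\<close>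
    define q p :: "int poly" where "q = [:0, 1:]" "p = [:-1, 1:]"
    have qp: "[:0, 1:] = p + 1" "[:-1, 1:] = p" by (simp_all add: q_p_def one_pCons)
    show ?thesis
      using b(3,4)
      by (cases "dn x s"; cases "dn x t"; cases "dn (x \<otimes> s) t") (simp_all only: l qp if_True if_False simp_thms, simp_all add: algebra_simps)
  qed (simp add: lam_def)
qed

definition rw :: "'a list \<Rightarrow> 'a \<Rightarrow> int poly" where
  "rw u = foldl (\<lambda>h s. lam s h) (\<lambda>x. if x = \<one> then 1 else 0) u"

lemma rw_snoc [simp]: "rw (u @ [s]) = lam s (rw u)" by (simp add: rw_def)

lemma wd_snoc [simp]: "u \<in> lists S \<Longrightarrow> s \<in> S \<Longrightarrow> wd (u @ [s]) = wd u \<otimes> s"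
  using wd_append[of u "[s]"] by simp

lemma two_desc:
  assumes "y \<in> carrier G" "s \<in> S" "t \<in> S" "s \<noteq> t" "dn y s" "dn y t"
  shows "ord (s \<otimes> t) = 2 \<Longrightarrow> \<exists>z\<in>carrier G. y = z \<otimes> s \<otimes> t \<and> len y = len z + 2"
    "ord (s \<otimes> t) = 3 \<Longrightarrow> \<exists>z\<in>carrier G. y = z \<otimes> s \<otimes> t \<otimes> s \<and> len y = len z + 3"
proof -
  have l1: "len y = len (y \<otimes> s) + 1" "len y = len (y \<otimes> t) + 1"
    using len_step[of y s] len_step[of y t] assms by auto
  {
    assume o: "ord (s \<otimes> t) = 2"
    then have "dn (y \<otimes> t) s" using dn_comm[of y t s] ord_SS_sym[of s t] assms by simp
    then have "len (y \<otimes> t) = len (y \<otimes> t \<otimes> s) + 1" using len_step[of "y \<otimes> t" s] assms by auto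
    then show "\<exists>z\<in>carrier G. y = z \<otimes> s \<otimes> t \<and> len y = len z + 2"
      using assms l1 by (intro bexI[of _ "y \<otimes> t \<otimes> s"]) auto
  next
    assume o: "ord (s \<otimes> t) = 3"
    have d1: "dn (y \<otimes> s) t" using dn_braid(3)[OF assms(1-4) o] assms by simp
    have d2: "dn (y \<otimes> s \<otimes> t) s" using dn_braid(2)[OF assms(1-4) o] assms by simp
    have "len y = len (y \<otimes> s \<otimes> t \<otimes> s) + 3"
      using l1 d1 d2 len_step[of "y \<otimes> s" t] len_step[of "y \<otimes> s \<otimes> t" s] assms by auto
    then show "\<exists>z\<in>carrier G. y = z \<otimes> s \<otimes> t \<otimes> s \<and> len y = len z + 3"
      using assms by (intro bexI[of _ "y \<otimes> s \<otimes> t \<otimes> s"]) auto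
  }
qed

text \<open>Matsumoto's argument: if reduced words of \<open>y\<close> end in different letters
  \<open>s\<close> and \<open>t\<close>, then \<open>y\<close> ends in the longest element of the
  subgroup they generate. Reduced words through that element connect the two given ones, and their
  braided endings agree by \<open>lam_comm\<close> or \<open>lam_braid\<close>.\<close>

lemma rw_unique: "\<lbrakk>u \<in> lists S; w \<in> lists S; wd u = y; wd w = y; length u = len y; length w = len y\<rbrakk> \<Longrightarrow> rw u = rw w"
proof (induct "len y" arbitrary: y u w rule: less_induct)
  case less
  note pr = less.prems
  have yc: "y \<in> carrier G" using pr wd_carr by blast
  show ?case
  proof (cases "len y = 0")
    case True
    then show ?thesis using pr by simp
  next
    case False
    obtain u' s where u: "u = u' @ [s]" using pr False by (metis length_0_conv rev_exhaust)
    obtain w' t where w: "w = w' @ [t]" using pr False by (metis length_0_conv rev_exhaust)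
    have m: "s \<in> S" "t \<in> S" "u' \<in> lists S" "w' \<in> lists S" using u w pr by auto
    have yu: "y = wd u' \<otimes> s" "y = wd w' \<otimes> t" using pr u w m by (metis wd_snoc)+
    then have ys: "wd u' = y \<otimes> s" "wd w' = y \<otimes> t" using m by (metis mult_SS wd_carr)+
    have l: "length u' = len (y \<otimes> s)" "length w' = len (y \<otimes> t)" "dn y s" "dn y t"
        "len y = len (y \<otimes> s) + 1" "len y = len (y \<otimes> t) + 1"
      using len_le[OF m(3)] len_le[OF m(4)] len_step[OF yc m(1)] len_step[OF yc m(2)] ys u w pr by auto
    show ?thesis
    proof (cases "s = t")
      case True
      have "rw u' = rw w'" using less.hyps[of "y \<otimes> s" u' w'] l m ys True by simp
      then show ?thesis using u w True by simp
    next
      case False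
      consider (a) "ord (s \<otimes> t) = 2" | (b) "ord (s \<otimes> t) = 3" using ord_SS[OF m(1,2) False] by blast
      then show ?thesis
      proof cases
        case a
        obtain z where z: "z \<in> carrier G" "y = z \<otimes> s \<otimes> t" "len y = len z + 2"
          using two_desc(1)[OF yc m(1,2) False l(3,4) a] by blast
        obtain p where p: "p \<in> lists S" "length p = len z" "wd p = z" using len_word[OF z(1)] by auto
        have e: "y \<otimes> t = z \<otimes> s" "y \<otimes> s = z \<otimes> t"
          using z m comm2[OF m(1,2) a] by (auto simp: m_assoc S_sq)
        have "rw u' = rw (p @ [t])"
          by (rule less.hyps[of "y \<otimes> s"]) (use l m ys p e z in \<open>auto simp del: in_lists_conv_set\<close>)
        moreover have "rw w' = rw (p @ [s])"
          by (rule less.hyps[of "y \<otimes> t"]) (use l m ys p e z in \<open>auto simp del: in_lists_conv_set\<close>)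
        ultimately show ?thesis using u w lam_comm[OF m(1,2) False a] by simp
      next
        case b
        obtain z where z: "z \<in> carrier G" "y = z \<otimes> s \<otimes> t \<otimes> s" "len y = len z + 3"
          using two_desc(2)[OF yc m(1,2) False l(3,4) b] by blast
        obtain p where p: "p \<in> lists S" "length p = len z" "wd p = z" using len_word[OF z(1)] by auto
        have "y = z \<otimes> (s \<otimes> t \<otimes> s)" using z m by (simp add: m_assoc)
        then have y2: "y = z \<otimes> t \<otimes> s \<otimes> t" using z m braid3[OF m(1,2) b] by (simp add: m_assoc)
        have e: "y \<otimes> s = z \<otimes> s \<otimes> t" using z m by simp
        have e2: "y \<otimes> t = z \<otimes> t \<otimes> s" using y2 z m by simp
        have "rw u' = rw ((p @ [s]) @ [t])"
          by (rule less.hyps[of "y \<otimes> s"]) (use l m ys p e e2 z in \<open>auto simp del: append_assoc\<close>)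
        moreover have "rw w' = rw ((p @ [t]) @ [s])"
          by (rule less.hyps[of "y \<otimes> t"]) (use l m ys p e e2 z in \<open>auto simp del: append_assoc\<close>)
        ultimately show ?thesis using u w lam_braid[OF m(1,2) False b] by (simp del: append_assoc)
      qed
    qed
  qed
qed

definition Rf :: "'a \<Rightarrow> 'a \<Rightarrow> int poly" where
  "Rf x y = (if x \<in> carrier G \<and> y \<in> carrier G then rw (SOME u. u \<in> lists S \<and> wd u = y \<and> length u = len y) x else 0)"

lemma Rf_word:
  assumes a: "u \<in> lists S" "wd u = y" "length u = len y" "x \<in> carrier G"
  shows "Rf x y = rw u x"
proof -
  let ?P = "\<lambda>u. u \<in> lists S \<and> wd u = y \<and> length u = len y"
  have "?P (SOME u. ?P u)" by (rule someI[of _ u]) (use a in blast)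
  then have "rw (SOME u. ?P u) = rw u" using rw_unique a by blast
  moreover have "y \<in> carrier G" using a wd_carr by blast
  ultimately show ?thesis using a by (simp add: Rf_def)
qed

lemma Rf_rec:
  assumes a: "x \<in> carrier G" "y \<in> carrier G" "s \<in> S" "dn y s"
  shows "Rf x y = lam s (\<lambda>x. Rf x (y \<otimes> s)) x"
proof -
  obtain p where p: "p \<in> lists S" "length p = len (y \<otimes> s)" "wd p = y \<otimes> s" using len_word[of "y \<otimes> s"] a by auto
  have ly: "len y = len (y \<otimes> s) + 1" using a len_step[of y s] by auto
  have "Rf x y = rw (p @ [s]) x" by (rule Rf_word) (use a p ly in \<open>auto simp del: rw_snoc\<close>)
  moreover have "z \<in> carrier G \<Longrightarrow> Rf z (y \<otimes> s) = rw p z" for z using Rf_word[OF p(1,3,2)] by simp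
  ultimately show ?thesis using a by (simp add: lam_def)
qed

lemma Rf_one: "x \<in> carrier G \<Longrightarrow> Rf x \<one> = (if x = \<one> then 1 else 0)"
  using Rf_word[of "[]" \<one> x] by (simp add: rw_def)

lemma less_dn: "x \<in> carrier G \<Longrightarrow> s \<in> S \<Longrightarrow> bruhat_less (x \<otimes> s) x \<longleftrightarrow> dn x s"
  using le_dn[of x s] le_len[of "x \<otimes> s" x] by (auto simp: bruhat_less_def)

lemma less_up: "x \<in> carrier G \<Longrightarrow> s \<in> S \<Longrightarrow> bruhat_less x (x \<otimes> s) \<longleftrightarrow> up x s"
  using le_up[of x s] le_len[of x "x \<otimes> s"] by (auto simp: bruhat_less_def)

lemma Rf_zero: "y \<in> carrier G \<Longrightarrow> x \<in> carrier G \<Longrightarrow> \<not> x \<preceq> y \<Longrightarrow> Rf x y = 0"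
proof (induct arbitrary: x rule: len_induct)
  case one
  then show ?case using Rf_one by auto
next
  case (step y s)
  have y: "y \<preceq> y \<otimes> s" using le_up step by simp
  have 1: "\<not> x \<otimes> s \<preceq> y" using lift_up[of "x \<otimes> s" y s] step by auto
  have 2: "\<not> x \<preceq> y" using y le_trans step by blast
  show ?case using Rf_rec[of x "y \<otimes> s" s] step 1 2 by (simp add: lam_def)
qed

lemma Rf_diag: "y \<in> carrier G \<Longrightarrow> Rf y y = 1"
proof (induct rule: len_induct)
  case (step y s)
  then show ?case using Rf_rec[of "y \<otimes> s" "y \<otimes> s" s] by (simp add: lam_def)
qed (simp add: Rf_one)

lemma Rf_family: "is_R_family Rf"
  unfolding is_R_family_def
proof (intro conjI ballI allI impI)
  fix x y
  assume "\<not> x \<preceq> y"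
  then show "Rf x y = 0" using Rf_zero by (cases "x \<in> carrier G \<and> y \<in> carrier G") (auto simp: Rf_def)
qed (auto simp: Rf_diag Rf_rec lam_def less_dn less_up)

lemma R_family_unique: "is_R_family R \<Longrightarrow> is_R_family R' \<Longrightarrow> R = R'"
proof (intro ext)
  fix x y
  assume a: "is_R_family R" "is_R_family R'"
  show "R x y = R' x y"
  proof (cases "x \<preceq> y")
    case False
    then show ?thesis using a by (simp add: is_R_family_def)
  next
    case True
    have "y \<in> carrier G" "x \<in> carrier G" using True le_carr by auto
    then show ?thesis
    proof (induct arbitrary: x rule: len_induct)
      case one
      show ?case
      proof (cases "x = \<one>")
        case True
        then show ?thesis using a by (simp add: is_R_family_def)
      next
        case False
        then have "\<not> x \<preceq> \<one>" using le_len[of x \<one>] by auto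
        then show ?thesis using a unfolding is_R_family_def by metis
      qed
    next
      case (step y s)
      have d: "bruhat_less (y \<otimes> s \<otimes> s) (y \<otimes> s)" using less_dn[of "y \<otimes> s" s] step by simp
      note rec = a(1)[unfolded is_R_family_def, THEN conjunct2, THEN conjunct2, rule_format, of x "y \<otimes> s" s]
         a(2)[unfolded is_R_family_def, THEN conjunct2, THEN conjunct2, rule_format, of x "y \<otimes> s" s]
      show ?case using rec d step len_gt[of x s] less_dn[of x s] less_up[of x s] by (cases "dn x s") auto
    qed
  qed
qed

lemma R_poly_Rf: "R_poly = Rf"
  unfolding R_poly_def by (rule the_equality) (auto simp: Rf_family R_family_unique)

text \<open>In the ascent case the top term comes from \<open>q * Rf x y\<close> alone, because
  \<open>x \<otimes> s\<close> is longer than \<open>x\<close> and so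
  \<open>q * Rf (x \<otimes> s) y\<close> has lower degree.\<close>

lemma Rf_monic: "x \<preceq> y \<Longrightarrow> (\<forall>n > len y - len x. coeff (Rf x y) n = 0) \<and> coeff (Rf x y) (len y - len x) = 1"
proof -
  assume xy: "x \<preceq> y"
  then have "y \<in> carrier G" "x \<in> carrier G" using le_carr by auto
  then show ?thesis using xy
  proof (induct arbitrary: x rule: len_induct)
    case one
    then have "x = \<one>" using le_len[of x \<one>] by auto
    then show ?case by (simp add: Rf_one)
  next
    case (step y s)
    have l: "len (y \<otimes> s) = len y + 1" using step len_step[of y s] by auto
    have R: "Rf x (y \<otimes> s) = lam s (\<lambda>x. Rf x y) x" using Rf_rec[of x "y \<otimes> s" s] step by simp
    show ?case
    proof (cases "dn x s")
      case True
      have "x \<otimes> s \<preceq> y" using lift_dn_dn[of x "y \<otimes> s" s] step True by simp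
      moreover have "len x = len (x \<otimes> s) + 1" using len_step[of x s] step True by auto
      ultimately show ?thesis using step l R True by (auto simp: lam_def)
    next
      case False
      then have u: "up x s" using len_gt step by blast
      have xy: "x \<preceq> y" using lift_up_dn[of x "y \<otimes> s" s] step u by simp
      have xl: "len x \<le> len y" using le_len[OF xy] by auto
      have xs: "len (x \<otimes> s) = len x + 1" using len_step[of x s] step u by auto
      have A: "\<forall>n > len y - len x. coeff (Rf x y) n = 0" "coeff (Rf x y) (len y - len x) = 1"
        using step xy by auto
      have B: "coeff (Rf (x \<otimes> s) y) n = 0" if "n \<ge> len y - len x" "len y - len x > 0 \<or> \<not> x \<otimes> s \<preceq> y" for n
      proof (cases "x \<otimes> s \<preceq> y")
        case True
        then show ?thesis using step(4)[of "x \<otimes> s"] step that xs le_len[OF True] by auto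
      next
        case False
        then show ?thesis using Rf_zero step by simp
      qed
      \<comment> \<open>For \<open>len y = len x\<close> the degree bound for
        \<open>x \<otimes> s\<close> truncates to 0 and proves nothing; there
        \<open>x \<otimes> s\<close> is too long to lie below \<open>y\<close>.\<close>
      have B2: "coeff (Rf (x \<otimes> s) y) n = 0" if "n \<ge> len y - len x" for n
      proof (cases "len y = len x")
        case True
        then have "\<not> x \<otimes> s \<preceq> y" using le_len[of "x \<otimes> s" y] xs by auto
        then show ?thesis using B that by auto
      qed (use B that xl in auto)
      have R2: "Rf x (y \<otimes> s) = pCons 0 (Rf (x \<otimes> s) y) + pCons 0 (Rf x y) - Rf x y"
        using R False step by (simp add: lam_def)
      have e: "coeff (Rf x (y \<otimes> s)) (Suc n) = coeff (Rf (x \<otimes> s) y) n + coeff (Rf x y) n - coeff (Rf x y) (Suc n)" for n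
        by (simp add: R2)
      show ?thesis
      proof (intro conjI allI impI)
        fix n assume "len (y \<otimes> s) - len x < n"
        then obtain m where "n = Suc m" "m > len y - len x" using l xl by (cases n) auto
        then show "coeff (Rf x (y \<otimes> s)) n = 0" using e A B2 by simp
      next
        show "coeff (Rf x (y \<otimes> s)) (len (y \<otimes> s) - len x) = 1"
          using e[of "len y - len x"] A B2 l xl by (simp add: Suc_diff_le)
      qed
    qed
  qed
qed

text \<open>On the diagonal, where the subtraction in \<open>d_coeff\<close> truncates, the recursion calls for \<open>0\<close>.\<close>

definition dz :: "'a \<Rightarrow> 'a \<Rightarrow> int" where "dz x y = (if x = y then 0 else d_coeff x y)"

lemma dz_self [simp]: "dz x x = 0" by (simp add: dz_def)

lemma dz_dn:
  assumes a: "x \<in> carrier G" "y \<in> carrier G" "s \<in> S" "dn x s" "dn y s"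
  shows "dz x y = dz (x \<otimes> s) (y \<otimes> s)"
proof -
  have "x = y \<longleftrightarrow> x \<otimes> s = y \<otimes> s" using a by simp
  moreover have "len x = len (x \<otimes> s) + 1" "len y = len (y \<otimes> s) + 1" using len_step a by force+
  ultimately show ?thesis using a Rf_rec[of x y s] by (simp add: dz_def d_coeff_def R_poly_Rf lam_def)
qed

text \<open>Compare coefficients one below the top.
  \<open>q * Rf (x \<otimes> s) (y \<otimes> s)\<close> contributes its leading 1 if it is nonzero,
  \<open>q * Rf x (y \<otimes> s)\<close> the old coefficient, and
  \<open>- Rf x (y \<otimes> s)\<close> its leading \<open>-1\<close>; \<open>d\<close> is the
  negative of the sum.\<close>

lemma dz_up:
  assumes a: "x \<preceq> y" "s \<in> S" "up x s" "dn y s"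
  shows "dz x y = dz x (y \<otimes> s) + 1 - (if x \<otimes> s \<preceq> y \<otimes> s then 1 else 0)"
proof -
  have c: "x \<in> carrier G" "y \<in> carrier G" using le_carr a by auto
  have xy: "x \<preceq> y \<otimes> s" using lift_up_dn a by simp
  have xs: "len (x \<otimes> s) = len x + 1" "len y = len (y \<otimes> s) + 1" using len_step[of x s] len_step[of y s] a c by auto
  have R2: "Rf x y = pCons 0 (Rf (x \<otimes> s) (y \<otimes> s)) + pCons 0 (Rf x (y \<otimes> s)) - Rf x (y \<otimes> s)"
    using Rf_rec[of x y s] a c by (simp add: lam_def)
  have ne: "x \<noteq> y" using a by auto
  show ?thesis
  proof (cases "x = y \<otimes> s")
    \<comment> \<open>Here \<open>Rf x y\<close> is \<open>q - 1\<close>, and the value 1 agrees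
      with the recursion because \<open>dz x x\<close> is 0.\<close>
    case True
    then have n: "\<not> x \<otimes> s \<preceq> y \<otimes> s" using le_len[of "x \<otimes> s" "y \<otimes> s"] xs by auto
    then have "Rf (x \<otimes> s) (y \<otimes> s) = 0" using Rf_zero a c by simp
    moreover have "Rf x (y \<otimes> s) = 1" using True Rf_diag c a by simp
    ultimately show ?thesis using ne True n xs R2 by (simp add: dz_def d_coeff_def R_poly_Rf)
  next
    case False
    then have l: "len x < len (y \<otimes> s)" using le_len[OF xy] by auto
    then obtain k where k: "len (y \<otimes> s) = len x + Suc k" by (metis less_iff_Suc_add add_Suc_right)
    have 1: "coeff (Rf x (y \<otimes> s)) (Suc k) = 1" using Rf_monic[OF xy] k by simp
    have 2: "coeff (Rf (x \<otimes> s) (y \<otimes> s)) k = (if x \<otimes> s \<preceq> y \<otimes> s then 1 else 0)"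
      using Rf_monic[of "x \<otimes> s" "y \<otimes> s"] Rf_zero[of "y \<otimes> s" "x \<otimes> s"] k xs a c by auto
    show ?thesis using ne False k xs 1 2 by (simp add: dz_def d_coeff_def R_poly_Rf R2)
  qed
qed

section \<open>Atoms and edges of Bruhat intervals\<close>


definition ht :: "('a \<Rightarrow> int) \<Rightarrow> int" where "ht v = (\<Sum>t\<in>S. v t)"

lemma ht_add [simp]: "ht (u + v) = ht u + ht v" by (simp add: ht_def sum.distrib)
lemma ht_diff [simp]: "ht (u - v) = ht u - ht v" by (simp add: ht_def sum_subtractf)
lemma ht_sc [simp]: "ht (sc c v) = c * ht v" by (simp add: ht_def sc_def sum_distrib_left)
lemma ht_al [simp]: "s \<in> S \<Longrightarrow> ht (al s) = 1" using finS by (simp add: ht_def al_def)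

lemma ht_pos: "b \<in> PR \<Longrightarrow> 0 < ht b"
proof -
  assume b: "b \<in> PR"
  then obtain t where t: "b t > 0" by (auto simp: PR_def pos_def)
  then have tS: "t \<in> S" using Rt_support PR_Rt b by force
  have "b t \<le> ht b" unfolding ht_def by (rule member_le_sum) (use b tS finS in \<open>auto simp: PR_def pos_def\<close>)
  then show ?thesis using t by simp
qed

lemma pos_not_uminus: "b \<in> PR \<Longrightarrow> c \<in> PR \<Longrightarrow> b \<noteq> - c"
  using ht_pos[of b] ht_pos[of c] by (auto simp: ht_def sum_negf)

lemma bf_PR: "b \<in> PR \<Longrightarrow> c \<in> PR \<Longrightarrow> b \<noteq> c \<Longrightarrow> bf b c = -1 \<or> bf b c = 0 \<or> bf b c = 1"
  using bf_cases[of b c] pos_not_uminus PR_Rt by blast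

text \<open>Since \<open>bf b b\<close> is positive, some \<open>s\<close> has
  \<open>b s * co s b > 0\<close>, and different positive roots pair to at most 1.\<close>

lemma PR_decomp:
  assumes b: "b \<in> PR" "b \<notin> al ` S"
  shows "\<exists>s\<in>S. co s b = 1 \<and> b - al s \<in> PR"
proof -
  have "0 < bf b b" using b PR_Rt bf_Rt by force
  then obtain s where s: "s \<in> S" "0 < b s * co s b"
    unfolding bf_def by (meson not_less sum_nonpos)
  have "0 \<le> b s" using b by (auto simp: PR_def pos_def)
  then have "0 < co s b" using s by (auto simp: zero_less_mult_iff)
  then have c: "co s b = 1" using bf_PR[of "al s" b] s b by auto
  have "sr s b = b - al s" using c by (simp add: sr_def)
  moreover have "b \<noteq> al s" using b s by blast
  ultimately show ?thesis using sr_PR[of b s] b s c by metis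
qed

text \<open>Induction on the height, passing to \<open>x \<otimes> s\<close> and
  \<open>b' = b - al s = sr s b\<close>. Exactly one of \<open>x (al s)\<close> and
  \<open>x b'\<close> is positive, so the length changes caused by \<open>s\<close> at
  \<open>x\<close> and at the reflected element compensate.\<close>

lemma len_cover: "\<lbrakk>x \<in> carrier G; b \<in> PR; pos (act x b);
    \<And>b1 b2. \<lbrakk>b1 \<in> PR; b2 \<in> PR; b = b1 + b2; pos (act x b1)\<rbrakk> \<Longrightarrow> \<not> pos (act x b2)\<rbrakk>
  \<Longrightarrow> len (x \<otimes> rf b) = len x + 1"
proof (induct "nat (ht b)" arbitrary: x b rule: less_induct)
  case less
  note pr = less.prems
  show ?case
  proof (cases "b \<in> al ` S")
    case True
    then show ?thesis using pr act_al_iff(1) len_step by fastforce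
  next
    case False
    then obtain s where s: "s \<in> S" "co s b = 1" "b - al s \<in> PR" using PR_decomp pr by blast
    define b' where "b' = b - al s"
    define x' where "x' = x \<otimes> s"
    have cb: "co s b' = -1" using s by (simp add: b'_def)
    have bn: "b' \<noteq> al s" using cb s by auto
    have b1: "sr s b = b'" using s(2) by (simp add: sr_def b'_def)
    then have b2: "sr s b' = b" using sr_sr[OF s(1), of b] by simp
    have b': "b' \<in> PR" "b = b' + al s" "sr s b = b'" "sr s b' = b" "co s b' = -1" "b' \<noteq> al s"
      using s(3) cb bn b1 b2 by (simp_all add: b'_def)
    have x': "x' \<in> carrier G" "x = x' \<otimes> s" using pr s by (auto simp: x'_def)
    have h: "nat (ht b') < nat (ht b)" using b' s ht_pos[of b'] by simp
    have xb: "act x' b' = act x b" using x'_def pr s b' by simp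
    have nd: "\<not> pos (act x' c2)" if c: "c1 \<in> PR" "c2 \<in> PR" "b' = c1 + c2" "pos (act x' c1)" for c1 c2
    proof
      assume p: "pos (act x' c2)"
      have "bf (c1 + c2) (c1 + c2) = 2" using bf_Rt[OF PR_Rt[OF b'(1)]] c(3) by simp
      then have bb: "bf c1 c2 = -1" "bf c2 c1 = -1"
        using bf_Rt[OF PR_Rt[OF c(1)]] bf_Rt[OF PR_Rt[OF c(2)]] bf_sym[of c1 c2] by simp_all
      \<comment> \<open>A summand of \<open>b'\<close> cannot be \<open>al s\<close>: then
        \<open>al s\<close> would pair to \<open>2 - 1\<close> with \<open>b'\<close>, but it pairs
        to \<open>-1\<close>.\<close>
      have cc: "bf (al s) c1 + bf (al s) c2 = -1" using b'(5) c(3) s(1) by simp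
      have n1: "c1 \<noteq> al s"
      proof
        assume e: "c1 = al s"
        have "bf (al s) c1 = 2" "bf (al s) c2 = -1" using e bb(1) s(1) by auto
        then show False using cc by simp
      qed
      have n2: "c2 \<noteq> al s"
      proof
        assume e: "c2 = al s"
        have "bf (al s) c2 = 2" "bf (al s) c1 = -1" using e bb(2) s(1) by auto
        then show False using cc by simp
      qed
      have "sr s c1 \<in> PR" "sr s c2 \<in> PR" using sr_PR c(1,2) s(1) n1 n2 by blast+
      moreover have "b = sr s c1 + sr s c2" using b'(4) c(3) by (simp add: sr_lin)
      moreover have "act x (sr s c1) = act x' c1" "act x (sr s c2) = act x' c2" using x' s by (simp_all add: act_lin)
      ultimately show False using pr(4)[of "sr s c1" "sr s c2"] c p by simp
    qed
    have l: "len (x' \<otimes> rf b') = len x' + 1" by (rule less.hyps) (use h x' b' xb pr nd in auto)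
    have R: "b' \<in> Rt" "b \<in> Rt" using PR_Rt b' pr by auto
    have e: "x \<otimes> rf b = x' \<otimes> rf b' \<otimes> s" using rf_sr[of x b s] pr R s b' by (simp add: x'_def)
    have a: "act (x' \<otimes> rf b') (al s) = act x' b"
      using x' R s b'(2,5) bf_sym[of b' "al s"] by (simp add: act_rf add.commute)
    have a2: "act x' b = act x b'" using x'_def pr s b' by simp
    define z where "z = x' \<otimes> rf b'"
    have zc: "z \<in> carrier G" using x' R by (simp add: z_def)
    have ez: "len (x \<otimes> rf b) = len (z \<otimes> s)" "len z = len x' + 1" using e l by (simp_all add: z_def)
    note stp = len_step[OF pr(1) s(1), folded x'_def] len_step[OF zc s(1)]
    show ?thesis
    proof (cases "pos (act x (al s))")
      case True
      then have "\<not> pos (act x b')" using pr(4)[of "al s" b'] b' s by (simp add: add.commute)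
      then have "dn z s" using dn_pos[OF zc s(1)] a a2 by (simp add: z_def)
      moreover have "len x < len x'" using True act_al_iff(1)[OF pr(1) s(1)] by (simp add: x'_def)
      ultimately show ?thesis using stp ez by linarith
    next
      case False
      then have d: "len x' < len x" using dn_pos[OF pr(1) s(1)] by (simp add: x'_def)
      have "pos (act x b')"
      proof -
        have "act x b' = act x b + (- act x (al s))" using b' pr by (simp add: act_lin)
        then show ?thesis using pos_add[of "act x b" "- act x (al s)"] False pr s Rt_cases[of "act x (al s)"] by auto
      qed
      then have "up z s" using dn_pos[OF zc s(1)] len_gt[OF zc s(1)] a a2 by (simp add: z_def)
      then show ?thesis using stp ez d by linarith
    qed
  qed
qed

text \<open>In type A2 the reflection in \<open>b1 + b2\<close> is \<open>rf b1 rf b2 rf b1\<close>.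
  This path and the long edge at \<open>x\<close> form a diamond, through which edges that are not
  covers are generated.\<close>

lemma A2_path:
  assumes "x \<in> carrier G" "b1 \<in> PR" "b2 \<in> PR" "b1 + b2 \<in> PR" "pos (act x b1)" "pos (act x b2)"
  defines "p \<equiv> x \<otimes> rf b1" and "q \<equiv> x \<otimes> rf b1 \<otimes> rf b2"
  shows "bruhat_step x p" "bruhat_step p q" "bruhat_step q (x \<otimes> rf (b1 + b2))"
proof -
  have R: "b1 \<in> Rt" "b2 \<in> Rt" "b1 + b2 \<in> Rt" using assms PR_Rt by auto
  have bb: "bf b1 b2 = -1" "bf b2 b1 = -1"
    using bf_Rt[OF R(3)] bf_Rt[OF R(1)] bf_Rt[OF R(2)] bf_sym[of b1 b2] by auto
  have pc: "p \<in> carrier G" "q \<in> carrier G" using assms R by auto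
  show "bruhat_step x p" using assms by (auto simp: step_iff)
  have "act p b2 = act x b1 + act x b2" using assms(1) R bb by (simp add: p_def act_rf act_lin add.commute)
  then show "bruhat_step p q" using pc assms(2-6) pos_add unfolding step_iff p_def q_def by auto
  have aq: "act q b1 = act x b2"
    using assms(1) R bb bf_Rt[OF R(1)] by (simp add: q_def act_rf act_lin) (simp add: sc_def fun_eq_iff)
  have "act (rf b1) b2 = b1 + b2" using R bb by (simp add: act_rf add.commute)
  then have "rf (b1 + b2) = rf b1 \<otimes> rf b2 \<otimes> inv (rf b1)" using rf_act[of "rf b1" b2] R by simp
  moreover have "inv (rf b1) = rf b1" using R by (simp add: inv_equality)
  ultimately have "x \<otimes> rf (b1 + b2) = q \<otimes> rf b1" using assms(1) R by (simp add: q_def m_assoc)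
  then show "bruhat_step q (x \<otimes> rf (b1 + b2))" using aq assms(2,6) pc unfolding step_iff by auto
qed

section \<open>Atoms of an interval and their connectivity\<close>

definition atom :: "'a \<Rightarrow> 'a \<Rightarrow> 'a \<Rightarrow> bool" where
  "atom x y a \<longleftrightarrow> bruhat_step x a \<and> len a = len x + 1 \<and> a \<preceq> y"

text \<open>A shortest element of the interval reached from \<open>x\<close> by one step is a cover
  of \<open>x\<close>; otherwise its root decomposes and \<open>A2_path\<close> begins with a
  shorter one.\<close>

lemma ex_atom: assumes "x \<preceq> y" "x \<noteq> y" shows "\<exists>a. atom x y a"
proof -
  let ?P = "\<lambda>w. bruhat_step x w \<and> w \<preceq> y"
  have x: "x \<in> carrier G" "y \<in> carrier G" using le_carr assms by auto
  have "bruhat_step\<^sup>*\<^sup>* x y" using assms by (simp add: bruhat_le_def)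
  then obtain w where "bruhat_step x w" "bruhat_step\<^sup>*\<^sup>* w y" using assms(2) by (metis converse_rtranclpE)
  then have "?P w" using step_carr x by (auto simp: bruhat_le_def)
  then obtain w where w: "?P w" and mn: "\<And>w'. ?P w' \<Longrightarrow> len w \<le> len w'"
    using ex_has_least_nat[of ?P w len] by blast
  obtain b where b: "b \<in> PR" "w = x \<otimes> rf b" "pos (act x b)" using w by (auto simp: step_iff)
  have "len w = len x + 1"
  proof (rule ccontr)
    assume "len w \<noteq> len x + 1"
    then obtain b1 b2 where d: "b1 \<in> PR" "b2 \<in> PR" "b = b1 + b2" "pos (act x b1)" "pos (act x b2)"
      using len_cover[of x b] b x by blast
    note A = A2_path[OF x(1) d(1,2) _ d(4,5)]
    have s: "bruhat_step x (x \<otimes> rf b1)" "bruhat_step (x \<otimes> rf b1) (x \<otimes> rf b1 \<otimes> rf b2)"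
      "bruhat_step (x \<otimes> rf b1 \<otimes> rf b2) w" using A b d by auto
    then have "?P (x \<otimes> rf b1)" "len (x \<otimes> rf b1) < len w"
      using step_le le_trans w step_len by (meson, meson less_trans)
    then show False using mn by force
  qed
  then show ?thesis using w by (auto simp: atom_def)
qed

definition arel :: "'a \<Rightarrow> 'a \<Rightarrow> 'a \<Rightarrow> 'a \<Rightarrow> bool" where
  "arel x y a a' \<longleftrightarrow> atom x y a \<and> atom x y a' \<and> (\<exists>c. atom a y c \<and> atom a' y c)"

lemma arel_sym: "arel x y a a' \<Longrightarrow> arel x y a' a" by (auto simp: arel_def)

lemma arel_mono: "arel x y a a' \<Longrightarrow> y \<preceq> y2 \<Longrightarrow> arel x y2 a a'"
  unfolding arel_def atom_def using le_trans by blast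

lemma atom_carr: "atom x y a \<Longrightarrow> x \<in> carrier G \<and> a \<in> carrier G \<and> y \<in> carrier G"
  using step_carr le_carr by (auto simp: atom_def)

lemma atom_lift:
  assumes "atom x y a" "s \<in> S" "up y s" "a \<noteq> x \<otimes> s" "up x s"
  shows "atom (x \<otimes> s) (y \<otimes> s) (a \<otimes> s) \<and> up a s"
proof -
  note c = atom_carr[OF assms(1)]
  have st: "bruhat_step (x \<otimes> s) (a \<otimes> s)" using step_s[of x a s] assms by (auto simp: atom_def)
  have "len (x \<otimes> s) = len a" using assms len_step[of x s] c by (auto simp: atom_def)
  then have u: "up a s" using step_len[OF st] by simp
  then have "len (a \<otimes> s) = len (x \<otimes> s) + 1"
    using assms len_step[of x s] len_step[of a s] c by (auto simp: atom_def)
  then show ?thesis using st u assms lift_up by (auto simp: atom_def)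
qed

text \<open>Lift along an ascent \<open>s\<close> of \<open>y\<close>. If \<open>s\<close> is an
  ascent of \<open>x\<close>, every other atom is related to the atom \<open>x \<otimes> s\<close>.
  If not, an atom of \<open>[x, Y]\<close> lies below \<open>y\<close> or comes from an atom of
  \<open>[X, y]\<close> by right multiplication with \<open>s\<close>. Relations in
  \<open>[X, y]\<close> carry over as long as they avoid \<open>x\<close>, which is itself an atom
  of \<open>[X, y]\<close> if \<open>x\<close> is below \<open>y\<close>.\<close>

lemma atoms_connected: "y \<in> carrier G \<Longrightarrow> atom x y a \<Longrightarrow> atom x y a' \<Longrightarrow> (arel x y)\<^sup>*\<^sup>* a a'"
proof (induct arbitrary: x a a' rule: len_induct)
  case one
  then show ?case using step_len le_len[of a \<one>] by (auto simp: atom_def)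
next
  case (step y s)
  have c: "x \<in> carrier G" "a \<in> carrier G" "a' \<in> carrier G" using step atom_carr by auto
  define Y where "Y = y \<otimes> s"
  have Y: "Y \<in> carrier G" "Y \<otimes> s = y" "dn Y s" "y \<preceq> Y" using step le_up by (auto simp: Y_def)
  have yl: "len Y = len y + 1" using step len_step[of y s] by (auto simp: Y_def)
  note IH = step.hyps(4)
  have at: "atom x Y a" "atom x Y a'" using step by (auto simp: Y_def)
  have goal: "(arel x Y)\<^sup>*\<^sup>* a a'"
  proof (cases "dn x s")
    case False
    then have u: "up x s" using len_gt c step by blast
    have xY: "x \<preceq> Y" using at step_le le_trans by (meson atom_def)
    have ax: "atom x Y (x \<otimes> s)" using step_up[of x s] lift_dn[OF xY step(2) Y(3)] u c step len_step[of x s]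
      by (auto simp: atom_def)
    have *: "(arel x Y)\<^sup>*\<^sup>* d (x \<otimes> s)" if d: "atom x Y d" for d
    proof (cases "d = x \<otimes> s")
      case False
      have dc: "d \<in> carrier G" using d atom_carr by blast
      have st: "bruhat_step (x \<otimes> s) (d \<otimes> s)" using step_s[of x d s] d step False by (auto simp: atom_def)
      have ls: "len (x \<otimes> s) = len x + 1" using ax by (simp add: atom_def)
      have ud: "up d s" using step_len[OF st] ls d by (auto simp: atom_def)
      have ld: "len (d \<otimes> s) = len d + 1" using ud len_step[of d s] dc step by auto
      have "d \<otimes> s \<preceq> Y" using lift_dn[of d Y s] d step Y by (simp add: atom_def)
      then have "atom d Y (d \<otimes> s)" "atom (x \<otimes> s) Y (d \<otimes> s)"
        using st ls ld d step_up[of d s] dc ud step by (auto simp: atom_def)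
      then have "arel x Y d (x \<otimes> s)" using d ax by (auto simp: arel_def)
      then show ?thesis by blast
    qed simp
    have "symp (arel x Y)" using arel_sym by (auto intro: sympI)
    then have "(arel x Y)\<^sup>*\<^sup>* (x \<otimes> s) a'" using *[OF at(2)] by (metis sympD symp_rtranclp)
    then show ?thesis using *[OF at(1)] by simp
  next
    case dx: True
    define X where "X = x \<otimes> s"
    have X: "X \<in> carrier G" "x = X \<otimes> s" "up X s" using c step dx by (auto simp: X_def)
    have xl: "len x = len X + 1" using c step dx len_step[of x s] by (auto simp: X_def)
    have ax: "bruhat_step X x" using step_dn[of x s] c step dx by (simp add: X_def)
    have lift: "atom x Y (d \<otimes> s) \<and> up d s" if "atom X y d" "d \<noteq> x" for d
      using atom_lift[of X y d s] that step X by (simp add: Y_def)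
    have down: "atom X y (d \<otimes> s) \<and> d \<otimes> s \<noteq> x" if d: "atom x Y d" "dn d s" for d
    proof -
      have dc: "d \<in> carrier G" using d atom_carr by blast
      have n: "d \<noteq> x \<otimes> s" using d dx step_len[of x d] by (auto simp: atom_def)
      then have "bruhat_step X (d \<otimes> s)" using step_s[of x d s] d step by (auto simp: atom_def X_def)
      moreover have "d \<otimes> s \<preceq> y" using lift_dn_dn[of d Y s] d step Y by (simp add: atom_def)
      moreover have "len (d \<otimes> s) = len X + 1" using d xl len_step[of d s] dc step by (auto simp: atom_def)
      moreover have "d \<otimes> s \<noteq> x" using n dc c step mult_SS by metis
      ultimately show ?thesis by (simp add: atom_def)
    qed
    have rl: "d \<otimes> s = e \<otimes> s \<or> arel x Y (d \<otimes> s) (e \<otimes> s)" if de: "arel X y d e" "d \<noteq> x" "e \<noteq> x" for d e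
    proof -
      obtain k where k: "atom d y k" "atom e y k" "atom X y d" "atom X y e" using de by (auto simp: arel_def)
      note ld = lift[OF k(3) de(2)] and le = lift[OF k(4) de(3)]
      have kc: "d \<in> carrier G" "e \<in> carrier G" "k \<in> carrier G" using k atom_carr by auto
      have l1: "len (d \<otimes> s) = len d + 1" "len (e \<otimes> s) = len e + 1" using ld le len_step[of d s] len_step[of e s] kc step by auto
      show ?thesis
      proof (cases "dn k s")
        case True
        have "d \<otimes> s \<preceq> k" "e \<otimes> s \<preceq> k" using lift_dn[of d k s] lift_dn[of e k s] k step_le True step by (auto simp: atom_def)
        moreover have "len (d \<otimes> s) = len k" "len (e \<otimes> s) = len k" using l1 k by (auto simp: atom_def)
        ultimately show ?thesis using le_len[of "d \<otimes> s" k] le_len[of "e \<otimes> s" k] by auto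
      next
        case False
        then have uk: "up k s" using len_gt kc step by blast
        have n: "k \<noteq> d \<otimes> s" "k \<noteq> e \<otimes> s" using uk ld le kc step by auto
        have "atom (d \<otimes> s) Y (k \<otimes> s)" "atom (e \<otimes> s) Y (k \<otimes> s)"
          using atom_lift[of d y k s] atom_lift[of e y k s] k n step ld le by (auto simp: Y_def)
        then show ?thesis using ld le by (auto simp: arel_def)
      qed
    qed
    show ?thesis
    proof (cases "x \<preceq> y")
      case nle: False
      have all_dn: "dn d s" if d: "atom x Y d" for d
      proof (rule ccontr)
        assume "\<not> dn d s"
        then have "up d s" using len_gt atom_carr d step by blast
        then have "d \<preceq> y" using lift_up_dn[of d Y s] d step Y by (simp add: atom_def)
        then show False using nle d step_le le_trans by (meson atom_def)
      qed
      have nx: "d \<noteq> x" if "atom X y d" for d using that nle by (auto simp: atom_def)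
      have "(arel X y)\<^sup>*\<^sup>* (a \<otimes> s) (a' \<otimes> s)" using IH down all_dn at by blast
      then have "(arel x Y)\<^sup>*\<^sup>* (a \<otimes> s \<otimes> s) (a' \<otimes> s \<otimes> s)"
      proof (induct rule: rtranclp_induct)
        case (step d e)
        have "d \<noteq> x" "e \<noteq> x" using step(2) nx by (auto simp: arel_def)
        then show ?case using rl[OF step(2)] step(3) by (metis rtranclp.rtrancl_into_rtrancl)
      qed simp
      then show ?thesis using c step by simp
    next
      case xy: True
      show ?thesis
      proof (cases "x = y")
        case True
        have "d = Y" if "atom x Y d" for d using that le_len[of d Y] yl True by (auto simp: atom_def)
        from this[OF at(1)] this[OF at(2)] show ?thesis by simp
      next
        case False
        then obtain w0 where w0: "atom x y w0" using ex_atom xy by blast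
        have lw: "(arel x Y)\<^sup>*\<^sup>* d w0" if d: "atom x y d" for d
        proof -
          have "(arel x y)\<^sup>*\<^sup>* d w0" using IH[OF d w0] .
          then show ?thesis by (rule rtranclp_mono[THEN predicate2D, rotated]) (auto intro: arel_mono Y(4))
        qed
        have axX: "atom X y x" using ax xl xy by (simp add: atom_def)
        \<comment> \<open>Follow a path to the atom \<open>x\<close> of \<open>[X, y]\<close>. The
          last element \<open>d\<close> before \<open>x\<close> has a cover \<open>k\<close> in
          common with it; this \<open>k\<close> is an atom of \<open>[x, y]\<close>, and
          \<open>d \<otimes> s\<close> equals \<open>k\<close> or is related to it.\<close>
        have key: "(arel x Y)\<^sup>*\<^sup>* (d \<otimes> s) w0" if "(arel X y)\<^sup>*\<^sup>* d x" "d \<noteq> x" for d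
          using that
        proof (induct rule: converse_rtranclp_induct)
          case (step d e)
          show ?case
          proof (cases "e = x")
            case False
            then have "d \<otimes> s = e \<otimes> s \<or> arel x Y (d \<otimes> s) (e \<otimes> s)" using rl step by blast
            then show ?thesis using step False by (metis converse_rtranclp_into_rtranclp)
          next
            case True
            obtain k where k: "atom d y k" "atom x y k" "atom X y d"
              using step(1) True by (auto simp: arel_def)
            note ld = lift[OF k(3) step(4)]
            have kc: "d \<in> carrier G" "k \<in> carrier G" using k atom_carr by auto
            have l1: "len (d \<otimes> s) = len d + 1" using ld len_step[of d s] kc \<open>s \<in> S\<close> by auto
            show ?thesis
            proof (cases "dn k s")
              case dk: True
              have "d \<otimes> s \<preceq> k" using lift_dn[of d k s] k step_le dk \<open>s \<in> S\<close> by (auto simp: atom_def)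
              moreover have "len (d \<otimes> s) = len k" using l1 k by (auto simp: atom_def)
              ultimately have "d \<otimes> s = k" using le_len[of "d \<otimes> s" k] by auto
              then show ?thesis using lw k by simp
            next
              case False
              then have uk: "up k s" using len_gt kc \<open>s \<in> S\<close> by blast
              have n: "k \<noteq> d \<otimes> s" using uk ld kc \<open>s \<in> S\<close> by auto
              have "atom (d \<otimes> s) Y (k \<otimes> s)"
                using atom_lift[of d y k s] k n ld \<open>s \<in> S\<close> \<open>up y s\<close> by (auto simp: Y_def)
              moreover have "atom k Y (k \<otimes> s)"
                using step_up[of k s] uk kc \<open>s \<in> S\<close> len_step[of k s] \<open>atom (d \<otimes> s) Y (k \<otimes> s)\<close> by (auto simp: atom_def)
              moreover have "atom x Y k" using k Y le_trans by (auto simp: atom_def)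
              ultimately have "arel x Y (d \<otimes> s) k" using ld by (auto simp: arel_def)
              then show ?thesis using lw[OF k(2)] by (meson converse_rtranclp_into_rtranclp)
            qed
          qed
        qed simp
        have conn: "(arel x Y)\<^sup>*\<^sup>* d w0" if d: "atom x Y d" for d
        proof (cases "d \<preceq> y")
          case True
          then show ?thesis using lw d by (simp add: atom_def)
        next
          case False
          have dc: "d \<in> carrier G" using d atom_carr by blast
          have "dn d s"
          proof (rule ccontr)
            assume "\<not> dn d s"
            then have "up d s" using len_gt dc step by blast
            then show False using lift_up_dn[of d Y s] d step Y False by (simp add: atom_def)
          qed
          then have "atom X y (d \<otimes> s)" "d \<otimes> s \<noteq> x" using down d by auto
          then have "(arel x Y)\<^sup>*\<^sup>* (d \<otimes> s \<otimes> s) w0" using key IH axX by blast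
          then show ?thesis using dc step by simp
        qed
        have "symp (arel x Y)" using arel_sym by (auto intro: sympI)
        then have "(arel x Y)\<^sup>*\<^sup>* w0 a'" using conn[OF at(2)] by (metis sympD symp_rtranclp)
        then show ?thesis using conn[OF at(1)] by simp
      qed
    qed
  qed
  then show ?case by (simp add: Y_def)
qed

section \<open>Diamond closed sets of edges\<close>


definition adj :: "'a \<Rightarrow> 'a \<Rightarrow> bool" where
  "adj z w \<longleftrightarrow> z \<in> carrier G \<and> (\<exists>b\<in>PR. w = z \<otimes> rf b)"

abbreviation "I \<equiv> bruhat_interval"
abbreviation "E \<equiv> bruhat_edges"

lemma I_iff: "z \<in> I x y \<longleftrightarrow> x \<preceq> z \<and> z \<preceq> y" by (simp add: bruhat_interval_def)

lemma I_carr: "z \<in> I x y \<Longrightarrow> z \<in> carrier G" using le_carr by (auto simp: I_iff)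

lemma adj_rt:
  assumes a: "z \<in> carrier G" "b \<in> Rt"
  shows "adj z (z \<otimes> rf b)"
proof -
  show ?thesis
  proof (cases "pos b")
    case True
    then show ?thesis using a by (auto simp: adj_def PR_def)
  next
    case False
    then have "- b \<in> PR" using a Rt_cases[of b] by (simp add: PR_def)
    moreover have "rf b = rf (- b)" using a by simp
    ultimately show ?thesis using a unfolding adj_def by metis
  qed
qed

lemma adj_sym: "adj z w \<Longrightarrow> adj w z"
  unfolding adj_def by (metis PR_Rt mult_rf m_closed rf_carr)

lemma step_adj: "bruhat_step z w \<Longrightarrow> adj z w" by (auto simp: step_iff adj_def)

lemma adj_cases: "adj z w \<Longrightarrow> bruhat_step z w \<or> bruhat_step w z"
proof -
  assume "adj z w"
  then obtain b where b: "z \<in> carrier G" "b \<in> PR" "w = z \<otimes> rf b" by (auto simp: adj_def)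
  have R: "b \<in> Rt" using b PR_Rt by blast
  have t: "rf b \<in> reflections" using b by (auto simp: reflections_rf)
  have "len z < len w \<or> len w < len z"
    using len_rf[OF b(1,2)] Rt_cases[OF Rt_act[OF b(1) R]] b(3) by metis
  moreover have "w \<in> carrier G" "z = w \<otimes> rf b" using b R by auto
  ultimately show ?thesis using b t unfolding bruhat_step_def by metis
qed

lemma adj_ne: "adj z w \<Longrightarrow> z \<noteq> w" using adj_cases step_len by blast

lemma adj_right: "adj z w \<Longrightarrow> v \<in> carrier G \<Longrightarrow> adj (z \<otimes> v) (w \<otimes> v)"
proof -
  assume a: "adj z w" "v \<in> carrier G"
  then obtain b where b: "z \<in> carrier G" "b \<in> Rt" "w = z \<otimes> rf b" by (auto simp: adj_def dest: PR_Rt)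
  have "w \<otimes> v = z \<otimes> v \<otimes> rf (act (inv v) b)"
    using b a mult_rf_comm[of v "act (inv v) b"] by (simp add: m_assoc)
  then show ?thesis using adj_rt[of "z \<otimes> v" "act (inv v) b"] a b by simp
qed

lemma E_iff: "{z, w} \<in> E x y \<longleftrightarrow> z \<in> I x y \<and> w \<in> I x y \<and> adj z w"
proof
  assume "{z, w} \<in> E x y"
  then obtain z' w' t where *: "{z, w} = {z', w'}" "z' \<in> I x y" "w' \<in> I x y" "t \<in> reflections" "w' = z' \<otimes> t"
    by (auto simp: bruhat_edges_def)
  then have "adj z' w'" using I_carr by (auto simp: adj_def reflections_rf)
  then show "z \<in> I x y \<and> w \<in> I x y \<and> adj z w" using * adj_sym by (auto simp: doubleton_eq_iff)
next
  assume "z \<in> I x y \<and> w \<in> I x y \<and> adj z w"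
  then show "{z, w} \<in> E x y" unfolding bruhat_edges_def by (auto simp: adj_def reflections_rf)
qed

lemma E_cases: "e \<in> E x y \<Longrightarrow> \<exists>z w. e = {z, w} \<and> z \<in> I x y \<and> w \<in> I x y \<and> bruhat_step z w"
proof -
  assume e: "e \<in> E x y"
  then obtain z w where "e = {z, w}" by (auto simp: bruhat_edges_def)
  then have "e = {z, w}" "z \<in> I x y" "w \<in> I x y" "adj z w" using e E_iff by auto
  then show ?thesis using adj_cases[of z w] by (metis insert_commute)
qed

lemma E_mono: "x \<preceq> a \<Longrightarrow> b \<preceq> y \<Longrightarrow> E a b \<subseteq> E x y"
proof
  fix e assume a: "x \<preceq> a" "b \<preceq> y" "e \<in> E a b"
  then obtain z w where e: "e = {z, w}" "z \<in> I a b" "w \<in> I a b" "bruhat_step z w" using E_cases by blast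
  have "z \<in> I x y" "w \<in> I x y" using e(2,3) a(1,2) unfolding I_iff by (meson le_trans)+
  then show "e \<in> E x y" using e(1) step_adj[OF e(4)] by (simp add: E_iff)
qed

lemma closedD:
  assumes "diamond_closed x y K" "{a, b} \<in> K" "{b, c} \<in> K" "adj c d" "adj d a" "d \<in> I x y" "a \<noteq> c" "b \<noteq> d"
  shows "{c, d} \<in> K" "{d, a} \<in> K"
proof -
  have E: "{a, b} \<in> E x y" "{b, c} \<in> E x y" using assms(1-3) unfolding diamond_closed_def by blast+
  then have i: "a \<in> I x y" "c \<in> I x y" and ab: "adj a b" "adj b c" unfolding E_iff by blast+
  have "a \<noteq> b" "b \<noteq> c" "c \<noteq> d" "d \<noteq> a"
    using adj_ne[OF ab(1)] adj_ne[OF ab(2)] adj_ne[OF assms(4)] adj_ne[OF assms(5)] by simp_all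
  moreover have "{c, d} \<in> E x y" "{d, a} \<in> E x y" using i assms(4-6) unfolding E_iff by blast+
  ultimately have "is_diamond x y a b c d" unfolding is_diamond_def using E assms(7,8) by simp
  then show "{c, d} \<in> K" "{d, a} \<in> K" using assms(1-3) unfolding diamond_closed_def by blast+
qed

lemma closed_restrict:
  assumes a: "diamond_closed x y K" "x \<preceq> a" "b \<preceq> y"
  shows "diamond_closed a b (K \<inter> E a b)"
proof -
  have K: "{r, s} \<in> K \<inter> E a b \<and> {s, p} \<in> K \<inter> E a b"
    if d: "is_diamond a b p q r s" and e: "{p, q} \<in> K" "{q, r} \<in> K" for p q r s
  proof -
    have "is_diamond x y p q r s" using d E_mono[OF a(2,3)] unfolding is_diamond_def by (meson order_trans)
    then have "{r, s} \<in> K \<and> {s, p} \<in> K" using a(1) e unfolding diamond_closed_def by meson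
    then show ?thesis using d by (simp add: is_diamond_def)
  qed
  show ?thesis unfolding diamond_closed_def
  proof (intro conjI allI impI)
    fix p q r s assume h: "is_diamond a b p q r s \<and> {p, q} \<in> K \<inter> E a b \<and> {q, r} \<in> K \<inter> E a b"
    show "{r, s} \<in> K \<inter> E a b" "{s, p} \<in> K \<inter> E a b" using K[of p q r s] h by simp_all
  qed simp
qed

lemma closed_E: "diamond_closed x y (E x y)"
  by (simp add: diamond_closed_def is_diamond_def)

lemma generating_iff: "diamond_generating x y F \<longleftrightarrow>
  F \<subseteq> E x y \<and> (\<forall>K. diamond_closed x y K \<and> F \<subseteq> K \<longrightarrow> E x y \<subseteq> K)"
proof -
  have "F \<subseteq> E x y \<Longrightarrow> diamond_closure x y F = E x y \<longleftrightarrow> (\<forall>K. diamond_closed x y K \<and> F \<subseteq> K \<longrightarrow> E x y \<subseteq> K)"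
    using closed_E[of x y] unfolding diamond_closure_def by blast
  then show ?thesis by (auto simp: diamond_generating_def)
qed

text \<open>Pass from an atom \<open>a\<close> to a related atom \<open>a'\<close>. The edges
  \<open>{x, a}\<close> and \<open>{a, d}\<close> of the diamond \<open>x, a, d, a'\<close> yield
  \<open>{d, a'}\<close> and \<open>{a', x}\<close>, and induction on \<open>[a', y]\<close> with
  its atom \<open>d\<close> yields all edges above \<open>a'\<close>. Every edge not at
  \<open>x\<close> lies above some atom.\<close>

lemma atom_generates:
  "\<lbrakk>atom x y u; diamond_closed x y K; {x, u} \<in> K; E u y \<subseteq> K\<rbrakk> \<Longrightarrow> E x y \<subseteq> K"
proof (induct "len y - len x" arbitrary: x u K rule: less_induct)
  case less
  note pr = less.prems
  have c: "x \<in> carrier G" "u \<in> carrier G" "y \<in> carrier G" using pr(1) atom_carr by auto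
  have xy: "x \<preceq> y" using pr(1) unfolding atom_def by (meson step_le le_trans)
  have all: "{x, a} \<in> K \<and> E a y \<subseteq> K" if a: "atom x y a" for a
  proof -
    have "(arel x y)\<^sup>*\<^sup>* u a" using atoms_connected[OF c(3) pr(1) a] .
    then show ?thesis
    proof (induct rule: rtranclp_induct)
      case base
      then show ?case using pr by simp
    next
      case (step a a')
      show ?case
      proof (cases "a = a'")
        case False
        obtain d where d: "atom a y d" "atom a' y d" "atom x y a" "atom x y a'" using step(2) by (auto simp: arel_def)
        have le: "x \<preceq> a" "x \<preceq> a'" "a \<preceq> d" "a' \<preceq> d" "d \<preceq> y" "a \<preceq> y" "a' \<preceq> y"
          using d step_le by (simp_all add: atom_def)
        have ad: "adj x a" "adj x a'" "adj a d" "adj a' d" using d step_adj by (auto simp: atom_def)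
        have dc: "a \<in> carrier G" "a' \<in> carrier G" "d \<in> carrier G" using d(1,2) atom_carr by blast+
        have "{a, d} \<in> E a y" using le ad dc by (simp add: E_iff I_iff)
        then have k: "{a, d} \<in> K" using step(3) by blast
        have xd: "x \<noteq> d" using d by (auto simp: atom_def)
        have "{d, a'} \<in> K" "{a', x} \<in> K"
          using closedD[OF pr(2) conjunct1[OF step(3)] k adj_sym[OF ad(4)] adj_sym[OF ad(2)]] le False xd
          by (simp_all add: I_iff)
        moreover have "E a' y \<subseteq> K"
        proof -
          have yy: "y \<preceq> y" using c by simp
          have "E d y \<subseteq> K" using E_mono[OF le(3) yy] step(3) by blast
          then have Ed: "E d y \<subseteq> K \<inter> E a' y" using E_mono[OF le(4) yy] by blast
          have "{a', d} \<in> E a' y" using le ad dc by (simp add: E_iff I_iff)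
          then have e2: "{a', d} \<in> K \<inter> E a' y" using \<open>{d, a'} \<in> K\<close> by (simp add: insert_commute)
          have "len a' = len x + 1" using d(4) by (simp add: atom_def)
          then have "len y - len a' < len y - len x" using le_len[OF le(7)] by (elim disjE) simp_all
          then have "E a' y \<subseteq> K \<inter> E a' y"
            using less.hyps[OF _ d(2) closed_restrict[OF pr(2) le(2) yy] e2 Ed] by blast
          then show ?thesis by blast
        qed
        ultimately show ?thesis by (simp add: insert_commute)
      qed (use step in simp)
    qed
  qed
  have off: "{z, w} \<in> K" if "{z, w} \<in> E x y" "bruhat_step z w" "z \<noteq> x" for z w
  proof -
    have z: "x \<preceq> z" "z \<preceq> w" "w \<preceq> y" using that(1) step_le[OF that(2)] unfolding E_iff I_iff by blast+
    have "x \<noteq> z" using that(3) by simp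
    then obtain a where a: "atom x z a" using ex_atom[OF z(1)] by blast
    have az: "bruhat_step x a" "len a = len x + 1" "a \<preceq> z" using a unfolding atom_def by blast+
    have aw: "a \<preceq> w" "z \<preceq> y" "a \<preceq> y" using az(3) z by (meson le_trans)+
    have "atom x y a" using az aw by (simp add: atom_def)
    moreover have "{z, w} \<in> E a y" using step_adj[OF that(2)] z(3) az aw by (simp add: E_iff I_iff)
    ultimately show ?thesis using all by blast
  qed
  show ?case
  proof
    fix e assume "e \<in> E x y"
    then obtain z w where e: "e = {z, w}" "{z, w} \<in> E x y" "bruhat_step z w" "w \<preceq> y"
      using E_cases[of e x y] unfolding I_iff by metis
    show "e \<in> K"
    proof (cases "z = x")
      case False
      then show ?thesis using off e by simp
    next
      case True
      obtain b where b: "b \<in> PR" "w = x \<otimes> rf b" "pos (act x b)" using e(3) True unfolding step_iff by blast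
      show ?thesis
      proof (cases "len w = len x + 1")
        case True
        then have "atom x y w" using e(3,4) \<open>z = x\<close> by (simp add: atom_def)
        then show ?thesis using all[of w] e(1) \<open>z = x\<close> by simp
      next
        case False
        then obtain b1 b2 where d: "b1 \<in> PR" "b2 \<in> PR" "b = b1 + b2" "pos (act x b1)" "pos (act x b2)"
          using len_cover[of x b] b c(1) by blast
        \<comment> \<open>A long edge at \<open>x\<close> is a side of a diamond whose sides
          \<open>{p, q}\<close> and \<open>{q, w}\<close> avoid \<open>x\<close> and are therefore
          already in \<open>K\<close>.\<close>
        define p q where pq: "p = x \<otimes> rf b1" "q = x \<otimes> rf b1 \<otimes> rf b2"
        have st: "bruhat_step x p" "bruhat_step p q" "bruhat_step q w"
          using A2_path[OF c(1) d(1,2) _ d(4,5)] d(3) b(1,2) by (simp_all add: pq)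
        have lw: "x \<preceq> p" "p \<preceq> q" "q \<preceq> w" using st[THEN step_le] by simp_all
        have le: "p \<preceq> y" "q \<preceq> y" "x \<preceq> q" "x \<preceq> w" using lw e(4) by (meson le_trans)+
        have ne: "p \<noteq> x" "q \<noteq> x" "p \<noteq> w" using st[THEN step_len] by auto
        have "{p, q} \<in> E x y" "{q, w} \<in> E x y"
          using st[THEN step_adj] lw le e(4) by (simp_all add: E_iff I_iff)
        then have "{p, q} \<in> K" "{q, w} \<in> K" using off st(2,3) ne by blast+
        moreover have "adj w x" "adj x p" using adj_sym[OF step_adj[OF e(3)]] step_adj[OF st(1)] \<open>z = x\<close> by simp_all
        moreover have "x \<in> I x y" using xy c by (simp add: I_iff)
        ultimately have "{w, x} \<in> K" using closedD(1)[OF pr(2), of p q w x] ne by simp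
        then show ?thesis using e(1) \<open>z = x\<close> by (simp add: insert_commute)
      qed
    qed
  qed
qed

section \<open>Ladders of diamonds\<close>

lemma le_mult:
  assumes a: "c \<preceq> d" "a \<in> carrier G" "len (d \<otimes> a) = len d + len a"
  shows "c \<otimes> a \<preceq> d \<otimes> a"
proof -
  obtain u where u: "u \<in> lists S" "length u = len a" "wd u = a" using len_word[OF a(2)] by auto
  have "\<lbrakk>u \<in> lists S; c \<preceq> d; len (d \<otimes> wd u) = len d + length u\<rbrakk> \<Longrightarrow> c \<otimes> wd u \<preceq> d \<otimes> wd u" for u
  proof (induct u arbitrary: c d)
    case Nil
    then show ?case using le_carr by simp
  next
    case (Cons s u)
    have cc: "c \<in> carrier G" "d \<in> carrier G" "s \<in> S" "u \<in> lists S" "wd u \<in> carrier G"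
      using Cons.prems le_carr[OF Cons.prems(2)] by simp_all
    have l: "len (d \<otimes> s) = len d + 1" "len (d \<otimes> s \<otimes> wd u) = len (d \<otimes> s) + length u"
      using len_wd_left[of d s u] Cons.prems(3) cc by simp_all
    have "c \<otimes> s \<preceq> d \<otimes> s" using lift_up[OF Cons.prems(2) cc(3)] l by simp
    then have "c \<otimes> s \<otimes> wd u \<preceq> d \<otimes> s \<otimes> wd u" using Cons.hyps[OF cc(4) _ l(2)] by blast
    then show ?case using cc by (simp add: m_assoc)
  qed
  from this[OF u(1) a(1)] show ?thesis using u a by simp
qed

text \<open>The rungs \<open>{c v, c r v}\<close>, where \<open>c\<close> runs through a chain of a generalized quotient from
  \<open>y\<^sub>0 r\<close> down to \<open>x\<^sub>0\<close>, are successively generated by edges above \<open>x\<^sub>0 r v\<close>.\<close>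

lemma ladder:
  assumes c: "x0 \<in> carrier G" "y0 \<in> carrier G" "v \<in> carrier G" "r \<in> S"
    and d: "dn y0 r" and le: "x0 \<otimes> r \<preceq> y0 \<otimes> r" and u: "up x0 r"
    and l: "len (x0 \<otimes> v) = len x0 + len v" "len (x0 \<otimes> r \<otimes> v) = len x0 + 1 + len v"
      "len (y0 \<otimes> v) = len y0 + len v" "len (y0 \<otimes> r \<otimes> v) = len (y0 \<otimes> r) + len v"
    and K: "diamond_closed (x0 \<otimes> v) (y0 \<otimes> v) K" "E (x0 \<otimes> r \<otimes> v) (y0 \<otimes> v) \<subseteq> K"
  shows "{x0 \<otimes> v, x0 \<otimes> r \<otimes> v} \<in> K"
proof -
  define y1 where "y1 = y0 \<otimes> r"
  have y1: "y1 \<in> carrier G" "y1 \<otimes> r = y0" "len y0 = len y1 + 1"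
    using c d len_step[OF c(2,4)] by (simp_all add: y1_def)
  \<comment> \<open>Membership in this quotient says that both ends \<open>c v\<close> and
    \<open>c r v\<close> of a rung have additive length, so that the order can be transported by
    \<open>le_mult\<close>.\<close>
  define A where "A = {v, r \<otimes> v}"
  have AG: "A \<subseteq> carrier G" using c by (auto simp: A_def)
  have lx0r: "len (x0 \<otimes> r) = len x0 + 1" using u len_step[OF c(1,4)] by linarith
  have "len (x0 \<otimes> (r \<otimes> v)) \<le> len x0 + len (r \<otimes> v)" using len_mult c by simp
  then have lrv: "len (r \<otimes> v) = 1 + len v" using l(2) len_left_step[OF c(3,4)] c by (simp add: m_assoc)
  have gA: "z \<in> gq A \<longleftrightarrow> z \<in> carrier G \<and> len (z \<otimes> v) = len z + len v \<and> len (z \<otimes> r \<otimes> v) = len z + 1 + len v" for z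
    using c by (auto simp: gq_def A_def lrv m_assoc)
  have x0g: "x0 \<in> gq A" using gA l c by simp
  have y1g: "y1 \<in> gq A" using gA l y1 c by (simp add: y1_def)
  have x0y1: "x0 \<preceq> y1" using le_trans[OF le_up[OF c(1,4) u] le] by (simp add: y1_def)
  have main: "\<lbrakk>z \<in> gq A; x0 \<preceq> z; z \<preceq> y1; {z \<otimes> v, z \<otimes> r \<otimes> v} \<in> K\<rbrakk> \<Longrightarrow> {x0 \<otimes> v, x0 \<otimes> r \<otimes> v} \<in> K" for z
  proof (induct "len z" arbitrary: z rule: less_induct)
    case less
    show ?case
    proof (cases "x0 = z")
      case False
      then obtain z' where z': "z' \<in> gq A" "bruhat_step z' z" "x0 \<preceq> z'"
        using gq_chain[OF x0g less.prems(1) AG less.prems(2)] by blast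
      have zc: "z \<in> carrier G" "z' \<in> carrier G" using less.prems(1) z'(1) by (simp_all add: gq_def)
      have zu: "len (w \<otimes> r) = len w + 1 \<and> len (w \<otimes> r \<otimes> v) = len (w \<otimes> r) + len v" if "w \<in> gq A" for w
      proof -
        have w: "w \<in> carrier G" "len (w \<otimes> r \<otimes> v) = len w + 1 + len v" using that by (simp_all add: gA)
        then show ?thesis using len_mult[of "w \<otimes> r" v] len_step[OF w(1) c(4)] c by auto
      qed
      note zu1 = zu[OF less.prems(1)] and zu2 = zu[OF z'(1)]
      have z'y: "z' \<preceq> y1" using le_trans[OF step_le[OF z'(2)] less.prems(3)] .
      have mem: "w \<otimes> v \<in> I (x0 \<otimes> v) (y0 \<otimes> v)" "w \<otimes> r \<otimes> v \<in> I (x0 \<otimes> r \<otimes> v) (y0 \<otimes> v)" 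
        if w: "w \<in> gq A" "x0 \<preceq> w" "w \<preceq> y1" for w
      proof -
        have wc: "w \<in> carrier G" using w gA by simp
        have "w \<preceq> y0" using le_trans[OF w(3)] le_dn[OF c(2,4) d] by (simp add: y1_def)
        then show "w \<otimes> v \<in> I (x0 \<otimes> v) (y0 \<otimes> v)"
          using le_mult[of x0 w v] le_mult[of w y0 v] w c(3) l(3) by (simp add: I_iff gA)
        have "x0 \<otimes> r \<preceq> w \<otimes> r" using lift_up[OF w(2) c(4)] zu[OF w(1)] by simp
        moreover have "w \<otimes> r \<preceq> y0" using lift_up[OF w(3) c(4)] y1 by simp
        ultimately show "w \<otimes> r \<otimes> v \<in> I (x0 \<otimes> r \<otimes> v) (y0 \<otimes> v)"
          using le_mult[of "x0 \<otimes> r" "w \<otimes> r" v] le_mult[of "w \<otimes> r" y0 v] zu[OF w(1)] c(3) l(3) by (simp add: I_iff)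
      qed
      note m1 = mem[OF less.prems(1-3)] and m2 = mem[OF z'(1,3) z'y]
      have a1: "adj z z'" using adj_sym[OF step_adj[OF z'(2)]] .
      have "adj (z \<otimes> r \<otimes> v) (z' \<otimes> r \<otimes> v)" using adj_right[OF adj_right[OF a1]] c by simp
      moreover have "{z \<otimes> r \<otimes> v, z' \<otimes> r \<otimes> v} \<in> E (x0 \<otimes> r \<otimes> v) (y0 \<otimes> v)"
        using calculation m1(2) m2(2) by (simp add: E_iff)
      ultimately have k: "{z \<otimes> r \<otimes> v, z' \<otimes> r \<otimes> v} \<in> K" using K(2) by blast
      have a2: "adj (z' \<otimes> r \<otimes> v) (z' \<otimes> v)"
        using adj_right[OF adj_sym[OF adj_rt[OF zc(2) Rt_al]]] c by simp
      have a3: "adj (z' \<otimes> v) (z \<otimes> v)" using adj_right[OF adj_sym[OF a1]] c by simp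
      have lz: "len z' < len z" using step_len[OF z'(2)] .
      have "z \<noteq> z' \<otimes> r"
      proof
        assume "z = z' \<otimes> r"
        then have "z \<otimes> r = z'" using zc c by simp
        then show False using lz zu1 by simp
      qed
      then have n1: "z \<otimes> v \<noteq> z' \<otimes> r \<otimes> v" using c zc by simp
      have "z \<otimes> r \<noteq> z'" using lz zu1 by auto
      then have n2: "z \<otimes> r \<otimes> v \<noteq> z' \<otimes> v" using c zc by simp
      have "{z' \<otimes> r \<otimes> v, z' \<otimes> v} \<in> K"
        using closedD(1)[OF K(1) less.prems(4) k a2 a3 m2(1) n1 n2] .
      then have "{z' \<otimes> v, z' \<otimes> r \<otimes> v} \<in> K" by (simp add: insert_commute)
      then show ?thesis using less.hyps[OF lz z'(1,3) z'y] by blast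
    qed (use less.prems in simp)
  qed
  \<comment> \<open>The top rung is \<open>{y1 v, y0 v}\<close>. It lies above \<open>x0 r v\<close>
    because \<open>x0 r\<close> is below \<open>y1\<close>.\<close>
  have "x0 \<otimes> r \<otimes> v \<preceq> y1 \<otimes> v" using le_mult[of "x0 \<otimes> r" y1 v] le l c by (simp add: y1_def)
  moreover have "y1 \<otimes> v \<preceq> y0 \<otimes> v" using le_mult[of y1 y0 v] le_dn[OF c(2,4) d] c l by (simp add: y1_def)
  moreover have "adj (y1 \<otimes> v) (y0 \<otimes> v)" using adj_right[OF adj_rt[OF y1(1) Rt_al[OF c(4)]] c(3)] c(4) y1(2) by simp
  moreover have "x0 \<otimes> r \<otimes> v \<preceq> y0 \<otimes> v" using calculation le_trans by blast
  ultimately have "{y1 \<otimes> v, y1 \<otimes> r \<otimes> v} \<in> E (x0 \<otimes> r \<otimes> v) (y0 \<otimes> v)"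
    using c y1 by (simp add: E_iff I_iff)
  then have "{y1 \<otimes> v, y1 \<otimes> r \<otimes> v} \<in> K" using K(2) by blast
  then show ?thesis using main[OF y1g x0y1] y1(1) by simp
qed

section \<open>Minimal roots separating two elements\<close>


lemma bf_sum: "\<lbrakk>u \<in> Rt; v \<in> Rt; u + v \<in> Rt\<rbrakk> \<Longrightarrow> bf u v = -1"
  using bf_Rt[of u] bf_Rt[of v] bf_Rt[of "u + v"] bf_sym[of v u] by simp

lemma bf_PR_sum: "\<lbrakk>u \<in> PR; v \<in> PR; u + v \<in> PR\<rbrakk> \<Longrightarrow> bf u v = -1"
  by (simp add: bf_sum PR_Rt)

lemma PR_sum:
  assumes a: "u \<in> PR" "v \<in> PR" "bf u v = -1"
  shows "u + v \<in> PR"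
proof -
  have "act (rf u) v = u + v" using a act_rf[OF PR_Rt[OF a(1)]] by simp
  moreover have "act (rf u) v \<in> Rt" using a PR_Rt[of u] PR_Rt[of v] by simp
  ultimately show ?thesis using a pos_add[OF PR_pos PR_pos] by (simp add: PR_def)
qed

lemma PR_diff:
  assumes a: "u \<in> PR" "v \<in> PR" "bf u v = 1" "pos (u - v)"
  shows "u - v \<in> PR"
proof -
  have "act (rf v) u = u - v" using a act_rf[OF PR_Rt[OF a(2)]] bf_sym[of v u] by simp
  moreover have "act (rf v) u \<in> Rt" using a PR_Rt[of u] PR_Rt[of v] by simp
  ultimately show ?thesis using a by (simp add: PR_def)
qed

lemma bf_PR_le: "u \<in> PR \<Longrightarrow> v \<in> PR \<Longrightarrow> ht u < ht v \<Longrightarrow> -1 \<le> bf u v \<and> bf u v \<le> 1"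
proof -
  assume a: "u \<in> PR" "v \<in> PR" "ht u < ht v"
  then have "u \<noteq> v" by auto
  then show ?thesis using bf_PR[OF a(1,2)] by auto
qed

end

text \<open>Here \<open>P\<close> and \<open>N\<close> stand for the positive roots which two given elements both keep positive,
  respectively both make negative, and \<open>g\<close> for a minimal root on which they differ in sign.\<close>

locale min_root = simply_laced +
  fixes g :: "'a \<Rightarrow> int" and N P :: "('a \<Rightarrow> int) \<Rightarrow> bool"
  assumes g: "g \<in> PR"
    and NP: "N v \<Longrightarrow> v \<in> PR" "P v \<Longrightarrow> v \<in> PR"
    and N_add: "\<lbrakk>N u; N v; u + v \<in> PR\<rbrakk> \<Longrightarrow> N (u + v)"
    and N_cancel: "\<lbrakk>P u; v \<in> PR; N (u + v)\<rbrakk> \<Longrightarrow> N v"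
    and dich: "\<lbrakk>u \<in> PR; v \<in> PR; g = u + v\<rbrakk> \<Longrightarrow> N u \<and> P v \<or> P u \<and> N v"
begin

text \<open>Stars with centre \<open>z\<close> in \<open>N\<close> and one, two or three arms in \<open>P\<close> adding up to \<open>g\<close>. If \<open>z\<close> is a sum
  of two roots, one of the summands is again the centre of a star, so there is a star with simple
  centre.\<close>

definition L1 :: "('a \<Rightarrow> int) \<Rightarrow> bool" where "L1 z \<longleftrightarrow> (\<exists>b. g = b + z \<and> P b \<and> N z)"

definition L2 :: "('a \<Rightarrow> int) \<Rightarrow> bool" where
  "L2 z \<longleftrightarrow> (\<exists>b c. g = b + c + z \<and> P b \<and> P c \<and> N z \<and> N (b + z) \<and> N (c + z))"

text \<open>The conditions make \<open>b\<close>, \<open>c\<close>, \<open>d\<close>,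
  \<open>z\<close> pair like the simple roots of D4 with centre \<open>z\<close>, so
  \<open>z\<close> pairs to \<open>-1\<close> with \<open>g\<close>, and \<open>g + z\<close> is the
  highest root. Its membership in \<open>N\<close> is the extra condition required of a simple root
  with pairing \<open>-1\<close>.\<close>

definition L3 :: "('a \<Rightarrow> int) \<Rightarrow> bool" where
  "L3 z \<longleftrightarrow> (\<exists>b c d. g = b + c + d + z \<and> P b \<and> P c \<and> P d \<and> N z \<and> N (b + z) \<and> N (c + z) \<and> N (d + z)
     \<and> N (b + c + z) \<and> N (b + d + z) \<and> N (c + d + z) \<and> N (g + z))"

lemma bf_PN: "P u \<Longrightarrow> N v \<Longrightarrow> N (u + v) \<Longrightarrow> bf u v = -1"
  by (simp add: bf_PR_sum NP)

text \<open>The pairing makes \<open>b + v\<close> a root, and \<open>dich\<close> applies to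
  \<open>g = u + (b + v)\<close>. Either \<open>b + v\<close> is the only arm at centre
  \<open>u\<close>, or \<open>u\<close> joins \<open>b\<close> as second arm at centre
  \<open>v\<close>.\<close>

lemma L1_half:
  assumes b: "g = b + (u + v)" "P b" "N (u + v)" and uv: "u \<in> PR" "v \<in> PR" and bu: "bf g u = 1"
  shows "L1 u \<or> L2 v"
proof -
  have e: "g - u = b + v" using b(1) by (simp add: algebra_simps)
  have "pos (g - u)" unfolding e using pos_add[OF PR_pos[OF NP(2)[OF b(2)]] PR_pos[OF uv(2)]] .
  then have r: "b + v \<in> PR" using PR_diff[OF g uv(1) bu] e by simp
  have ge: "g = u + (b + v)" using b(1) by (simp add: algebra_simps)
  show ?thesis
  proof (cases "N u \<and> P (b + v)")
    case True
    then show ?thesis unfolding L1_def using ge by (metis add.commute)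
  next
    case False
    then have p: "P u" "N (b + v)" using dich[OF uv(1) r ge] by auto
    then have "N v" using N_cancel[OF p(1) uv(2) b(3)] by simp
    then have "L2 v" unfolding L2_def using b p by (intro exI[of _ b] exI[of _ u]) (simp add: algebra_simps)
    then show ?thesis by simp
  qed
qed

text \<open>Both arms attach to \<open>v\<close>, so \<open>b + c + v\<close> is a root. It becomes
  the only arm at \<open>u\<close>, or \<open>u\<close> becomes the third arm at
  \<open>v\<close>.\<close>

lemma L2_both:
  assumes b: "g = b + c + (u + v)" "P b" "P c" "N (u + v)" "N (b + (u + v))" "N (c + (u + v))"
    and uv: "u \<in> PR" "v \<in> PR" and bu: "bf b v = -1" "bf c v = -1" "bf g u = 1" "bf g v = -1"
  shows "L1 u \<or> L3 v"
proof -
  have bc: "b \<in> PR" "c \<in> PR" using b NP by auto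
  have r1: "b + v \<in> PR" "c + v \<in> PR" using PR_sum bc uv bu by auto
  have e: "g - u = b + c + v" using b(1) by (simp add: algebra_simps)
  have "pos (b + c + v)" using pos_add[OF PR_pos[OF bc(1)] PR_pos[OF r1(2)]] by (simp add: algebra_simps)
  then have r: "b + c + v \<in> PR" using PR_diff[OF g uv(1) bu(3)] e by simp
  have ge: "g = u + (b + c + v)" using b(1) by (simp add: algebra_simps)
  show ?thesis
  proof (cases "N u \<and> P (b + c + v)")
    case True
    then show ?thesis unfolding L1_def using ge by (metis add.commute)
  next
    case False
    then have p: "P u" "N (b + c + v)" using dich[OF uv(1) r ge] by auto
    then have v: "N v" using N_cancel[OF p(1) uv(2) b(4)] by simp
    have bv: "N (b + v)" "N (c + v)"
      using N_cancel[OF p(1) r1(1)] N_cancel[OF p(1) r1(2)] b(5,6) by (simp_all add: algebra_simps)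
    have s: "g + v = (b + (u + v)) + (c + v)" using b(1) by (simp add: algebra_simps)
    have "g + v \<in> PR" using PR_sum[OF g uv(2) bu(4)] .
    then have gv: "N (g + v)" using N_add[OF b(5) bv(2)] s by simp
    have "L3 v" unfolding L3_def using b p v bv gv
      by (intro exI[of _ b] exI[of _ c] exI[of _ u]) (simp add: algebra_simps)
    then show ?thesis by simp
  qed
qed

text \<open>The arms attach to different summands, so \<open>g\<close> is the sum of the roots
  \<open>b + v\<close> and \<open>c + u\<close>. The one in \<open>P\<close> is a new arm; the
  centre is taken from the one in \<open>N\<close>, whose other part remains an arm.\<close>

lemma L2_split:
  assumes b: "g = b + c + (u + v)" "P b" "P c" "N (u + v)" "N (b + (u + v))" "N (c + (u + v))"
    and uv: "u \<in> PR" "v \<in> PR" and bu: "bf b v = -1" "bf c u = -1"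
  shows "L2 u \<or> L2 v"
proof -
  have bc: "b \<in> PR" "c \<in> PR" using b NP by auto
  have r: "b + v \<in> PR" "c + u \<in> PR" using PR_sum bc uv bu by auto
  have ge: "g = (b + v) + (c + u)" using b(1) by (simp add: algebra_simps)
  show ?thesis
  proof (cases "N (b + v) \<and> P (c + u)")
    case True
    then have v: "N v" using N_cancel[OF b(2) uv(2)] by simp
    have "L2 v" unfolding L2_def using True v b by (intro exI[of _ b] exI[of _ "c + u"]) (simp add: algebra_simps)
    then show ?thesis by simp
  next
    case False
    then have p: "P (b + v)" "N (c + u)" using dich[OF r ge] by auto
    then have u: "N u" using N_cancel[OF b(3) uv(1)] by simp
    have "L2 u" unfolding L2_def using p u b by (intro exI[of _ c] exI[of _ "b + v"]) (simp add: algebra_simps)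
    then show ?thesis by simp
  qed
qed

text \<open>One arm attaches to \<open>u\<close> and two to \<open>v\<close>, so \<open>g\<close> is
  the sum of the roots \<open>b + u\<close> and \<open>c + d + v\<close>. The new star has centre
  \<open>u\<close> with arms \<open>b\<close> and \<open>c + d + v\<close>, or centre
  \<open>v\<close> with arms \<open>b + u\<close>, \<open>c\<close> and \<open>d\<close>.\<close>

lemma L3_split:
  assumes b: "g = b + c + d + (u + v)" "P b" "P c" "P d" "N (u + v)"
      "N (b + (u + v))" "N (c + (u + v))" "N (d + (u + v))"
      "N (b + c + (u + v))" "N (b + d + (u + v))" "N (c + d + (u + v))" "N (g + (u + v))"
    and uv: "u \<in> PR" "v \<in> PR" and bu: "bf b u = -1" "bf c v = -1" "bf d v = -1" "bf g u = 0" "bf g v = -1"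
  shows "L2 u \<or> L3 v"
proof -
  have bc: "b \<in> PR" "c \<in> PR" "d \<in> PR" using b NP by auto
  have r: "b + u \<in> PR" "c + v \<in> PR" "d + v \<in> PR" using PR_sum bc uv bu by auto
  have "c + d + (u + v) \<in> PR" using b NP by blast
  moreover have "b + (c + d + (u + v)) = g" using b(1) by (simp add: algebra_simps)
  ultimately have "bf b (c + d + (u + v)) = -1" using bf_sum[of b "c + d + (u + v)"] bc g PR_Rt by simp
  then have "bf b g = 1" using b(1) bf_Rt[OF PR_Rt[OF bc(1)]] by simp
  then have gb: "bf g (b + u) = 1" using bu bf_sym[of b g] by simp
  have e: "g - (b + u) = c + d + v" using b(1) by (simp add: algebra_simps)
  have "pos (c + d + v)" using pos_add[OF PR_pos[OF bc(2)] PR_pos[OF r(3)]] by (simp add: algebra_simps)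
  then have r2: "c + d + v \<in> PR" using PR_diff[OF g r(1) gb] e by simp
  have ge: "g = (b + u) + (c + d + v)" using b(1) by (simp add: algebra_simps)
  show ?thesis
  proof (cases "N (b + u) \<and> P (c + d + v)")
    case True
    then have u: "N u" using N_cancel[OF b(2) uv(1)] by simp
    have "L2 u" unfolding L2_def using True u b
      by (intro exI[of _ b] exI[of _ "c + d + v"]) (simp add: algebra_simps)
    then show ?thesis by simp
  next
    case False
    then have p: "P (b + u)" "N (c + d + v)" using dich[OF r(1) r2 ge] by auto
    have cv: "N (c + v)" "N (d + v)"
      using N_cancel[OF b(4) r(2)] N_cancel[OF b(3) r(3)] p(2) by (simp_all add: algebra_simps)
    have v: "N v" using N_cancel[OF b(3) uv(2) cv(1)] .
    have s: "g + v = (b + d + (u + v)) + (c + v)" using b(1) by (simp add: algebra_simps)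
    have "g + v \<in> PR" using PR_sum[OF g uv(2) bu(5)] .
    then have gv: "N (g + v)" using N_add[OF b(10) cv(1)] s by simp
    have "L3 v" unfolding L3_def using b p v cv gv
      by (intro exI[of _ "b + u"] exI[of _ c] exI[of _ d]) (simp add: algebra_simps)
    then show ?thesis by simp
  qed
qed

lemma arm:
  assumes "b \<in> PR" "u \<in> PR" "v \<in> PR" "bf b (u + v) = -1" "bf u v = -1"
  shows "bf b u = -1 \<and> bf b v = 0 \<or> bf b u = 0 \<and> bf b v = -1"
proof -
  have "b \<noteq> u" "b \<noteq> v" using assms bf_Rt[OF PR_Rt] bf_sym[of v u] by force+
  then show ?thesis using bf_PR[OF assms(1,2)] bf_PR[OF assms(1,3)] assms(4) by auto
qed

text \<open>When there are two or three arms, each pairs to \<open>-1\<close> with \<open>z\<close>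
  and attaches to exactly one of \<open>u\<close> and \<open>v\<close>; their distribution selects
  the splitting lemma. With one arm, the pairings of \<open>g\<close> with \<open>u\<close> and
  \<open>v\<close> add up to 1, so one of them is 1.\<close>

lemma L_descend:
  assumes z: "L1 z \<or> L2 z \<or> L3 z" and uv: "z = u + v" "u \<in> PR" "v \<in> PR"
  shows "(L1 u \<or> L2 u \<or> L3 u) \<or> (L1 v \<or> L2 v \<or> L3 v)"
proof -
  have zN: "N z" using z unfolding L1_def L2_def L3_def by blast
  have zP: "z \<in> PR" using NP(1)[OF zN] .
  have pP: "0 < ht p" if "P p" for p using ht_pos[OF NP(2)[OF that]] .
  \<comment> \<open>As \<open>z\<close> is lower than \<open>g\<close>, so are \<open>u\<close> and
    \<open>v\<close>; hence they differ from \<open>g\<close> and pair with it to at least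
    \<open>-1\<close> and at most 1.\<close>
  have hz: "ht z < ht g"
  proof -
    consider "L1 z" | "L2 z" | "L3 z" using z by blast
    then show ?thesis
    proof cases
      case 1
      then obtain b where "g = b + z" "P b" unfolding L1_def by blast
      then show ?thesis using pP by simp
    next
      case 2
      then obtain b c where b: "g = b + c + z" "P b" "P c" unfolding L2_def by blast
      show ?thesis using pP[OF b(2)] pP[OF b(3)] b(1) by simp
    next
      case 3
      then obtain b c d where b: "g = b + c + d + z" "P b" "P c" "P d" unfolding L3_def by blast
      show ?thesis using pP[OF b(2)] pP[OF b(3)] pP[OF b(4)] b(1) by simp
    qed
  qed
  have buv: "bf u v = -1" using bf_PR_sum[OF uv(2,3)] zP uv(1) by simp
  have su: "bf u u = 2" "bf v v = 2" "bf v u = -1"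
    using bf_Rt[OF PR_Rt[OF uv(2)]] bf_Rt[OF PR_Rt[OF uv(3)]] buv bf_sym[of v u] by simp_all
  have "bf g u \<le> 1 \<and> -1 \<le> bf g u" "bf g v \<le> 1 \<and> -1 \<le> bf g v"
    using bf_PR_le[OF uv(2) g] bf_PR_le[OF uv(3) g] bf_sym[of g u] bf_sym[of g v] hz uv ht_pos[OF uv(2)] ht_pos[OF uv(3)]
    by simp_all
  note bg = this
  have vu: "u + v = v + u" by (simp add: add.commute)
  consider "L1 z" | "L2 z" | "L3 z" using z by blast
  then show ?thesis
  proof cases
    case 1
    then obtain b where b: "g = b + (u + v)" "P b" "N (u + v)" using uv(1) unfolding L1_def by blast
    have "b + (u + v) \<in> PR" using g b(1) by simp
    then have "bf b (u + v) = -1" using bf_PR_sum[OF NP(2)[OF b(2)] NP(1)[OF b(3)]] by blast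
    then have "bf g u + bf g v = 1" using b(1) su buv by simp
    then have "bf g u = 1 \<or> bf g v = 1" using bg by linarith
    then show ?thesis using L1_half[OF b uv(2,3)] L1_half[OF b[unfolded vu] uv(3,2)] by blast
  next
    case 2
    then obtain b c where b: "g = b + c + (u + v)" "P b" "P c" "N (u + v)" "N (b + (u + v))" "N (c + (u + v))"
      using uv(1) unfolding L2_def by blast
    have bc: "b \<in> PR" "c \<in> PR" using b NP(2) by blast+
    have ab: "bf b (u + v) = -1" "bf c (u + v) = -1" using bf_PN b by blast+
    have "g = c + b + (u + v)" using b(1) by (simp add: algebra_simps)
    note b' = this b(3,2,4,6,5)
    have gu: "bf g u = bf b u + bf c u + 1" "bf g v = bf b v + bf c v + 1" using b(1) su buv by simp_all
    note ar = arm[OF bc(1) uv(2,3) ab(1) buv] arm[OF bc(2) uv(2,3) ab(2) buv]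
    consider "bf b v = -1" "bf c v = -1" "bf b u = 0" "bf c u = 0" | "bf b u = -1" "bf c u = -1" "bf b v = 0" "bf c v = 0"
      | "bf b v = -1" "bf c u = -1" | "bf c v = -1" "bf b u = -1" using ar by blast
    then show ?thesis
    proof cases
      case 1
      then have "bf g u = 1" "bf g v = -1" using gu by simp_all
      then show ?thesis using L2_both[OF b uv(2,3) 1(1,2)] by blast
    next
      case 2
      then have "bf g v = 1" "bf g u = -1" using gu by simp_all
      then show ?thesis using L2_both[OF b[unfolded vu] uv(3,2) 2(1,2)] by blast
    next
      case 3
      then show ?thesis using L2_split[OF b uv(2,3)] by blast
    next
      case 4
      then show ?thesis using L2_split[OF b' uv(2,3)] by blast
    qed
  next
    case 3
    then obtain b c d where b: "g = b + c + d + (u + v)" "P b" "P c" "P d" "N (u + v)"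
      "N (b + (u + v))" "N (c + (u + v))" "N (d + (u + v))"
      "N (b + c + (u + v))" "N (b + d + (u + v))" "N (c + d + (u + v))" "N (g + (u + v))"
      using uv(1) unfolding L3_def by blast
    have bc: "b \<in> PR" "c \<in> PR" "d \<in> PR" using b NP(2) by blast+
    have ab: "bf b (u + v) = -1" "bf c (u + v) = -1" "bf d (u + v) = -1" using bf_PN b by blast+
    have g2: "g = c + b + d + (u + v)" "g = d + b + c + (u + v)" using b(1) by (simp_all add: algebra_simps)
    have cm: "c + b = b + c" "d + b = b + d" "d + c = c + d" by (simp_all add: add.commute)
    have gu: "bf g u = bf b u + bf c u + bf d u + 1" "bf g v = bf b v + bf c v + bf d v + 1" using b(1) su buv by simp_all
    have b2: "N (c + b + (u + v))" "N (d + b + (u + v))" "N (d + c + (u + v))" unfolding cm using b(9-11) by blast+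
    note b' = g2(1) b(3,2,4,5,7,6,8) b2(1) b(11,10,12)
    note b'' = g2(2) b(4,2,3,5,8,6,7) b2(2,3) b(9,12)
    note ar = arm[OF bc(1) uv(2,3) ab(1) buv] arm[OF bc(2) uv(2,3) ab(2) buv] arm[OF bc(3) uv(2,3) ab(3) buv]
    \<comment> \<open>Three arms at the same summand would give this summand the pairing
      \<open>-2\<close> with \<open>g\<close>, so the arms split as one and two.\<close>
    consider "bf b u = -1 \<and> bf c v = -1 \<and> bf d v = -1 \<and> bf g u = 0 \<and> bf g v = -1"
      | "bf c u = -1 \<and> bf b v = -1 \<and> bf d v = -1 \<and> bf g u = 0 \<and> bf g v = -1"
      | "bf d u = -1 \<and> bf b v = -1 \<and> bf c v = -1 \<and> bf g u = 0 \<and> bf g v = -1"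
      | "bf b v = -1 \<and> bf c u = -1 \<and> bf d u = -1 \<and> bf g v = 0 \<and> bf g u = -1"
      | "bf c v = -1 \<and> bf b u = -1 \<and> bf d u = -1 \<and> bf g v = 0 \<and> bf g u = -1"
      | "bf d v = -1 \<and> bf b u = -1 \<and> bf c u = -1 \<and> bf g v = 0 \<and> bf g u = -1"
    proof -
      have "bf b u = -1 \<and> bf b v = 0 \<or> bf b u = 0 \<and> bf b v = -1" "bf c u = -1 \<and> bf c v = 0 \<or> bf c u = 0 \<and> bf c v = -1"
        "bf d u = -1 \<and> bf d v = 0 \<or> bf d u = 0 \<and> bf d v = -1" using ar by blast+
      then show thesis using that gu bg by (elim disjE conjE) simp_all
    qed
    then show ?thesis
    proof cases
      case 1
      then show ?thesis using L3_split[OF b uv(2,3)] by blast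
    next
      case 2
      then show ?thesis using L3_split[OF b' uv(2,3)] by blast
    next
      case 3
      then show ?thesis using L3_split[OF b'' uv(2,3)] by blast
    next
      case 4
      then show ?thesis using L3_split[OF b[unfolded vu] uv(3,2)] by blast
    next
      case 5
      then show ?thesis using L3_split[OF b'[unfolded vu] uv(3,2)] by blast
    next
      case 6
      then show ?thesis using L3_split[OF b''[unfolded vu] uv(3,2)] by blast
    qed
  qed
qed

lemma L_simple: "L1 z \<or> L2 z \<or> L3 z \<Longrightarrow> \<exists>s\<in>S. L1 (al s) \<or> L2 (al s) \<or> L3 (al s)"
proof (induct "nat (ht z)" arbitrary: z rule: less_induct)
  case less
  have zN: "N z" using less.prems unfolding L1_def L2_def L3_def by blast
  have zP: "z \<in> PR" using NP(1)[OF zN] .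
  show ?case
  proof (cases "z \<in> al ` S")
    case True
    then show ?thesis using less.prems by blast
  next
    case False
    then obtain s where s: "s \<in> S" "z - al s \<in> PR" using PR_decomp[OF zP] by blast
    have e: "z = (z - al s) + al s" by simp
    have "0 < ht (z - al s)" "0 < ht (al s)" using ht_pos s PR_al by blast+
    then have h: "nat (ht (z - al s)) < nat (ht z)" "nat (ht (al s)) < nat (ht z)" using s(1) by auto
    show ?thesis using L_descend[OF less.prems e s(2) PR_al[OF s(1)]] less.hyps[OF h(1)] less.hyps[OF h(2)] by blast
  qed
qed

text \<open>Split a simple root off \<open>g\<close>. It or its complement is the centre of a star
  with one arm, from which one descends to a simple centre. The pairing of the centre with
  \<open>g\<close> is 2 minus the number of arms.\<close>

lemma simple_center:
  assumes "g \<notin> al ` S"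
  shows "\<exists>s\<in>S. N (al s) \<and> (co s g = 0 \<or> co s g = 1 \<or> co s g = -1 \<and> N (g + al s))"
proof -
  obtain s where s: "s \<in> S" "g - al s \<in> PR" using PR_decomp[OF g assms] by blast
  have "L1 (al s) \<or> L1 (g - al s)"
  proof -
    have e: "g = (g - al s) + al s" "g = al s + (g - al s)" by simp_all
    show ?thesis using dich[OF s(2) PR_al[OF s(1)] e(1)] e unfolding L1_def by blast
  qed
  then obtain r where r: "r \<in> S" "L1 (al r) \<or> L2 (al r) \<or> L3 (al r)" using L_simple by blast
  have n: "N (al r)" using r(2) unfolding L1_def L2_def L3_def by blast
  have arm: "bf b (al r) = -1" if "P b" "N (b + al r)" for b
    using bf_PN[OF that(1) n that(2)] .
  have "co r g = bf g (al r)" using bf_al[OF r(1), of g] bf_sym[of g "al r"] by simp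
  moreover have two: "bf (al r) (al r) = 2" using bf_Rt[OF Rt_al[OF r(1)]] .
  moreover have "bf g (al r) = 1" if L: "L1 (al r)"
  proof -
    obtain b where b: "g = b + al r" "P b" using L unfolding L1_def by blast
    then have "bf b (al r) = -1" using bf_PR_sum[of b "al r"] NP(2)[OF b(2)] PR_al[OF r(1)] g by simp
    then show ?thesis using b two by simp
  qed
  moreover have "bf g (al r) = 0" if L: "L2 (al r)"
  proof -
    obtain b c where b: "g = b + c + al r" "P b" "P c" "N (b + al r)" "N (c + al r)" using L unfolding L2_def by blast
    show ?thesis using b(1) arm[OF b(2,4)] arm[OF b(3,5)] two by simp
  qed
  moreover have "bf g (al r) = -1 \<and> N (g + al r)" if L: "L3 (al r)"
  proof -
    obtain b c d where b: "g = b + c + d + al r" "P b" "P c" "P d" "N (b + al r)" "N (c + al r)" "N (d + al r)" "N (g + al r)"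
      using L unfolding L3_def by blast
    show ?thesis using b(1,8) arm[OF b(2,5)] arm[OF b(3,6)] arm[OF b(4,7)] two by simp
  qed
  ultimately show ?thesis using r n by metis
qed

end

context simply_laced
begin

definition sep :: "'a \<Rightarrow> 'a \<Rightarrow> ('a \<Rightarrow> int) \<Rightarrow> bool" where
  "sep x y g \<longleftrightarrow> g \<in> PR \<and> pos (act x g) \<and> neg (act y g)"

text \<open>Testing the first summand suffices, since both orders of a decomposition are
  covered.\<close>

definition min_sep :: "'a \<Rightarrow> 'a \<Rightarrow> ('a \<Rightarrow> int) \<Rightarrow> bool" where
  "min_sep x y g \<longleftrightarrow> sep x y g \<and> (\<forall>a\<in>PR. \<forall>b\<in>PR. g = a + b \<longrightarrow> \<not> sep x y a)"

lemma act_sum_cases: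
  assumes "x \<in> carrier G" "a \<in> PR" "b \<in> PR"
  shows "pos (act x (a + b)) \<Longrightarrow> neg (act x a) \<Longrightarrow> pos (act x b)"
    "neg (act x (a + b)) \<Longrightarrow> pos (act x a) \<Longrightarrow> neg (act x b)"
    "pos (act x a) \<or> neg (act x a)"
proof -
  have e: "act x b = act x (a + b) + (- act x a)" "- act x b = - act x (a + b) + act x a"
    using assms by (simp_all add: act_lin algebra_simps)
  show "pos (act x (a + b)) \<Longrightarrow> neg (act x a) \<Longrightarrow> pos (act x b)" unfolding e(1) by (rule pos_add)
  show "neg (act x (a + b)) \<Longrightarrow> pos (act x a) \<Longrightarrow> neg (act x b)" unfolding e(2) by (rule pos_add)
  show "pos (act x a) \<or> neg (act x a)" using Rt_cases[OF Rt_act] assms PR_Rt by blast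
qed

text \<open>As \<open>x g\<close> is positive, one summand, say \<open>u\<close>, is positive under
  \<open>x\<close>. Since \<open>u\<close> does not separate, \<open>y u\<close> is positive, hence
  \<open>y v\<close> is negative; since \<open>v\<close> does not separate, \<open>x v\<close> is
  negative.\<close>

lemma min_sep_dich:
  assumes c: "x \<in> carrier G" "y \<in> carrier G" and m: "min_sep x y g" and d: "u \<in> PR" "v \<in> PR" "g = u + v"
  shows "neg (act x u) \<and> neg (act y u) \<and> pos (act x v) \<and> pos (act y v) \<or>
         neg (act x v) \<and> neg (act y v) \<and> pos (act x u) \<and> pos (act y u)"
proof -
  have g: "pos (act x (u + v))" "neg (act y (u + v))" "pos (act x (v + u))" "neg (act y (v + u))"
    using m d(3) by (simp_all add: min_sep_def sep_def add.commute)
  have n: "\<not> (pos (act x u) \<and> neg (act y u))" "\<not> (pos (act x v) \<and> neg (act y v))"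
    using m d unfolding min_sep_def sep_def by (metis add.commute)+
  show ?thesis
    using act_sum_cases[OF c(1) d(1,2)] act_sum_cases[OF c(2) d(1,2)] act_sum_cases[OF c(1) d(2,1)]
      act_sum_cases[OF c(2) d(2,1)] n g pos_not_neg by metis
qed

lemma min_sep_descent:
  assumes c: "x \<in> carrier G" "y \<in> carrier G" and m: "min_sep x y g" and gn: "g \<notin> al ` S"
  shows "\<exists>s\<in>S. dn x s \<and> dn y s \<and> (co s g = 0 \<or> co s g = 1 \<or> co s g = -1 \<and> neg (act x (g + al s)))"
proof -
  define N where "N = (\<lambda>v. v \<in> PR \<and> neg (act x v) \<and> neg (act y v))"
  define P where "P = (\<lambda>v. v \<in> PR \<and> pos (act x v) \<and> pos (act y v))"
  interpret min_root G S g N P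
  proof
    show "g \<in> PR" using m by (simp add: min_sep_def sep_def)
    show "v \<in> PR" if "N v" for v using that by (simp add: N_def)
    show "v \<in> PR" if "P v" for v using that by (simp add: P_def)
    show "N (u + v)" if "N u" "N v" "u + v \<in> PR" for u v
      using that neg_add[of "act x u" "act x v"] neg_add[of "act y u" "act y v"] c by (simp add: N_def act_lin)
    show "N v" if "P u" "v \<in> PR" "N (u + v)" for u v
      using that act_sum_cases(2)[OF c(1), of u v] act_sum_cases(2)[OF c(2), of u v] by (simp add: N_def P_def)
    show "N u \<and> P v \<or> P u \<and> N v" if "u \<in> PR" "v \<in> PR" "g = u + v" for u v
      using min_sep_dich[OF c m that] that(1,2) by (auto simp: N_def P_def)
  qed
  obtain s where s: "s \<in> S" "N (al s)" "co s g = 0 \<or> co s g = 1 \<or> co s g = -1 \<and> N (g + al s)"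
    using simple_center[OF gn] by blast
  then show ?thesis using act_al_iff(2) c unfolding N_def by blast
qed

text \<open>The sign condition for pairing \<open>-1\<close> serves twice: it excludes
  decompositions of \<open>sr s g\<close> with the summand \<open>al s\<close>, and it makes
  \<open>s\<close> a descent of \<open>x \<otimes> rf g\<close>.\<close>

lemma min_sep_S:
  assumes c: "x \<in> carrier G" "y \<in> carrier G" and m: "min_sep x y g" and s: "s \<in> S" "dn x s" "dn y s"
    and k: "co s g = 0 \<or> co s g = 1 \<or> co s g = -1 \<and> neg (act x (g + al s))"
  shows "min_sep (x \<otimes> s) (y \<otimes> s) (sr s g)" and "dn (x \<otimes> rf g) s" and "dn (y \<otimes> rf g) s"
proof -
  have gP: "g \<in> PR" "pos (act x g)" "neg (act y g)" using m by (simp_all add: min_sep_def sep_def)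
  have gR: "g \<in> Rt" using gP PR_Rt by blast
  have as: "neg (act x (al s))" "neg (act y (al s))" using act_al_neg c s by blast+
  have gs: "g \<noteq> al s" using gP(2) as pos_not_neg by blast
  have xs: "pos (act (x \<otimes> s) (al s))" "pos (act (y \<otimes> s) (al s))" using as c s by (simp_all add: act_lin)
  have "sep (x \<otimes> s) (y \<otimes> s) (sr s g)" using gP c s sr_PR[OF gP(1) s(1) gs] by (simp add: sep_def)
  moreover have False if ab: "a \<in> PR" "b \<in> PR" "sr s g = a + b" "sep (x \<otimes> s) (y \<otimes> s) a" for a b
  proof -
    have g: "g = sr s a + sr s b" using ab(3) s(1) by (metis sr_sr sr_lin(1))
    have pa: "pos (act (x \<otimes> s) a)" "neg (act (y \<otimes> s) a)" using ab(4) by (simp_all add: sep_def)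
    have "a \<noteq> al s" using pa xs pos_not_neg by blast
    then have a': "sep x y (sr s a)" using pa c s sr_PR[OF ab(1) s(1)] by (simp add: sep_def)
    show False
    proof (cases "b = al s")
      case False
      then have "sr s b \<in> PR" using sr_PR ab s by blast
      then show False using m a' g unfolding min_sep_def sep_def by blast
    next
      case True
      \<comment> \<open>With \<open>al s\<close> as a summand, the pairing of \<open>g\<close> is
        \<open>-1\<close> and \<open>g + al s = sr s a\<close> is separating, hence positive under
        \<open>x\<close>, against \<open>k\<close>.\<close>
      have "sr s g \<in> Rt" using Rt_act[of s g] s(1) gR by simp
      then have "bf a (al s) = -1" using bf_sum[of a "al s"] ab PR_Rt True s(1) by simp
      then have "co s a = -1" using bf_al[OF s(1)] bf_sym[of a "al s"] by simp
      then have "co s (sr s a) = 1" using s(1) by (simp add: sr_def)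
      moreover have "g = sr s a - al s" using g True s(1) by simp
      ultimately have "co s g = -1" using s(1) by simp
      moreover have "g + al s = sr s a" using g True s(1) by simp
      ultimately show False using k a' pos_not_neg by (auto simp: sep_def)
    qed
  qed
  ultimately show "min_sep (x \<otimes> s) (y \<otimes> s) (sr s g)" unfolding min_sep_def by blast
  have t: "act (z \<otimes> rf g) (al s) = act z (al s) - sc (co s g) (act z g)" if "z \<in> carrier G" for z
    using that gR s(1) bf_al[OF s(1), of g] bf_sym[of g "al s"] by (simp add: act_rf act_lin)
  have xd: "neg (act (x \<otimes> rf g) (al s))"
  proof -
    consider "co s g = 0" | "co s g = 1" | "co s g = -1" "neg (act x (g + al s))" using k by blast
    then show ?thesis
    proof cases
      case 2
      then show ?thesis using t[OF c(1)] neg_add[OF as(1), of "- act x g"] gP(2) by simp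
    next
      case 3
      have "act x (g + al s) = act (x \<otimes> rf g) (al s)" using 3(1) t[OF c(1)] act_lin(1)[OF c(1), of g "al s"] by simp
      then show ?thesis using 3(2) by simp
    qed (use t[OF c(1)] as in simp)
  qed
  have yd: "neg (act (y \<otimes> rf g) (al s))"
  proof -
    consider "co s g = 0" | "co s g = 1" | "co s g = -1" using k by blast
    then show ?thesis
    proof cases
      case 2
      have p: "g - al s \<in> PR" using sr_PR[OF gP(1) s(1) gs] 2 by (simp add: sr_def)
      have "pos (act y (g - al s))" using min_sep_dich[OF c m p PR_al[OF s(1)]] as pos_not_neg by auto
      then show ?thesis using t[OF c(2)] 2 c by (simp add: act_lin)
    next
      case 3
      then show ?thesis using t[OF c(2)] neg_add[OF as(2) gP(3)] by simp
    qed (use t[OF c(2)] as in simp)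
  qed
  show "dn (x \<otimes> rf g) s" "dn (y \<otimes> rf g) s" 
    using xd yd act_al_iff(2)[OF m_closed[OF c(1) rf_carr[OF gR]] s(1)]
      act_al_iff(2)[OF m_closed[OF c(2) rf_carr[OF gR]] s(1)] by blast+
qed

text \<open>Common descents are stripped until \<open>g\<close> is simple and are collected in
  \<open>v\<close>. Since \<open>x \<otimes> rf g\<close> and \<open>y \<otimes> rf g\<close> share
  them, all four products are length additive, and the edges by \<open>g\<close> are edges by
  \<open>r\<close> multiplied by \<open>v\<close>.\<close>

lemma min_sep_factor:
  "\<lbrakk>x \<in> carrier G; y \<in> carrier G; min_sep x y g\<rbrakk> \<Longrightarrow>
   \<exists>x0 y0 v r. x0 \<in> carrier G \<and> y0 \<in> carrier G \<and> v \<in> carrier G \<and> r \<in> S \<and> up x0 r \<and> dn y0 r \<and>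
     x = x0 \<otimes> v \<and> y = y0 \<otimes> v \<and> x \<otimes> rf g = x0 \<otimes> r \<otimes> v \<and> y \<otimes> rf g = y0 \<otimes> r \<otimes> v \<and>
     len x = len x0 + len v \<and> len y = len y0 + len v \<and>
     len (x0 \<otimes> r \<otimes> v) = len (x0 \<otimes> r) + len v \<and> len (y0 \<otimes> r \<otimes> v) = len (y0 \<otimes> r) + len v"
proof (induct "len x" arbitrary: x y g rule: less_induct)
  case less
  note c = less.prems(1,2) and m = less.prems(3)
  have gP: "g \<in> PR" "pos (act x g)" "neg (act y g)" using m by (simp_all add: min_sep_def sep_def)
  have gR: "g \<in> Rt" using gP PR_Rt by blast
  show ?case
  proof (cases "g \<in> al ` S")
    case True
    then obtain r where r: "r \<in> S" "g = al r" by blast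
    have "up x r" "dn y r" using gP r act_al_iff c by blast+
    then show ?thesis using r c by (intro exI[of _ x] exI[of _ y] exI[of _ \<one>] exI[of _ r]) simp
  next
    case False
    obtain s where s: "s \<in> S" "dn x s" "dn y s"
      "co s g = 0 \<or> co s g = 1 \<or> co s g = -1 \<and> neg (act x (g + al s))"
      using min_sep_descent[OF c m False] by blast
    note m' = min_sep_S[OF c m s]
    have cs: "x \<otimes> s \<in> carrier G" "y \<otimes> s \<in> carrier G" using c s by simp_all
    obtain x0 y0 v r where h: "x0 \<in> carrier G" "y0 \<in> carrier G" "v \<in> carrier G" "r \<in> S" "up x0 r" "dn y0 r"
     "x \<otimes> s = x0 \<otimes> v" "y \<otimes> s = y0 \<otimes> v" "x \<otimes> s \<otimes> rf (sr s g) = x0 \<otimes> r \<otimes> v" "y \<otimes> s \<otimes> rf (sr s g) = y0 \<otimes> r \<otimes> v"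
     "len (x \<otimes> s) = len x0 + len v" "len (y \<otimes> s) = len y0 + len v"
     "len (x0 \<otimes> r \<otimes> v) = len (x0 \<otimes> r) + len v" "len (y0 \<otimes> r \<otimes> v) = len (y0 \<otimes> r) + len v"
      using less.hyps[OF s(2) cs m'(1)] by blast
    have q: "x \<otimes> rf g \<otimes> s = x0 \<otimes> r \<otimes> v" "y \<otimes> rf g \<otimes> s = y0 \<otimes> r \<otimes> v"
      using rf_sr[OF c(1) gR s(1)] rf_sr[OF c(2) gR s(1)] h(9,10) by simp_all
    have rg: "x \<otimes> rf g \<in> carrier G" "y \<otimes> rf g \<in> carrier G" using c gR by simp_all
    have e: "x = x0 \<otimes> (v \<otimes> s)" "y = y0 \<otimes> (v \<otimes> s)" "x \<otimes> rf g = x0 \<otimes> r \<otimes> (v \<otimes> s)" "y \<otimes> rf g = y0 \<otimes> r \<otimes> (v \<otimes> s)"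
    proof -
      have "x = x \<otimes> s \<otimes> s" "y = y \<otimes> s \<otimes> s" "x \<otimes> rf g = x \<otimes> rf g \<otimes> s \<otimes> s" "y \<otimes> rf g = y \<otimes> rf g \<otimes> s \<otimes> s"
        using c rg s(1) by simp_all
      then show "x = x0 \<otimes> (v \<otimes> s)" "y = y0 \<otimes> (v \<otimes> s)" "x \<otimes> rf g = x0 \<otimes> r \<otimes> (v \<otimes> s)" "y \<otimes> rf g = y0 \<otimes> r \<otimes> (v \<otimes> s)"
        unfolding h(7,8) q using h(1-4) s(1) by (simp_all add: m_assoc)
    qed
    have lx: "len x = len (x \<otimes> s) + 1" "len y = len (y \<otimes> s) + 1"
      "len (x \<otimes> rf g) = len (x0 \<otimes> r \<otimes> v) + 1" "len (y \<otimes> rf g) = len (y0 \<otimes> r \<otimes> v) + 1"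
      using len_step[OF c(1) s(1)] len_step[OF c(2) s(1)] len_step[OF rg(1) s(1)] len_step[OF rg(2) s(1)] s m'(2,3)
      unfolding q by linarith+
    have "len x \<le> len x0 + len (v \<otimes> s)" using len_mult[of x0 "v \<otimes> s"] e(1) h s(1) by simp
    then have lv: "len (v \<otimes> s) = len v + 1" using lx(1) h(11) len_step[OF h(3) s(1)] by linarith
    show ?thesis
      using h(1-6) e s(1) lx lv h(11-14)
      by (intro exI[of _ x0] exI[of _ y0] exI[of _ "v \<otimes> s"] exI[of _ r]) (simp flip: e)
  qed
qed

text \<open>Without separating roots the inversions of \<open>y\<close> are inversions of
  \<open>x\<close>, so \<open>y\<close> is below \<open>x\<close> in weak order: a descent of
  \<open>y\<close> is one of \<open>x\<close> and can be stripped from both.\<close>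

lemma weak_le: "\<lbrakk>y \<in> carrier G; x \<in> carrier G; \<And>g. \<not> sep x y g\<rbrakk> \<Longrightarrow> y \<preceq> x"
proof (induct arbitrary: x rule: len_induct)
  case one
  then show ?case using one_le by simp
next
  case (step y s)
  have yc: "y \<in> carrier G" and s: "s \<in> S" and u: "up y s" and x: "x \<in> carrier G" using step by simp_all
  have "neg (act (y \<otimes> s) (al s))" using act_al_pos[OF yc s u] yc s by (simp add: act_lin)
  then have "\<not> pos (act x (al s))" using step.prems(2)[of "al s"] s by (simp add: sep_def)
  then have d: "dn x s" using act_al_iff(1)[OF x s] len_step[OF x s] by linarith
  have "\<not> sep (x \<otimes> s) y g" for g
  proof
    assume g: "sep (x \<otimes> s) y g"
    then have gP: "g \<in> PR" "pos (act (x \<otimes> s) g)" "neg (act y g)" by (simp_all add: sep_def)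
    then have "g \<noteq> al s" using act_al_pos[OF yc s u] pos_not_neg by blast
    then have "sep x (y \<otimes> s) (sr s g)" using gP sr_PR[OF gP(1) s] x yc s by (simp add: sep_def)
    then show False using step.prems(2) by blast
  qed
  then have "y \<preceq> x \<otimes> s" using step.hyps(4)[of "x \<otimes> s"] x s by simp
  then have "y \<otimes> s \<preceq> x \<otimes> s \<otimes> s" using lift_up[of y "x \<otimes> s" s] s d x by simp
  then show ?case using x s by simp
qed

lemma ex_min_sep:
  assumes a: "x \<preceq> y" "x \<noteq> y"
  shows "\<exists>g. min_sep x y g"
proof -
  have "\<exists>g. sep x y g" using weak_le[OF le_carr(2)[OF a(1)] le_carr(1)[OF a(1)]] le_antisym a by blast
  then obtain g where g: "sep x y g" "\<And>h. sep x y h \<Longrightarrow> nat (ht g) \<le> nat (ht h)"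
    using ex_has_least_nat[of "sep x y" _ "\<lambda>g. nat (ht g)"] by blast
  have "\<not> sep x y a" if "a \<in> PR" "b \<in> PR" "g = a + b" for a b
    using g(2)[of a] ht_pos[OF that(1)] ht_pos[OF that(2)] that(3) by auto
  then show ?thesis using g(1) unfolding min_sep_def by blast
qed

section \<open>The upper bound\<close>


lemma strip_word:
  assumes "v \<in> carrier G"
    and "\<And>x y s. \<lbrakk>x \<in> carrier G; y \<in> carrier G; s \<in> S; up x s; up y s; Q (x \<otimes> s) (y \<otimes> s)\<rbrakk> \<Longrightarrow> Q x y"
    and "x \<in> carrier G" "y \<in> carrier G" "len (x \<otimes> v) = len x + len v" "len (y \<otimes> v) = len y + len v" "Q (x \<otimes> v) (y \<otimes> v)"
  shows "Q x y"
  using assms(1,5-7)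
proof (induct rule: len_induct)
  case one
  then show ?case using assms(3,4) by simp
next
  case (step v s)
  have c: "x \<otimes> v \<in> carrier G" "y \<otimes> v \<in> carrier G" "x \<otimes> v \<otimes> s = x \<otimes> (v \<otimes> s)" "y \<otimes> v \<otimes> s = y \<otimes> (v \<otimes> s)"
    using step assms(3,4) by (simp_all add: m_assoc)
  have l: "len (v \<otimes> s) = len v + 1" using step(3) len_step[OF step(1,2)] by linarith
  have m: "len (x \<otimes> v) \<le> len x + len v" "len (y \<otimes> v) \<le> len y + len v"
    using len_mult assms(3,4) step(1) by blast+
  have s: "len (x \<otimes> (v \<otimes> s)) = len (x \<otimes> v) + 1 \<or> len (x \<otimes> v) = len (x \<otimes> (v \<otimes> s)) + 1"
    "len (y \<otimes> (v \<otimes> s)) = len (y \<otimes> v) + 1 \<or> len (y \<otimes> v) = len (y \<otimes> (v \<otimes> s)) + 1"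
    using len_step[OF c(1) step(2)] len_step[OF c(2) step(2)] c by simp_all
  have e: "len (x \<otimes> v) = len x + len v" "len (y \<otimes> v) = len y + len v" using l m s step.prems by linarith+
  have "up (x \<otimes> v) s" "up (y \<otimes> v) s" using e l step.prems c by simp_all
  then have "Q (x \<otimes> v) (y \<otimes> v)" using assms(2)[OF c(1,2) step(2)] step.prems(3) c by simp
  then show ?case using step.hyps(4) e by blast
qed

lemma le_strip: "\<lbrakk>v \<in> carrier G; x \<in> carrier G; y \<in> carrier G; len (x \<otimes> v) = len x + len v;
    len (y \<otimes> v) = len y + len v; x \<otimes> v \<preceq> y \<otimes> v\<rbrakk> \<Longrightarrow> x \<preceq> y"
proof (rule strip_word[of v bruhat_le])
  fix x y s assume a: "x \<in> carrier G" "y \<in> carrier G" "s \<in> S" "up x s" "up y s" "x \<otimes> s \<preceq> y \<otimes> s"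
  show "x \<preceq> y" using lift_dn_dn[OF a(6,3)] a by simp
qed

lemma dz_strip:
  assumes c: "v \<in> carrier G" "x \<in> carrier G" "y \<in> carrier G" "len (x \<otimes> v) = len x + len v" "len (y \<otimes> v) = len y + len v"
  shows "dz (x \<otimes> v) (y \<otimes> v) = dz x y"
proof -
  show ?thesis
  proof (rule strip_word[of v "\<lambda>p q. dz (x \<otimes> v) (y \<otimes> v) = dz p q"])
    fix p q s assume a: "p \<in> carrier G" "q \<in> carrier G" "s \<in> S" "up p s" "up q s"
      "dz (x \<otimes> v) (y \<otimes> v) = dz (p \<otimes> s) (q \<otimes> s)"
    show "dz (x \<otimes> v) (y \<otimes> v) = dz p q" using dz_dn[of "p \<otimes> s" "q \<otimes> s" s] a by simp
  qed (use c in simp_all)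
qed

lemma E_self: "E x x = {}"
proof -
  have "e \<notin> E x x" for e
  proof
    assume "e \<in> E x x"
    then obtain z w where "z \<in> I x x" "w \<in> I x x" "bruhat_step z w" using E_cases by blast
    then show False using le_antisym[of x z] le_antisym[of x w] step_len[of z w] by (simp add: I_iff)
  qed
  then show ?thesis by blast
qed

text \<open>The recursion enters twice: \<open>r\<close> is a common descent of \<open>x0 r\<close>
  and \<open>y0\<close>, so \<open>dz u y = dz x0 (y0 r)\<close>, and \<open>dz_up\<close> compares
  this with \<open>dz x y\<close>. The edge \<open>{x, u}\<close> has to be added exactly when
  \<open>dz\<close> grows; otherwise the ladder supplies it.\<close>

lemma generating_upper: "x \<preceq> y \<Longrightarrow> \<exists>F. diamond_generating x y F \<and> finite F \<and> int (card F) \<le> dz x y"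
proof (induct "len y - len x" arbitrary: x rule: less_induct)
  case less
  note xy = less.prems
  have c: "x \<in> carrier G" "y \<in> carrier G" using le_carr xy by blast+
  show ?case
  proof (cases "x = y")
    case True
    then show ?thesis by (intro exI[of _ "{}"]) (simp add: generating_iff E_self)
  next
    case False
    obtain g where g: "min_sep x y g" using ex_min_sep[OF xy False] by blast
    then have gP: "g \<in> PR" by (simp add: min_sep_def sep_def)
    obtain x0 y0 v r where h: "x0 \<in> carrier G" "y0 \<in> carrier G" "v \<in> carrier G" "r \<in> S" "up x0 r" "dn y0 r"
      "x = x0 \<otimes> v" "y = y0 \<otimes> v" "x \<otimes> rf g = x0 \<otimes> r \<otimes> v"
      "len x = len x0 + len v" "len y = len y0 + len v"
      "len (x0 \<otimes> r \<otimes> v) = len (x0 \<otimes> r) + len v" "len (y0 \<otimes> r \<otimes> v) = len (y0 \<otimes> r) + len v"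
      using min_sep_factor[OF c g] by blast
    define u where "u = x0 \<otimes> r \<otimes> v"
    have x0r: "x0 \<otimes> r \<in> carrier G" "len (x0 \<otimes> r) = len x0 + 1"
      using h(1,4) h(5) len_step[OF h(1,4)] by (simp, linarith)
    have lv: "len (x0 \<otimes> v) = len x0 + len v" "len (y0 \<otimes> v) = len y0 + len v" using h by simp_all
    have xy0: "x0 \<preceq> y0" using le_strip[OF h(3,1,2) lv] xy h(7,8) by simp
    have uy: "u \<preceq> y" unfolding u_def h(8)
      using le_mult[OF lift_dn[OF xy0 h(4,6)] h(3) lv(2)] .
    have lu: "len u = len x + 1" using h(10,12) x0r by (simp add: u_def)
    have "u = x \<otimes> rf g" using h(9) by (simp add: u_def)
    then have st: "bruhat_step x u" using c(1) gP lu le_carr(1)[OF uy] by (auto simp: bruhat_step_def reflections_rf)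
    have at: "atom x y u" using st lu uy by (simp add: atom_def)
    have ux: "{x, u} \<in> E x y" using step_adj[OF st] step_le[OF st] uy xy c by (simp add: E_iff I_iff)
    have yy: "y \<preceq> y" using c by simp
    have "len y - len u < len y - len x" using le_len[OF uy] lu by auto
    then obtain F where F: "diamond_generating u y F" "finite F" "int (card F) \<le> dz u y"
      using less.hyps uy by blast
    have sub: "F \<subseteq> E x y" using F(1) E_mono[OF step_le[OF st] yy] by (auto simp: generating_iff)
    have gen: "E u y \<subseteq> K" if K: "diamond_closed x y K" "F \<subseteq> K" for K
    proof -
      have "F \<subseteq> K \<inter> E u y" using K F(1) by (auto simp: generating_iff)
      then show ?thesis using closed_restrict[OF K(1) step_le[OF st] yy] F(1) by (auto simp: generating_iff)
    qed
    have "dz u y = dz (x0 \<otimes> r) y0" unfolding u_def h(8) using dz_strip[OF h(3) x0r(1) h(2) h(12) lv(2)] .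
    also have "\<dots> = dz x0 (y0 \<otimes> r)" using dz_dn[OF x0r(1) h(2,4)] h by simp
    finally have d: "dz x y = dz u y + 1 - (if x0 \<otimes> r \<preceq> y0 \<otimes> r then 1 else 0)"
      using dz_strip[OF h(3,1,2) lv] dz_up[OF xy0 h(4,5,6)] h(7,8) by simp
    show ?thesis
    proof (cases "x0 \<otimes> r \<preceq> y0 \<otimes> r")
      case True
      have "E x y \<subseteq> K" if K: "diamond_closed x y K" "F \<subseteq> K" for K
      proof -
        have "{x, u} \<in> K"
          using ladder[OF h(1-4,6) True h(5) lv(1) _ lv(2) h(13)] h(12) x0r(2) K(1) gen[OF K] by (simp add: h(7,8) u_def)
        then show ?thesis using atom_generates[OF at K(1) _ gen[OF K]] by blast
      qed
      then have "diamond_generating x y F" using sub by (simp add: generating_iff)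
      then show ?thesis using F d True by auto
    next
      case False
      have "E x y \<subseteq> K" if K: "diamond_closed x y K" "insert {x, u} F \<subseteq> K" for K
        using atom_generates[OF at K(1) _ gen[OF K(1)]] K(2) by blast
      then have "diamond_generating x y (insert {x, u} F)" using sub ux by (simp add: generating_iff)
      moreover have "int (card (insert {x, u} F)) \<le> dz x y"
        using F(2,3) d False card_insert_le_m1 by (simp add: card_insert_if)
      ultimately show ?thesis using F(2) by blast
    qed
  qed
qed

section \<open>The lower bound\<close>


text \<open>The functions in \<open>spl x y\<close> are the splines of GKM theory of degree one.\<close>

definition par :: "('a \<Rightarrow> 'a \<Rightarrow> real) \<Rightarrow> 'a \<Rightarrow> 'a \<Rightarrow> ('a \<Rightarrow> int) \<Rightarrow> bool" where
  "par f z w b \<longleftrightarrow> (\<exists>c. \<forall>t. f z t - f w t = c * real_of_int (act z b t))"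

definition spl :: "'a \<Rightarrow> 'a \<Rightarrow> ('a \<Rightarrow> 'a \<Rightarrow> real) set" where
  "spl x y = {f. \<forall>z\<in>I x y. \<forall>b\<in>Rt. z \<otimes> rf b \<in> I x y \<longrightarrow> par f z (z \<otimes> rf b) b}"

lemma splD: "\<lbrakk>f \<in> spl x y; z \<in> I x y; b \<in> Rt; z \<otimes> rf b \<in> I x y\<rbrakk> \<Longrightarrow> par f z (z \<otimes> rf b) b"
  by (simp add: spl_def)

lemma spl_lin:
  assumes f: "f \<in> spl x y" "g \<in> spl x y"
  shows "(\<lambda>z t. f z t + a * g z t) \<in> spl x y"
proof -
  have "par (\<lambda>z t. f z t + a * g z t) z (z \<otimes> rf b) b" if z: "z \<in> I x y" "b \<in> Rt" "z \<otimes> rf b \<in> I x y" for z b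
  proof -
    obtain c d where "\<forall>t. f z t - f (z \<otimes> rf b) t = c * real_of_int (act z b t)"
      "\<forall>t. g z t - g (z \<otimes> rf b) t = d * real_of_int (act z b t)"
      using splD[OF f(1) z] splD[OF f(2) z] unfolding par_def by blast
    then have "\<forall>t. f z t = f (z \<otimes> rf b) t + c * real_of_int (act z b t)"
      "\<forall>t. g z t = g (z \<otimes> rf b) t + d * real_of_int (act z b t)" by (simp_all add: algebra_simps)
    then show ?thesis unfolding par_def by (intro exI[of _ "c + a * d"]) (simp add: algebra_simps)
  qed
  then show ?thesis by (simp add: spl_def)
qed

lemma spl_mono: "x \<preceq> x' \<Longrightarrow> y' \<preceq> y \<Longrightarrow> spl x y \<subseteq> spl x' y'"
proof
  fix f assume a: "x \<preceq> x'" "y' \<preceq> y" "f \<in> spl x y"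
  have s: "z \<in> I x y" if "z \<in> I x' y'" for z
    using that le_trans[OF a(1)] le_trans[OF _ a(2)] unfolding I_iff by blast
  show "f \<in> spl x' y'" unfolding spl_def using splD[OF a(3)] s by blast
qed

lemma act_refl: "z \<in> carrier G \<Longrightarrow> b \<in> Rt \<Longrightarrow> act (z \<otimes> rf b) v = act z v - sc (bf b v) (act z b)"
  by (simp add: act_rf act_lin)

lemma par_sym:
  assumes a: "z \<in> carrier G" "b \<in> Rt" "par f (z \<otimes> rf b) z b"
  shows "par f z (z \<otimes> rf b) b"
proof -
  have "act (z \<otimes> rf b) b = - act z b" 
    unfolding act_refl[OF a(1,2)] bf_Rt[OF a(2)] by (simp add: sc_def fun_eq_iff)
  then obtain c where "\<forall>t. f (z \<otimes> rf b) t - f z t = c * - real_of_int (act z b t)"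
    using a(3) unfolding par_def by auto
  then have c: "f (z \<otimes> rf b) t - f z t = c * - real_of_int (act z b t)" for t by blast
  have "f z t - f (z \<otimes> rf b) t = c * real_of_int (act z b t)" for t using c[of t] by linarith
  then show ?thesis unfolding par_def by blast
qed

lemma par_s:
  assumes a: "z \<in> carrier G" "b \<in> Rt" "s \<in> S" "z \<otimes> s \<in> I x y" "z \<otimes> rf b \<otimes> s \<in> I x y" "f \<in> spl x y"
  shows "\<exists>c. \<forall>t. f (z \<otimes> s) t - f (z \<otimes> rf b \<otimes> s) t = c * real_of_int (act z b t)"
proof -
  have r: "sr s b \<in> Rt" using Rt_act[of s b] a by simp
  have "par f (z \<otimes> s) (z \<otimes> s \<otimes> rf (sr s b)) (sr s b)"
    using splD[OF a(6,4) r] rf_sr[OF a(1-3)] a(5) by simp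
  then show ?thesis unfolding par_def rf_sr[OF a(1-3)] using a by simp
qed

lemma bf_real:
  assumes a: "\<forall>t. p * real_of_int (u t) = q * real_of_int (w t)"
  shows "p * real_of_int (bf u v) = q * real_of_int (bf w v)"
proof -
  have "p * real_of_int (bf u v) = (\<Sum>s\<in>S. p * real_of_int (u s) * real_of_int (co s v))"
    by (simp add: bf_def sum_distrib_left mult.assoc)
  also have "\<dots> = q * real_of_int (bf w v)" using a by (simp add: bf_def sum_distrib_left mult.assoc)
  finally show ?thesis .
qed

text \<open>Pairing the relation with both roots gives a linear system of determinant
  \<open>k^2 - 4\<close> up to sign, which is nonzero for \<open>k\<close> equal to
  \<open>-1\<close>, 0 or 1.\<close>

lemma roots_independent:
  assumes u: "u \<in> Rt" "w \<in> Rt" "u \<noteq> w" "u \<noteq> - w" and e: "\<forall>t. p * real_of_int (u t) = q * real_of_int (w t)"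
  shows "p = 0" "q = 0"
proof -
  define k where "k = bf u w"
  have k: "k = -1 \<or> k = 0 \<or> k = 1" using bf_cases[OF u] by (simp add: k_def)
  have "p * 2 = q * real_of_int k" "p * real_of_int k = q * 2"
    using bf_real[OF e, of u] bf_real[OF e, of w] bf_Rt[OF u(1)] bf_Rt[OF u(2)] bf_sym[of w u] by (simp_all add: k_def)
  then show "p = 0" "q = 0" using k by auto
qed

lemma spl_closed:
  assumes f: "f \<in> spl x y"
  shows "diamond_closed x y {e \<in> E x y. \<forall>z w. e = {z, w} \<longrightarrow> f z = f w}"
proof -
  let ?K = "{e \<in> E x y. \<forall>z w. e = {z, w} \<longrightarrow> f z = f w}"
  have K: "{z, w} \<in> ?K \<longleftrightarrow> {z, w} \<in> E x y \<and> f z = f w" for z w by (auto simp: doubleton_eq_iff)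
  have step: "f d = f a" if d: "{d, a} \<in> E x y" "{d, c} \<in> E x y" "a \<noteq> c" "f a = f c" for a c d
  proof -
    have D: "d \<in> I x y" "a \<in> I x y" "c \<in> I x y" "adj d a" "adj d c" using d(1,2) by (simp_all add: E_iff)
    have dc: "d \<in> carrier G" using I_carr[OF D(1)] .
    obtain b b' where b: "b \<in> PR" "a = d \<otimes> rf b" "b' \<in> PR" "c = d \<otimes> rf b'"
      using D(4,5) unfolding adj_def by blast
    have R: "b \<in> Rt" "b' \<in> Rt" using b(1,3) by (simp_all add: PR_Rt)
    obtain p q where pq: "\<forall>t. f d t - f a t = p * real_of_int (act d b t)" "\<forall>t. f d t - f c t = q * real_of_int (act d b' t)"
      using splD[OF f D(1) R(1)] splD[OF f D(1) R(2)] D(2,3) b(2,4) unfolding par_def by blast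
    have e: "\<forall>t. p * real_of_int (act d b t) = q * real_of_int (act d b' t)"
      using pq d(4) by simp
    have "b \<noteq> b'" using d(3) b by blast
    moreover have "b \<noteq> - b'" using pos_not_uminus b by blast
    ultimately have "act d b \<noteq> act d b'" "act d b \<noteq> - act d b'"
      using act_inv(1)[OF dc, of b] act_inv(1)[OF dc, of b'] act_lin(4)[OF dc, of b'] act_inv(1)[OF dc, of "- b'"] by metis+
    then have "p = 0" using roots_independent(1)[OF Rt_act[OF dc R(1)] Rt_act[OF dc R(2)] _ _ e] by blast
    then show ?thesis using pq(1) by auto
  qed
  show ?thesis unfolding diamond_closed_def
  proof (intro conjI allI impI)
    fix a b c d assume h: "is_diamond x y a b c d \<and> {a, b} \<in> ?K \<and> {b, c} \<in> ?K"
    then have fe: "f a = f c" unfolding K by simp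
    have e: "{c, d} \<in> E x y" "{d, a} \<in> E x y" "a \<noteq> c" using h by (simp_all add: is_diamond_def)
    have "{d, c} \<in> E x y" using e(1) by (simp add: insert_commute)
    then have "f d = f a" using step[OF e(2) _ e(3) fe] by blast
    then show "{c, d} \<in> ?K" "{d, a} \<in> ?K" unfolding K using e fe by simp_all
  qed simp
qed

lemma const_edges:
  assumes "\<And>z w. {z, w} \<in> E x y \<Longrightarrow> f z = f w" and z: "z \<in> I x y"
  shows "f z = f x"
proof -
  have "x \<preceq> z" "z \<preceq> y" using z by (simp_all add: I_iff)
  then show ?thesis
  proof (induct rule: le_induct)
    case (step p q)
    have p: "p \<preceq> y" "x \<preceq> q" using le_trans[OF step_le[OF step(2)] step(4)] le_trans[OF step(1) step_le[OF step(2)]] .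
    have "{p, q} \<in> E x y" using p step(1,4) step_adj[OF step(2)] by (simp add: E_iff I_iff)
    then show ?case using assms(1) step(3) p(1) by metis
  qed simp
qed

text \<open>The reflection formula gives the multiple \<open>bf b (al s)\<close>. Such a spline
  changes sign under right multiplication by \<open>s\<close> and is used to adjust differences
  along the edges \<open>{z, z \<otimes> s}\<close>.\<close>

lemma simple_spl:
  assumes s: "s \<in> S"
  shows "(\<lambda>z t. real_of_int (act z (al s) t)) \<in> spl x y"
proof -
  have "par (\<lambda>z t. real_of_int (act z (al s) t)) z (z \<otimes> rf b) b" if "z \<in> carrier G" "b \<in> Rt" for z b
    unfolding par_def act_refl[OF that] by (intro exI[of _ "real_of_int (bf b (al s))"]) (simp add: sc_def)
  then show ?thesis using I_carr unfolding spl_def by blast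
qed

text \<open>Extension from \<open>[x, y s]\<close> to \<open>[x, y]\<close>, constant along those
  vertical edges \<open>{z, z s}\<close> that leave \<open>[x, y s]\<close>. In the situation of
  \<open>half_cases\<close> every missing element has its partner in the smaller interval.\<close>

definition vext :: "'a \<Rightarrow> 'a \<Rightarrow> 'a \<Rightarrow> ('a \<Rightarrow> 'a \<Rightarrow> real) \<Rightarrow> 'a \<Rightarrow> 'a \<Rightarrow> real" where
  "vext x y s f z = (if z \<in> I x (y \<otimes> s) then f z else f (z \<otimes> s))"

context
  fixes x y s
  assumes xy: "x \<preceq> y" and s: "s \<in> S" and up: "up x s" and dn: "dn y s"
begin

lemma y_carr: "y \<in> carrier G" "x \<in> carrier G" using le_carr xy by blast+

lemma half_sub: "z \<in> I x (y \<otimes> s) \<Longrightarrow> z \<in> I x y"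
  using le_trans[OF _ le_dn[OF y_carr(1) s dn]] by (simp add: I_iff)

lemma half_cases: "z \<in> I x y \<Longrightarrow> z \<notin> I x (y \<otimes> s) \<Longrightarrow> z \<otimes> s \<in> I x (y \<otimes> s) \<and> dn z s"
proof -
  assume a: "z \<in> I x y" "z \<notin> I x (y \<otimes> s)"
  then have z: "x \<preceq> z" "z \<preceq> y" "\<not> z \<preceq> y \<otimes> s" by (simp_all add: I_iff)
  have d: "dn z s" using lift_up_dn[OF z(2) s _ dn] z(3) len_gt[of z s] le_carr(1)[OF z(2)] s by blast
  then show ?thesis using lift_up_dn[OF z(1) s up d] lift_dn_dn[OF z(2) s d dn] by (simp add: I_iff)
qed

text \<open>An edge that leaves the smaller interval goes upwards and, unless it is vertical, still
  does so after multiplication by \<open>s\<close>. As \<open>w s\<close> is inside, the translated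
  edge is inside too and can replace the original one.\<close>

lemma half_edge:
  assumes z: "z \<in> I x (y \<otimes> s)" and w: "w \<in> I x y" "w \<notin> I x (y \<otimes> s)" and a: "adj z w" and ne: "w \<noteq> z \<otimes> s"
  shows "z \<otimes> s \<in> I x (y \<otimes> s)"
proof -
  have zi: "x \<preceq> z" "z \<preceq> y \<otimes> s" "z \<in> carrier G" using z I_carr[OF z] by (simp_all add: I_iff)
  have wi: "x \<preceq> w" "\<not> w \<preceq> y \<otimes> s" "w \<otimes> s \<preceq> y \<otimes> s" using w half_cases[OF w] by (simp_all add: I_iff)
  have "\<not> w \<preceq> z" using le_trans[OF _ zi(2)] wi(2) by blast
  then have "bruhat_step z w" using adj_cases[OF a] step_le by blast
  then have "bruhat_step (z \<otimes> s) (w \<otimes> s)" using step_s[OF _ s] ne by blast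
  then have zy: "z \<otimes> s \<preceq> y \<otimes> s" using le_trans[OF step_le wi(3)] by blast
  have "x \<preceq> z \<otimes> s"
  proof (cases "up z s")
    case True
    then show ?thesis using le_trans[OF zi(1) le_up[OF zi(3) s]] by blast
  next
    case False
    then have "dn z s" using len_step[OF zi(3) s] by linarith
    then show ?thesis using lift_up_dn[OF zi(1) s up] by blast
  qed
  then show ?thesis using zy by (simp add: I_iff)
qed

lemma vext_spl:
  assumes f: "f \<in> spl x (y \<otimes> s)" and v: "\<And>z. z \<in> I x (y \<otimes> s) \<Longrightarrow> z \<otimes> s \<in> I x (y \<otimes> s) \<Longrightarrow> f z = f (z \<otimes> s)"
  shows "vext x y s f \<in> spl x y"
proof -
  have half: "par (vext x y s f) z w b" if z: "z \<in> I x (y \<otimes> s)" "w \<in> I x y" "b \<in> Rt" "w = z \<otimes> rf b" for z w b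
  proof (cases "w \<in> I x (y \<otimes> s)")
    case True
    then show ?thesis using splD[OF f z(1,3)] z by (simp add: par_def vext_def)
  next
    case w: False
    have zc: "z \<in> carrier G" using I_carr z by blast
    show ?thesis
    proof (cases "w = z \<otimes> s")
      case True
      then have "vext x y s f w = vext x y s f z" using w z(1) zc s by (simp add: vext_def)
      then show ?thesis unfolding par_def by (intro exI[of _ 0]) simp
    next
      case False
      have zs: "z \<otimes> s \<in> I x (y \<otimes> s)" using half_edge[OF z(1,2) w _ False] adj_rt[OF zc z(3)] z(4) by simp
      then have "vext x y s f z = f (z \<otimes> s)" "vext x y s f w = f (w \<otimes> s)" using v[OF z(1)] z(1) w by (simp_all add: vext_def)
      then show ?thesis
        unfolding par_def using par_s[OF zc z(3) s zs _ f] half_cases[OF z(2) w] z(4) by simp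
    qed
  qed
  have "par (vext x y s f) z (z \<otimes> rf b) b" if z: "z \<in> I x y" "b \<in> Rt" "z \<otimes> rf b \<in> I x y" for z b
  proof -
    have zc: "z \<in> carrier G" using I_carr z by blast
    consider "z \<in> I x (y \<otimes> s)" | "z \<otimes> rf b \<in> I x (y \<otimes> s)" | "z \<notin> I x (y \<otimes> s)" "z \<otimes> rf b \<notin> I x (y \<otimes> s)" by blast
    then show ?thesis
    proof cases
      case 1
      then show ?thesis using half z by blast
    next
      case 2
      have "z = z \<otimes> rf b \<otimes> rf b" using zc z(2) by simp
      then show ?thesis using par_sym[OF zc z(2)] half[OF 2 z(1,2)] by blast
    next
      case 3
      then show ?thesis
        unfolding par_def vext_def using par_s[OF zc z(2) s _ _ f] half_cases[OF z(1) 3(1)] half_cases[OF z(3) 3(2)] by simp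
    qed
  qed
  then show ?thesis by (simp add: spl_def)
qed

text \<open>The multiple along vertical edges is carried from \<open>x\<close> up to
  \<open>z\<close> through the generalized quotient of elements with ascent \<open>s\<close>:
  consecutive vertical edges bound a square, and independence of labels forces equal
  multiples.\<close>

lemma vertical:
  assumes f: "f \<in> spl x (y \<otimes> s)" and c: "\<And>t. f x t - f (x \<otimes> s) t = c * real_of_int (act x (al s) t)"
    and xs: "x \<otimes> s \<preceq> y \<otimes> s" and z: "z \<in> I x (y \<otimes> s)" "z \<otimes> s \<in> I x (y \<otimes> s)"
  shows "f z t - f (z \<otimes> s) t = c * real_of_int (act z (al s) t)"
proof -
  have gs: "w \<in> gq {s} \<longleftrightarrow> w \<in> carrier G \<and> up w s" for w
    using len_step[of w s] s len_S1[of s] by (auto simp: gq_def)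
  have main: "f z t - f (z \<otimes> s) t = c * real_of_int (act z (al s) t)"
    if "x \<preceq> z" "z \<preceq> y \<otimes> s" "z \<otimes> s \<preceq> y \<otimes> s" "up z s" for z t
    using that
  proof (induct "len z" arbitrary: z t rule: less_induct)
    case less
    note pr = less.prems
    show ?case
    proof (cases "x = z")
      case True
      then show ?thesis using c by simp
    next
      case False
      have zc: "z \<in> carrier G" using le_carr(2)[OF pr(1)] .
      have sG: "{s} \<subseteq> carrier G" using s by simp
      obtain p where p: "p \<in> gq {s}" "bruhat_step p z" "x \<preceq> p"
        using gq_chain[OF _ _ sG pr(1) False] gs y_carr(2) up zc pr(4) by blast
      have pc: "p \<in> carrier G" "up p s" using p(1) gs by simp_all
      obtain b where b: "b \<in> PR" "z = p \<otimes> rf b" using p(2) by (auto simp: step_iff)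
      have R: "b \<in> Rt" using PR_Rt b by blast
      have zs: "z \<otimes> s \<in> carrier G" using zc s by simp
      have pz: "p \<preceq> z" using step_le p(2) by blast
      have ps: "p \<otimes> s \<preceq> z \<otimes> s" using lift_up[OF pz s pr(4)] .
      have le: "p \<preceq> y \<otimes> s" "p \<otimes> s \<preceq> y \<otimes> s" "x \<preceq> p \<otimes> s" "x \<preceq> z \<otimes> s"
        using le_trans[OF pz pr(2)] le_trans[OF ps pr(3)] le_trans[OF p(3) le_up[OF pc(1) s pc(2)]]
          le_trans[OF pr(1) le_up[OF zc s pr(4)]] by simp_all
      have ih: "f p t - f (p \<otimes> s) t = c * real_of_int (act p (al s) t)" for t
        using less.hyps[OF step_len[OF p(2)] p(3) le(1,2) pc(2)] .
      have i: "p \<in> I x (y \<otimes> s)" "p \<otimes> s \<in> I x (y \<otimes> s)" "z \<in> I x (y \<otimes> s)" "z \<otimes> s \<in> I x (y \<otimes> s)"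
        using p(3) le pr by (simp_all add: I_iff)
      obtain d where d: "\<forall>t. f p t - f z t = d * real_of_int (act p b t)"
        using splD[OF f i(1) R] i(3) b(2) unfolding par_def by blast
      obtain d' where d': "\<forall>t. f (p \<otimes> s) t - f (z \<otimes> s) t = d' * real_of_int (act p b t)"
        using par_s[OF pc(1) R s i(2) _ f] i(4) b(2) by blast
      obtain e where e: "\<forall>t. f z t - f (z \<otimes> s) t = e * real_of_int (act z (al s) t)"
        using splD[OF f i(3) Rt_al[OF s]] i(4) s unfolding par_def by auto
      define k where "k = bf b (al s)"
      have az: "act z (al s) t = act p (al s) t - k * act p b t" for t
        unfolding b(2) act_refl[OF pc(1) R] by (simp add: sc_def k_def)
      have "b \<noteq> al s"
      proof
        assume "b = al s"
        then have "z \<otimes> s = p" using b(2) s pc(1) by simp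
        then show False using step_len[OF p(2)] pr(4) by simp
      qed
      moreover have "b \<noteq> - al s" using pos_not_uminus[OF b(1) PR_al[OF s]] .
      ultimately have n: "act p (al s) \<noteq> act p b" "act p (al s) \<noteq> - act p b"
        using act_inv(1)[OF pc(1), of b] act_inv(1)[OF pc(1), of "al s"] act_lin(4)[OF pc(1), of b]
          act_inv(1)[OF pc(1), of "- b"] by (metis, metis minus_minus)
      \<comment> \<open>Sum up around the square \<open>p, z, z s, p s\<close>, whose two
        non-vertical edges have the same label, and replace \<open>z (al s)\<close> by
        \<open>p (al s) - k * p b\<close>.\<close>
      have "\<forall>t. (c - e) * real_of_int (act p (al s) t) = (d - d' - e * real_of_int k) * real_of_int (act p b t)"
      proof
        fix t show "(c - e) * real_of_int (act p (al s) t) = (d - d' - e * real_of_int k) * real_of_int (act p b t)"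
        using ih[of t] d[THEN spec, of t] d'[THEN spec, of t] e[THEN spec, of t] az[of t] by (simp add: algebra_simps)
      qed
      then have "c - e = 0"
        using roots_independent(1)[OF Rt_act[OF pc(1) Rt_al[OF s]] Rt_act[OF pc(1) R] n] by blast
      then show ?thesis using e by simp
    qed
  qed
  have zi: "x \<preceq> z" "z \<preceq> y \<otimes> s" "x \<preceq> z \<otimes> s" "z \<otimes> s \<preceq> y \<otimes> s" "z \<in> carrier G" using z I_carr[OF z(1)] by (simp_all add: I_iff)
  show ?thesis
  proof (cases "up z s")
    case True
    then show ?thesis using main zi by blast
  next
    case False
    then have "up (z \<otimes> s) s" using len_step[OF zi(5) s] zi(5) s by simp
    then have "f (z \<otimes> s) t - f z t = c * real_of_int (act (z \<otimes> s) (al s) t)"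
      using main[of "z \<otimes> s" t] zi s by simp
    then show ?thesis using zi(5) s by (simp add: act_lin algebra_simps)
  qed
qed

end

end

context simply_laced
begin

section \<open>Dimension bounds through linear functionals\<close>

definition lin :: "(('a \<Rightarrow> 'a \<Rightarrow> real) \<Rightarrow> real) \<Rightarrow> bool" where
  "lin \<phi> \<longleftrightarrow> (\<forall>a f g. \<phi> (\<lambda>z t. f z t + a * g z t) = \<phi> f + a * \<phi> g)"

text \<open>States that the splines on \<open>[x, y]\<close> modulo constant functions have dimension at least \<open>n\<close>.\<close>

definition large :: "'a \<Rightarrow> 'a \<Rightarrow> int \<Rightarrow> bool" where
  "large x y n \<longleftrightarrow> (\<forall>\<Phi>. finite \<Phi> \<and> (\<forall>\<phi>\<in>\<Phi>. lin \<phi>) \<and> int (card \<Phi>) < n \<longrightarrow>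
     (\<exists>f\<in>spl x y. (\<forall>\<phi>\<in>\<Phi>. \<phi> f = 0) \<and> (\<exists>z\<in>I x y. f z \<noteq> f x)))"

lemma largeD: "\<lbrakk>large x y n; finite \<Phi>; \<And>\<phi>. \<phi> \<in> \<Phi> \<Longrightarrow> lin \<phi>; int (card \<Phi>) < n\<rbrakk>
  \<Longrightarrow> \<exists>f\<in>spl x y. (\<forall>\<phi>\<in>\<Phi>. \<phi> f = 0) \<and> (\<exists>z\<in>I x y. f z \<noteq> f x)"
  unfolding large_def by blast

lemma largeI: "(\<And>\<Phi>. \<lbrakk>finite \<Phi>; \<And>\<phi>. \<phi> \<in> \<Phi> \<Longrightarrow> lin \<phi>; int (card \<Phi>) < n\<rbrakk>
  \<Longrightarrow> \<exists>f\<in>spl x y. (\<forall>\<phi>\<in>\<Phi>. \<phi> f = 0) \<and> (\<exists>z\<in>I x y. f z \<noteq> f x)) \<Longrightarrow> large x y n"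
  unfolding large_def by blast

lemma linD: "lin \<phi> \<Longrightarrow> \<phi> (\<lambda>z t. f z t + a * g z t) = \<phi> f + a * \<phi> g"
  unfolding lin_def by blast

text \<open>A linear map that keeps nonconstant splines nonconstant cannot lower the dimension;
  functionals are pulled back along it.\<close>

lemma large_pullback:
  assumes l: "large x' y' n"
    and lin_e: "\<And>a f g. e (\<lambda>z t. f z t + a * g z t) = (\<lambda>z t. e f z t + a * e g z t)"
    and e: "\<And>f. f \<in> spl x' y' \<Longrightarrow> e f \<in> spl x y"
    and nc: "\<And>f z. \<lbrakk>f \<in> spl x' y'; z \<in> I x' y'; f z \<noteq> f x'\<rbrakk> \<Longrightarrow> \<exists>z\<in>I x y. e f z \<noteq> e f x"
  shows "large x y n"
proof (rule largeI)
  fix \<Phi> :: "(('a \<Rightarrow> 'a \<Rightarrow> real) \<Rightarrow> real) set"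
  assume P: "finite \<Phi>" "\<And>\<phi>. \<phi> \<in> \<Phi> \<Longrightarrow> lin \<phi>" "int (card \<Phi>) < n"
  define \<Psi> where "\<Psi> = (\<lambda>\<phi> f. \<phi> (e f)) ` \<Phi>"
  have "lin \<psi>" if psi: "\<psi> \<in> \<Psi>" for \<psi>
  proof -
    obtain \<phi> where \<phi>: "\<phi> \<in> \<Phi>" "\<psi> = (\<lambda>f. \<phi> (e f))" using psi unfolding \<Psi>_def by blast
    then show ?thesis unfolding lin_def using lin_e linD[OF P(2)[OF \<phi>(1)]] by simp
  qed
  moreover have "int (card \<Psi>) < n" using card_image_le[OF P(1), of "\<lambda>\<phi> f. \<phi> (e f)"] P(3) by (simp add: \<Psi>_def)
  moreover have "finite \<Psi>" using P(1) by (simp add: \<Psi>_def)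
  ultimately obtain f where f: "f \<in> spl x' y'" "\<forall>\<psi>\<in>\<Psi>. \<psi> f = 0" "\<exists>z\<in>I x' y'. f z \<noteq> f x'"
    using largeD[OF l] by blast
  have "\<forall>\<phi>\<in>\<Phi>. \<phi> (e f) = 0" using f(2) by (simp add: \<Psi>_def)
  then show "\<exists>f\<in>spl x y. (\<forall>\<phi>\<in>\<Phi>. \<phi> f = 0) \<and> (\<exists>z\<in>I x y. f z \<noteq> f x)" using e f nc by blast
qed

text \<open>The extra spline \<open>h\<close> absorbs one functional \<open>\<chi>\<close> with
  \<open>\<chi> h\<close> nonzero: \<open>e f\<close> is corrected by the multiple of
  \<open>h\<close> that makes \<open>\<chi>\<close> vanish, and the other functionals are composed
  with this correction.\<close>

lemma large_pullback_Suc: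
  assumes l: "large x' y' n"
    and lin_e: "\<And>a f g. e (\<lambda>z t. f z t + a * g z t) = (\<lambda>z t. e f z t + a * e g z t)"
    and e: "\<And>f. f \<in> spl x' y' \<Longrightarrow> e f \<in> spl x y"
    and h: "h \<in> spl x y" "\<exists>z\<in>I x y. h z \<noteq> h x"
    and nc: "\<And>f z a. \<lbrakk>f \<in> spl x' y'; z \<in> I x' y'; f z \<noteq> f x'\<rbrakk> \<Longrightarrow>
        \<exists>z\<in>I x y. (\<lambda>t. e f z t + a * h z t) \<noteq> (\<lambda>t. e f x t + a * h x t)"
  shows "large x y (n + 1)"
proof (rule largeI)
  fix \<Phi> :: "(('a \<Rightarrow> 'a \<Rightarrow> real) \<Rightarrow> real) set"
  assume P: "finite \<Phi>" "\<And>\<phi>. \<phi> \<in> \<Phi> \<Longrightarrow> lin \<phi>" "int (card \<Phi>) < n + 1"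
  show "\<exists>f\<in>spl x y. (\<forall>\<phi>\<in>\<Phi>. \<phi> f = 0) \<and> (\<exists>z\<in>I x y. f z \<noteq> f x)"
  proof (cases "\<forall>\<phi>\<in>\<Phi>. \<phi> h = 0")
    case True
    then show ?thesis using h by blast
  next
    case False
    then obtain \<chi> where \<chi>: "\<chi> \<in> \<Phi>" "\<chi> h \<noteq> 0" by blast
    define r where "r = (\<lambda>f. - (\<chi> (e f) / \<chi> h))"
    define q where "q = (\<lambda>\<phi> f. \<phi> (e f) + r f * \<phi> h)"
    define \<Psi> where "\<Psi> = q ` (\<Phi> - {\<chi>})"
    have "lin \<psi>" if psi: "\<psi> \<in> \<Psi>" for \<psi>
    proof -
      obtain \<phi> where \<phi>: "\<phi> \<in> \<Phi>" "\<psi> = q \<phi>" using psi unfolding \<Psi>_def by blast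
      show ?thesis unfolding lin_def \<phi>(2) q_def r_def lin_e linD[OF P(2)[OF \<phi>(1)]] linD[OF P(2)[OF \<chi>(1)]]
        using \<chi>(2) by (simp add: field_simps)
    qed
    moreover have "card \<Psi> \<le> card \<Phi> - 1"
      using card_image_le[of "\<Phi> - {\<chi>}" q] P(1) \<chi>(1) by (simp add: \<Psi>_def)
    then have "int (card \<Psi>) < n" using P(3) card_gt_0_iff[of \<Phi>] P(1) \<chi>(1) by (cases "card \<Phi>") auto
    moreover have "finite \<Psi>" using P(1) by (simp add: \<Psi>_def)
    ultimately obtain f where f: "f \<in> spl x' y'" "\<forall>\<psi>\<in>\<Psi>. \<psi> f = 0" "\<exists>z\<in>I x' y'. f z \<noteq> f x'"
      using largeD[OF l] by blast
    define k where "k = (\<lambda>z t. e f z t + r f * h z t)"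
    have "k \<in> spl x y" unfolding k_def using spl_lin[OF e[OF f(1)] h(1)] .
    moreover have "\<phi> k = 0" if "\<phi> \<in> \<Phi>" for \<phi>
    proof -
      have "\<phi> k = q \<phi> f" unfolding k_def q_def using linD[OF P(2)[OF that]] .
      moreover have "q \<chi> f = 0" using \<chi>(2) by (simp add: q_def r_def)
      moreover have "q \<phi> f = 0" if "\<phi> \<noteq> \<chi>" using f(2) \<open>\<phi> \<in> \<Phi>\<close> that unfolding \<Psi>_def by simp
      ultimately show ?thesis by (cases "\<phi> = \<chi>") simp_all
    qed
    moreover have "\<exists>z\<in>I x y. k z \<noteq> k x" using f(1,3) nc unfolding k_def by blast
    ultimately show ?thesis by blast
  qed
qed

lemma vext_lin: "vext x y s (\<lambda>z t. f z t + a * g z t) = (\<lambda>z t. vext x y s f z t + a * vext x y s g z t)"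
  by (simp add: vext_def fun_eq_iff)

text \<open>If \<open>x s\<close> is below \<open>y s\<close>, a spline on \<open>[x, y s]\<close>
  has one constant multiple along all vertical edges; half of it times \<open>h\<close> is
  subtracted before the extension and added back afterwards. Otherwise \<open>[x, y s]\<close>
  contains no vertical edge, so every spline extends, and there is a new one vanishing on
  \<open>[x, y s]\<close> but not at \<open>x s\<close>.\<close>

lemma large_up:
  assumes xy: "x \<preceq> y" and s: "s \<in> S" and u: "up x s" and d: "dn y s" and l: "large x (y \<otimes> s) n"
  shows "large x y (n + 1 - (if x \<otimes> s \<preceq> y \<otimes> s then 1 else 0))"
proof -
  have c: "x \<in> carrier G" "y \<in> carrier G" using le_carr xy by blast+
  have xI: "x \<in> I x (y \<otimes> s)" using lift_up_dn[OF xy s u d] c by (simp add: I_iff)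
  note sub = half_sub[OF xy s u d]
  define h where "h = (\<lambda>z t. real_of_int (act z (al s) t))"
  have hspl: "h \<in> spl p q" for p q unfolding h_def using simple_spl[OF s] .
  have hs: "h (z \<otimes> s) t = - h z t" if "z \<in> carrier G" for z t
    using that s by (simp add: h_def act_lin)
  have "pos (act x (al s))" using act_al_pos[OF c(1) s u] .
  then obtain t0 where t0: "h x t0 > 0" by (auto simp: h_def pos_def)
  show ?thesis
  proof (cases "x \<otimes> s \<preceq> y \<otimes> s")
    case True
    \<comment> \<open>The multiple is read off in one coordinate where \<open>h x\<close> is
      nonzero, so that it is linear on all functions. The factor one half below reflects
      \<open>h z - h (z s) = 2 * h z\<close>.\<close>
    define \<kappa> where "\<kappa> = (\<lambda>f :: 'a \<Rightarrow> 'a \<Rightarrow> real. (f x t0 - f (x \<otimes> s) t0) / h x t0)"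
    define e where "e = (\<lambda>f z t. vext x y s (\<lambda>z t. f z t + - (\<kappa> f / 2) * h z t) z t + (\<kappa> f / 2) * h z t)"
    have e1: "e f z = f z" if "z \<in> I x (y \<otimes> s)" for f z using that by (simp add: e_def vext_def)
    have "large x y n"
    proof (rule large_pullback[OF l])
      fix a f g
      have "\<kappa> (\<lambda>z t. f z t + a * g z t) = \<kappa> f + a * \<kappa> g"
        using t0 by (simp add: \<kappa>_def field_simps)
      then show "e (\<lambda>z t. f z t + a * g z t) = (\<lambda>z t. e f z t + a * e g z t)"
        unfolding e_def by (simp add: vext_def fun_eq_iff algebra_simps add_divide_distrib)
    next
      fix f assume f: "f \<in> spl x (y \<otimes> s)"
      have xsI: "x \<otimes> s \<in> I x (y \<otimes> s)" using True le_up[OF c(1) s u] by (simp add: I_iff)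
      obtain c0 where c0: "\<forall>t. f x t - f (x \<otimes> s) t = c0 * h x t"
        using splD[OF f xI Rt_al[OF s]] xsI s unfolding par_def h_def by auto
      have k: "\<kappa> f = c0" using c0 t0 by (simp add: \<kappa>_def)
      have v: "f z t - f (z \<otimes> s) t = c0 * h z t" if "z \<in> I x (y \<otimes> s)" "z \<otimes> s \<in> I x (y \<otimes> s)" for z t
        using vertical[OF xy s u d f _ True that] c0 by (simp add: h_def)
      have "vext x y s (\<lambda>z t. f z t + - (\<kappa> f / 2) * h z t) \<in> spl x y"
      proof (rule vext_spl[OF xy s u d spl_lin[OF f hspl]])
        fix z assume z: "z \<in> I x (y \<otimes> s)" "z \<otimes> s \<in> I x (y \<otimes> s)"
        have "f z t + - (\<kappa> f / 2) * h z t = f (z \<otimes> s) t + - (\<kappa> f / 2) * h (z \<otimes> s) t" for t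
          using v[OF z, of t] hs[OF I_carr[OF z(1)], of t] by (simp add: k)
        then show "(\<lambda>t. f z t + - (\<kappa> f / 2) * h z t) = (\<lambda>t. f (z \<otimes> s) t + - (\<kappa> f / 2) * h (z \<otimes> s) t)" by blast
      qed
      then show "e f \<in> spl x y" unfolding e_def by (rule spl_lin) (rule hspl)
    next
      fix f :: "'a \<Rightarrow> 'a \<Rightarrow> real" and z assume "z \<in> I x (y \<otimes> s)" "f z \<noteq> f x"
      then show "\<exists>z\<in>I x y. e f z \<noteq> e f x" using e1 xI sub by metis
    qed
    then show ?thesis using True by simp
  next
    case False
    have nv: False if z: "z \<in> I x (y \<otimes> s)" "z \<otimes> s \<in> I x (y \<otimes> s)" for z
    proof -
      have zi: "x \<preceq> z" "x \<preceq> z \<otimes> s" "z \<preceq> y \<otimes> s" "z \<otimes> s \<preceq> y \<otimes> s" "z \<in> carrier G" using z I_carr by (simp_all add: I_iff)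
      show False
      proof (cases "up z s")
        case True
        then show False using le_trans[OF lift_up[OF zi(1) s True] zi(4)] False by blast
      next
        case F: False
        then have "up (z \<otimes> s) s" using len_step[OF zi(5) s] zi(5) s by simp
        then have "x \<otimes> s \<preceq> z" using lift_up[OF zi(2) s] zi(5) s by simp
        then show False using le_trans[OF _ zi(3)] False by blast
      qed
    qed
    \<comment> \<open>On \<open>[x, y]\<close> this is 0 inside \<open>[x, y s]\<close> and
      \<open>h\<close> outside it, because \<open>h\<close> changes sign under
      \<open>s\<close>.\<close>
    define k where "k = (\<lambda>z t. vext x y s (\<lambda>z t. 0 + - (1/2) * h z t) z t + (1/2) * h z t)"
    have k0: "k z t = 0" if "z \<in> I x (y \<otimes> s)" for z t using that by (simp add: k_def vext_def)
    have z0: "(\<lambda>z t. 0) \<in> spl p q" for p q unfolding spl_def par_def by (auto intro: exI[of _ 0])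
    have kspl: "k \<in> spl x y" unfolding k_def
      using spl_lin[OF vext_spl[OF xy s u d spl_lin[OF z0 hspl]] hspl] nv by blast
    have xs: "x \<otimes> s \<in> I x y" using le_up[OF c(1) s u] lift_dn[OF xy s d] by (simp add: I_iff)
    have "k (x \<otimes> s) t0 = - h x t0" using False c s hs[OF c(1)] by (simp add: k_def vext_def I_iff)
    then have "k (x \<otimes> s) t0 \<noteq> k x t0" using k0[OF xI, of t0] t0 by simp
    then have "k (x \<otimes> s) \<noteq> k x" by auto
    have "large x y (n + 1)"
    proof (rule large_pullback_Suc[OF l vext_lin[of x y s] _ kspl])
      show "vext x y s f \<in> spl x y" if "f \<in> spl x (y \<otimes> s)" for f
        using vext_spl[OF xy s u d that] nv by blast
      show "\<exists>z\<in>I x y. k z \<noteq> k x" using xs \<open>k (x \<otimes> s) \<noteq> k x\<close> by blast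
    next
      fix f :: "'a \<Rightarrow> 'a \<Rightarrow> real" and z a assume f: "z \<in> I x (y \<otimes> s)" "f z \<noteq> f x"
      have "(\<lambda>t. vext x y s f z t + a * k z t) \<noteq> (\<lambda>t. vext x y s f x t + a * k x t)"
        using f k0[OF f(1)] k0[OF xI] xI by (simp add: vext_def)
      then show "\<exists>z\<in>I x y. (\<lambda>t. vext x y s f z t + a * k z t) \<noteq> (\<lambda>t. vext x y s f x t + a * k x t)"
        using sub[OF f(1)] by blast
    qed
    then show ?thesis using False by simp
  qed
qed

text \<open>If \<open>x\<close> is not below \<open>y s\<close>, right multiplication by
  \<open>s\<close> identifies \<open>[x, y]\<close> with \<open>[x s, y s]\<close>. Otherwise go
  through \<open>[x s, y]\<close> and restrict: a spline that is constant on \<open>[x, y]\<close>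
  is constant along \<open>{x s, x}\<close> by the ladder, and then everywhere by
  \<open>atom_generates\<close>.\<close>

lemma large_dn:
  assumes xy: "x \<preceq> y" and s: "s \<in> S" and dx: "dn x s" and d: "dn y s" and l: "large (x \<otimes> s) (y \<otimes> s) n"
  shows "large x y n"
proof -
  have c: "x \<in> carrier G" "y \<in> carrier G" using le_carr xy by blast+
  have u: "up (x \<otimes> s) s" using c dx s by simp
  show ?thesis
  proof (cases "x \<preceq> y \<otimes> s")
    case False
    define e where "e = (\<lambda>(f :: 'a \<Rightarrow> 'a \<Rightarrow> real) z. f (z \<otimes> s))"
    have zs: "z \<otimes> s \<in> I (x \<otimes> s) (y \<otimes> s)" if "z \<in> I x y" for z
    proof -
      have z: "x \<preceq> z" "z \<preceq> y" "z \<in> carrier G" using that I_carr by (simp_all add: I_iff)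
      have "\<not> up z s" using lift_up_dn[OF z(2) s _ d] le_trans[OF z(1)] False by blast
      then have dz: "dn z s" using len_step[OF z(3) s] by linarith
      show ?thesis using lift_dn_dn[OF z(1) s dx dz] lift_dn_dn[OF z(2) s dz d] by (simp add: I_iff)
    qed
    have sz: "z \<otimes> s \<in> I x y" if "z \<in> I (x \<otimes> s) (y \<otimes> s)" for z
    proof -
      have z: "x \<otimes> s \<preceq> z" "z \<preceq> y \<otimes> s" "z \<in> carrier G" using that I_carr by (simp_all add: I_iff)
      have "\<not> dn z s" using lift_dn[OF z(1) s] le_trans[OF _ z(2)] False c s by auto
      then have uz: "up z s" using len_step[OF z(3) s] by linarith
      show ?thesis using lift_up[OF z(1) s uz] lift_up[OF z(2) s] d c s by (simp add: I_iff)
    qed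
    show ?thesis
    proof (rule large_pullback[OF l, of e])
      show "e (\<lambda>z t. f z t + a * g z t) = (\<lambda>z t. e f z t + a * e g z t)" for a f g by (simp add: e_def)
    next
      fix f assume f: "f \<in> spl (x \<otimes> s) (y \<otimes> s)"
      have "par (e f) z (z \<otimes> rf b) b" if z: "z \<in> I x y" "b \<in> Rt" "z \<otimes> rf b \<in> I x y" for z b
        unfolding par_def e_def using par_s[OF I_carr[OF z(1)] z(2) s zs[OF z(1)] zs[OF z(3)] f] .
      then show "e f \<in> spl x y" by (simp add: spl_def)
    next
      fix f :: "'a \<Rightarrow> 'a \<Rightarrow> real" and z assume z: "z \<in> I (x \<otimes> s) (y \<otimes> s)" "f z \<noteq> f (x \<otimes> s)"
      have "e f (z \<otimes> s) \<noteq> e f x" using z(2) I_carr[OF z(1)] s by (simp add: e_def)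
      then show "\<exists>z\<in>I x y. e f z \<noteq> e f x" using sz[OF z(1)] by blast
    qed
  next
    case True
    have xy': "x \<otimes> s \<preceq> y" using le_trans[OF le_dn[OF c(1) s dx] xy] .
    \<comment> \<open>The bound stays \<open>n\<close> because \<open>x s s = x\<close> is below
      \<open>y s\<close>.\<close>
    have "large (x \<otimes> s) y n" using large_up[OF xy' s u d l] True c s by simp
    then show ?thesis
    proof (rule large_pullback[where e="\<lambda>f. f"])
      show "f \<in> spl x y" if "f \<in> spl (x \<otimes> s) y" for f
        using that spl_mono[OF le_dn[OF c(1) s dx] le_refl[OF c(2)]] by blast
    next
      fix f :: "'a \<Rightarrow> 'a \<Rightarrow> real" and z assume f: "f \<in> spl (x \<otimes> s) y" "z \<in> I (x \<otimes> s) y" "f z \<noteq> f (x \<otimes> s)"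
      let ?K = "{e \<in> E (x \<otimes> s) y. \<forall>z w. e = {z, w} \<longrightarrow> f z = f w}"
      show "\<exists>z\<in>I x y. f z \<noteq> f x"
      proof (rule ccontr)
        assume "\<not> ?thesis"
        then have c1: "f z = f x" if "z \<in> I x y" for z using that by blast
        have cl: "diamond_closed (x \<otimes> s) y ?K" using spl_closed[OF f(1)] .
        have sub: "E x y \<subseteq> ?K"
        proof
          fix e assume e: "e \<in> E x y"
          have "f z = f w" if "e = {z, w}" for z w
            using e c1[of z] c1[of w] unfolding that E_iff by simp
          then show "e \<in> ?K" using e E_mono[OF le_dn[OF c(1) s dx] le_refl[OF c(2)]] by blast
        qed
        have lad: "{x \<otimes> s, x} \<in> ?K"
          using ladder[of "x \<otimes> s" y \<one> s ?K] c s d u True cl sub len_step[OF c(1) s] dx by simp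
        have at: "atom (x \<otimes> s) y x" using step_dn[OF c(1) s dx] xy dx len_step[OF c(1) s] by (simp add: atom_def)
        have all: "E (x \<otimes> s) y \<subseteq> ?K" using atom_generates[OF at cl lad sub] .
        have "f z = f (x \<otimes> s)"
        proof (rule const_edges[OF _ f(2)])
          fix z w assume "{z, w} \<in> E (x \<otimes> s) y"
          then show "f z = f w" using all by blast
        qed
        then show False using f(3) by blast
      qed
    qed simp
  qed
qed

lemma large_dz: "x \<preceq> y \<Longrightarrow> large x y (dz x y)"
proof (induct "len y" arbitrary: x y rule: less_induct)
  case less
  note xy = less.prems
  have c: "x \<in> carrier G" "y \<in> carrier G" using le_carr xy by blast+
  show ?case
  proof (cases "x = y")
    case True
    then show ?thesis by (simp add: large_def)
  next
    case False
    then have "y \<noteq> \<one>" using le_len[OF xy] by auto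
    then obtain s where s: "s \<in> S" "dn y s" using ex_descent c by blast
    show ?thesis
    proof (cases "up x s")
      case True
      then show ?thesis
        using large_up[OF xy s(1) True s(2) less.hyps[OF s(2) lift_up_dn[OF xy s(1) True s(2)]]] dz_up[OF xy s(1) True s(2)] by simp
    next
      case F: False
      then have d: "dn x s" using len_step[OF c(1) s(1)] by linarith
      show ?thesis
        using large_dn[OF xy s(1) d s(2) less.hyps[OF s(2) lift_dn_dn[OF xy s(1) d s(2)]]] dz_dn[OF c s(1) d s(2)] by simp
    qed
  qed
qed

lemma generating_lower:
  assumes xy: "x \<preceq> y" and F: "diamond_generating x y F" "finite F"
  shows "dz x y \<le> int (card F)"
proof (rule ccontr)
  assume "\<not> ?thesis"
  then have less: "int (card F) < dz x y" by simp
  have sub: "F \<subseteq> E x y" and gen: "\<And>K. diamond_closed x y K \<Longrightarrow> F \<subseteq> K \<Longrightarrow> E x y \<subseteq> K"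
    using F(1) by (simp_all add: generating_iff)
  have "\<exists>z b t. e = {z, z \<otimes> rf b} \<and> z \<in> I x y \<and> z \<otimes> rf b \<in> I x y \<and> b \<in> Rt \<and> act z b t \<noteq> 0" if e: "e \<in> F" for e
  proof -
    obtain z w where z: "e = {z, w}" "z \<in> I x y" "w \<in> I x y" "bruhat_step z w" using E_cases e sub by blast
    then obtain b where b: "b \<in> PR" "w = z \<otimes> rf b" "pos (act z b)" by (auto simp: step_iff)
    obtain t where "act z b t > 0" using b(3) by (auto simp: pos_def)
    then have "act z b t \<noteq> 0" by simp
    then show ?thesis using z b PR_Rt by blast
  qed
  then obtain Z B T where ZBT: "\<And>e. e \<in> F \<Longrightarrow> e = {Z e, Z e \<otimes> rf (B e)} \<and> Z e \<in> I x y \<and> Z e \<otimes> rf (B e) \<in> I x y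
      \<and> B e \<in> Rt \<and> act (Z e) (B e) (T e) \<noteq> 0"
    by metis
  \<comment> \<open>One scalar condition per edge suffices: a spline difference is a multiple of the
    label, so it is zero once it vanishes in a coordinate where the label does not.\<close>
  define \<Phi> where "\<Phi> = (\<lambda>e f :: 'a \<Rightarrow> 'a \<Rightarrow> real. f (Z e) (T e) - f (Z e \<otimes> rf (B e)) (T e)) ` F"
  have l: "lin \<phi>" if "\<phi> \<in> \<Phi>" for \<phi> using that by (auto simp: \<Phi>_def lin_def algebra_simps)
  have "int (card \<Phi>) < dz x y"
    using less card_image_le[OF F(2), of "\<lambda>e f :: 'a \<Rightarrow> 'a \<Rightarrow> real. f (Z e) (T e) - f (Z e \<otimes> rf (B e)) (T e)"]
    by (simp add: \<Phi>_def)
  moreover have "finite \<Phi>" using F(2) by (simp add: \<Phi>_def)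
  ultimately obtain f where f: "f \<in> spl x y" "\<forall>\<phi>\<in>\<Phi>. \<phi> f = 0" "\<exists>z\<in>I x y. f z \<noteq> f x"
    using largeD[OF large_dz[OF xy] _ l] by blast
  let ?K = "{e \<in> E x y. \<forall>z w. e = {z, w} \<longrightarrow> f z = f w}"
  have "F \<subseteq> ?K"
  proof
    fix e assume e: "e \<in> F"
    note Q = ZBT[OF e]
    obtain c where c: "\<forall>t. f (Z e) t - f (Z e \<otimes> rf (B e)) t = c * real_of_int (act (Z e) (B e) t)"
      using splD[OF f(1)] Q unfolding par_def by blast
    have "f (Z e) (T e) - f (Z e \<otimes> rf (B e)) (T e) = 0" using f(2) e by (simp add: \<Phi>_def)
    then have "c = 0" using c Q by simp
    then have eq: "f (Z e) = f (Z e \<otimes> rf (B e))" using c by auto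
    have "f z = f w" if "e = {z, w}" for z w
      using Q that eq by (metis doubleton_eq_iff)
    then show "e \<in> ?K" using e sub by blast
  qed
  then have "E x y \<subseteq> ?K" using gen[OF spl_closed[OF f(1)]] by blast
  then have "f z = f x" if "z \<in> I x y" for z using const_edges[OF _ that, of f] by blast
  then show False using f(3) by blast
qed

lemma finite_edges: "finite (E x y)"
proof -
  have "E x y \<subseteq> Pow (carrier G)" using I_carr by (auto simp: bruhat_edges_def)
  then show ?thesis using finite_subset fin by blast
qed

lemma d_coeff_eq_g_min: "bruhat_less x y \<Longrightarrow> d_coeff x y = int (g_min x y)"
proof -
  assume "bruhat_less x y"
  then have xy: "x \<preceq> y" "x \<noteq> y" by (simp_all add: bruhat_less_def)
  obtain F where F: "diamond_generating x y F" "int (card F) \<le> dz x y" using generating_upper[OF xy(1)] by blast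
  have lower: "dz x y \<le> int (card F')" if "diamond_generating x y F'" for F'
  proof -
    \<comment> \<open>Finiteness matters here, since an infinite set would have \<open>card\<close>
      0.\<close>
    have "F' \<subseteq> E x y" using that by (simp add: diamond_generating_def)
    then show ?thesis using generating_lower[OF xy(1) that] finite_subset[OF _ finite_edges] by blast
  qed
  have "g_min x y = card F"
    unfolding g_min_def
  proof (rule Least_equality)
    show "\<exists>F'. diamond_generating x y F' \<and> card F' = card F" using F by blast
    show "card F \<le> n" if "\<exists>F'. diamond_generating x y F' \<and> card F' = n" for n
      using that lower F(2) by force
  qed
  then show ?thesis using lower[OF F(1)] F(2) xy by (simp add: dz_def)
qed

end

theorem theorem6p1:
  fixes G :: "('a, 'b) monoid_scheme" and S :: "'a set" and x y :: 'a
  assumes "coxeter_system G S"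
    and "finite (carrier G)"
    and "\<forall>s \<in> S. \<forall>t \<in> S. group.ord G (s \<otimes>\<^bsub>G\<^esub> t) \<le> 3"
    and "x \<in> carrier G" and "y \<in> carrier G"
    and "coxeter_system.bruhat_less G S x y"
  shows "coxeter_system.d_coeff G S x y = int (coxeter_system.g_min G S x y)"
proof -
  interpret coxeter_system G S by fact
  interpret simply_laced G S by unfold_locales (use assms in simp_all)
  show ?thesis using d_coeff_eq_g_min assms(6) by blast
qed

end
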